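(* Let $G=\mathrm{SL}_3(\mathbb{R})$, $\Gamma=\mathrm{SL}_3(\mathbb{Z})$. Let $\lambda,\mu\ge 0$ with $\lambda+\mu=1$ and $\lambda\ge\mu$, let $g_t=\mathrm{diag}(e^{\lambda t},e^{\mu t},e^{-t})$ and $F^+_{\lambda,\mu}=\{g_t:t\ge 0\}$, and let $$U=\{u_{x,y,z}:(x,y,z)\in\mathbb{R}^3\},\qquad u_{x,y,z}=\begin{pmatrix}1&z&x\\0&1&y\\0&0&1\end{pmatrix}\in G.$$ Then the set $$\{u\in U: u\Gamma\in E(F^+_{\lambda,\mu})\},\qquad\text{where } E(F^+_{\lambda,\mu})=\{\Lambda\in G/\Gamma: F^+_{\lambda,\mu}\Lambda\text{ is bounded}\},$$ is HAW on $U$.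
   Context: $G$ acts on $G/\Gamma$ by left translations; a subset of $G/\Gamma$ is bounded if it is contained in a compact subset. Hyperplane absolute game. Let $W\subset\mathbb{R}^d$ be open, $S\subset\mathbb{R}^d$ a target set, $\beta\in(0,\frac13)$. For an affine hyperplane $L\subset\mathbb{R}^d$ and $\rho>0$ put $L^{(\rho)}=\{\mathbf{x}\in\mathbb{R}^d:\mathrm{dist}(\mathbf{x},L)<\rho\}$. Bob begins by choosing a closed ball $B_0\subset W$ of radius $\rho_0>0$. After Bob chooses a closed ball $B_i$ of radius $\rho_i$, Alice chooses a hyperplane neighborhood $L_i^{(\rho_i')}$ with $\rho_i'\le\beta\rho_i$, and then Bob chooses a closed ball $B_{i+1}\subset B_i\setminus L_i^{(\rho_i')}$ of radius $\rho_{i+1}\ge\beta\rho_i$. Alice wins if and only if $\bigcap_{i=0}^\infty B_i\cap S\neq\varnothing$. The set $S$ is HAW (hyperplane absolute winning) on $W$ if for every $\beta\in(0,\frac13)$ Alice has a winning strategy. HAW on a manifold. Let $M$ be a $d$-dimensional $C^1$ manifold with a $C^1$ atlas $\{(U_\alpha,\varphi_\alpha)\}$ ($\varphi_\alpha$ a $C^1$ diffeomorphism from $U_\alpha$ onto an open subset of $\mathbb{R}^d$). A subset $S\subset M$ is HAW on $M$ if for each $\alpha$ the set $\varphi_\alpha(S\cap U_\alpha)$ is HAW on $\varphi_\alpha(U_\alpha)$. (This is independent of the choice of atlas; $U$ above is a manifold diffeomorphic to $\mathbb{R}^3$ via $(x,y,z)\mapsto u_{x,y,z}$.) *)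

theory Defs
  imports "HOL-Analysis.Analysis" "HOL-Algebra.Left_Coset"
begin

section \<open>The hyperplane absolute game\<close>

definition affine_hyperplane :: "(real ^ 'd) set \<Rightarrow> bool" where
  "affine_hyperplane L \<longleftrightarrow> (\<exists>a b. a \<noteq> 0 \<and> L = {x. a \<bullet> x = b})"

definition hyperplane_nbhd :: "(real ^ 'd) set \<Rightarrow> real \<Rightarrow> (real ^ 'd) set" where
  "hyperplane_nbhd L \<rho> = {x. infdist x L < \<rho>}"

text \<open>A move of Bob is a pair of a centre and a radius. A strategy of Alice maps the list of
  Bob's moves so far (earliest first) to a pair of a hyperplane and the radius of its
  neighbourhood.\<close>

type_synonym 'd ball_move = "(real ^ 'd) \<times> real"
type_synonym 'd alice_strategy = "'d ball_move list \<Rightarrow> (real ^ 'd) set \<times> real"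

definition move_ball :: "'d::finite ball_move \<Rightarrow> (real ^ 'd) set" where
  "move_ball B = cball (fst B) (snd B)"

definition alice_nbhd :: "'d::finite alice_strategy \<Rightarrow> 'd ball_move list \<Rightarrow> (real ^ 'd) set" where
  "alice_nbhd \<sigma> h = hyperplane_nbhd (fst (\<sigma> h)) (snd (\<sigma> h))"

text \<open>Legality is demanded for every nonempty list of balls of positive radius, including lists
  that cannot occur in a play; there it is no restriction on Alice, as legal answers always
  exist.\<close>

definition legal_strategy :: "real \<Rightarrow> 'd::finite alice_strategy \<Rightarrow> bool" where
  "legal_strategy \<beta> \<sigma> \<longleftrightarrow>
     (\<forall>h. h \<noteq> [] \<and> (\<forall>B\<in>set h. 0 < snd B) \<longrightarrow>
        affine_hyperplane (fst (\<sigma> h)) \<and> 0 < snd (\<sigma> h) \<and> snd (\<sigma> h) \<le> \<beta> * snd (last h))"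

definition legal_play ::
  "(real ^ 'd) set \<Rightarrow> real \<Rightarrow> 'd::finite alice_strategy \<Rightarrow> (nat \<Rightarrow> 'd ball_move) \<Rightarrow> bool" where
  "legal_play W \<beta> \<sigma> B \<longleftrightarrow>
     move_ball (B 0) \<subseteq> W \<and> (\<forall>i. 0 < snd (B i)) \<and>
     (\<forall>i. move_ball (B (Suc i)) \<subseteq> move_ball (B i) - alice_nbhd \<sigma> (map B [0..<Suc i]) \<and>
          \<beta> * snd (B i) \<le> snd (B (Suc i)))"

definition winning_strategy ::
  "(real ^ 'd) set \<Rightarrow> (real ^ 'd) set \<Rightarrow> real \<Rightarrow> 'd::finite alice_strategy \<Rightarrow> bool" where
  "winning_strategy W S \<beta> \<sigma> \<longleftrightarrow>
     legal_strategy \<beta> \<sigma> \<and> (\<forall>B. legal_play W \<beta> \<sigma> B \<longrightarrow> (\<Inter>i. move_ball (B i)) \<inter> S \<noteq> {})"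

definition HAW_on :: "(real ^ 'd::finite) set \<Rightarrow> (real ^ 'd) set \<Rightarrow> bool" where
  "HAW_on W S \<longleftrightarrow> (\<forall>\<beta>. 0 < \<beta> \<and> \<beta> < 1/3 \<longrightarrow> (\<exists>\<sigma>. winning_strategy W S \<beta> \<sigma>))"


section \<open>HAW subsets of manifolds\<close>

definition C1_on :: "'a::euclidean_space set \<Rightarrow> ('a \<Rightarrow> 'b::euclidean_space) \<Rightarrow> bool" where
  "C1_on A f \<longleftrightarrow>
     (\<exists>f'. (\<forall>x\<in>A. (f has_derivative blinfun_apply (f' x)) (at x)) \<and> continuous_on A f')"

text \<open>The manifold is a subset \<open>M\<close> of an ambient space with its subspace topology; an atlas is a
  set of pairs of a chart domain and a chart map. The map is irrelevant outside the domain.\<close>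

definition C1_atlas ::
  "'m::topological_space set \<Rightarrow> ('m set \<times> ('m \<Rightarrow> real ^ 'd::finite)) set \<Rightarrow> bool" where
  "C1_atlas M \<A> \<longleftrightarrow>
     (\<Union>(U, \<phi>)\<in>\<A>. U) = M \<and>
     (\<forall>(U, \<phi>)\<in>\<A>. openin (top_of_set M) U \<and> open (\<phi> ` U) \<and> (\<exists>\<psi>. homeomorphism U (\<phi> ` U) \<phi> \<psi>)) \<and>
     (\<forall>(U, \<phi>)\<in>\<A>. \<forall>(V, \<psi>)\<in>\<A>. C1_on (\<phi> ` (U \<inter> V)) (\<psi> \<circ> the_inv_into U \<phi>))"

definition HAW_on_manifold ::
  "'m::topological_space set \<Rightarrow> ('m set \<times> ('m \<Rightarrow> real ^ 'd::finite)) set \<Rightarrow> 'm set \<Rightarrow> bool" where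
  "HAW_on_manifold M \<A> S \<longleftrightarrow>
     C1_atlas M \<A> \<and> S \<subseteq> M \<and> (\<forall>(U, \<phi>)\<in>\<A>. HAW_on (\<phi> ` U) (\<phi> ` (S \<inter> U)))"


section \<open>The homogeneous space\<close>

definition SL3R :: "(real ^ 3 ^ 3) monoid" where
  "SL3R = \<lparr>carrier = {A. det A = 1}, mult = (**), one = mat 1\<rparr>"

definition SL3Z :: "(real ^ 3 ^ 3) set" where
  "SL3Z = {A. det A = 1 \<and> (\<forall>i j. A $ i $ j \<in> \<int>)}"

definition quotient_topology :: "'a topology \<Rightarrow> ('a \<Rightarrow> 'b) \<Rightarrow> 'b topology" where
  "quotient_topology X q =
     topology (\<lambda>V. V \<subseteq> q ` topspace X \<and> openin X {x \<in> topspace X. q x \<in> V})"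

lemma openin_quotient_topology:
  "openin (quotient_topology X q) V \<longleftrightarrow>
     V \<subseteq> q ` topspace X \<and> openin X {x \<in> topspace X. q x \<in> V}"
proof -
  let ?L = "\<lambda>V. V \<subseteq> q ` topspace X \<and> openin X {x \<in> topspace X. q x \<in> V}"
  have "?L (S \<inter> T)" if "?L S" "?L T" for S T
  proof -
    have "{x \<in> topspace X. q x \<in> S \<inter> T} = {x \<in> topspace X. q x \<in> S} \<inter> {x \<in> topspace X. q x \<in> T}"
      by auto
    then show ?thesis
      using that by auto
  qed
  moreover have "?L (\<Union>\<K>)" if "\<forall>K\<in>\<K>. ?L K" for \<K>
  proof -
    have "{x \<in> topspace X. q x \<in> \<Union>\<K>} = (\<Union>K\<in>\<K>. {x \<in> topspace X. q x \<in> K})"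
      by auto
    moreover have "openin X (\<Union>K\<in>\<K>. {x \<in> topspace X. q x \<in> K})"
      using that by (intro openin_Union) auto
    ultimately show ?thesis
      using that by (auto 0 3)
  qed
  ultimately have "istopology ?L"
    unfolding istopology_def by blast
  then show ?thesis
    unfolding quotient_topology_def by simp
qed

lemma topspace_quotient_topology: "topspace (quotient_topology X q) = q ` topspace X"
proof -
  have "{x \<in> topspace X. q x \<in> q ` topspace X} = topspace X"
    by auto
  then have "openin (quotient_topology X q) (q ` topspace X)"
    by (simp add: openin_quotient_topology)
  then show ?thesis
    by (metis openin_quotient_topology openin_subset openin_topspace subset_antisym)
qed

lemma quotient_map_quotient_topology: "quotient_map X (quotient_topology X q) q"
  by (simp add: quotient_map_def topspace_quotient_topology openin_quotient_topology)

text \<open>The points of the homogeneous space are the left cosets of \<^const>\<open>SL3Z\<close>.\<close>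

definition SL3_quotient :: "(real ^ 3 ^ 3) set topology" where
  "SL3_quotient =
     quotient_topology (top_of_set (carrier SL3R)) (\<lambda>g. g <#\<^bsub>SL3R\<^esub> SL3Z)"

lemma topspace_SL3_quotient: "topspace SL3_quotient = lcosets\<^bsub>SL3R\<^esub> SL3Z"
  by (auto simp: SL3_quotient_def topspace_quotient_topology LCOSETS_def)

definition bounded_in_quotient :: "(real ^ 3 ^ 3) set set \<Rightarrow> bool" where
  "bounded_in_quotient A \<longleftrightarrow> (\<exists>K. compactin SL3_quotient K \<and> A \<subseteq> K)"

text \<open>Left translation of a coset \<open>\<Lambda>\<close> by \<open>g\<close> is again \<open>g <# \<Lambda>\<close>, the elementwise product.\<close>

definition orbit :: "(real ^ 3 ^ 3) set \<Rightarrow> (real ^ 3 ^ 3) set \<Rightarrow> (real ^ 3 ^ 3) set set" where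
  "orbit F \<Lambda> = (\<lambda>g. g <#\<^bsub>SL3R\<^esub> \<Lambda>) ` F"

definition bounded_orbit_points :: "(real ^ 3 ^ 3) set \<Rightarrow> (real ^ 3 ^ 3) set set" where
  "bounded_orbit_points F =
     {\<Lambda> \<in> lcosets\<^bsub>SL3R\<^esub> SL3Z. bounded_in_quotient (orbit F \<Lambda>)}"

definition diag_flow :: "real \<Rightarrow> real \<Rightarrow> real \<Rightarrow> real ^ 3 ^ 3" where
  "diag_flow lam mu t = vector
     [vector [exp (lam * t), 0, 0],
      vector [0, exp (mu * t), 0],
      vector [0, 0, exp (- t)]]"

definition F_plus :: "real \<Rightarrow> real \<Rightarrow> (real ^ 3 ^ 3) set" where
  "F_plus lam mu = {diag_flow lam mu t | t. 0 \<le> t}"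

definition u_mat :: "real \<Rightarrow> real \<Rightarrow> real \<Rightarrow> real ^ 3 ^ 3" where
  "u_mat x y z = vector
     [vector [1, z, x],
      vector [0, 1, y],
      vector [0, 0, 1]]"

definition U_group :: "(real ^ 3 ^ 3) set" where
  "U_group = {u_mat x y z | x y z. True}"

text \<open>The manifold structure of \<^const>\<open>U_group\<close> is given by one global chart, the inverse of
  \<open>(x, y, z) \<mapsto> u_mat x y z\<close>.\<close>

definition U_chart :: "real ^ 3 ^ 3 \<Rightarrow> real ^ 3" where
  "U_chart A = vector [A $ 1 $ 3, A $ 2 $ 3, A $ 1 $ 2]"

lemma U_chart_u_mat: "U_chart (u_mat x y z) = vector [x, y, z]"
  by (simp add: U_chart_def u_mat_def)

definition U_atlas :: "((real ^ 3 ^ 3) set \<times> (real ^ 3 ^ 3 \<Rightarrow> real ^ 3)) set" where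
  "U_atlas = {(U_group, U_chart)}"

end

theory Submission
  imports Defs
begin

text \<open>By Mahler's criterion the orbit of the lattice with parameters \<open>P = (x, y, z)\<close> is bounded as soon as
  its vectors stay away from zero along the flow, and this holds if, for some \<open>\<epsilon> > 0\<close>, the point \<open>P\<close> lies
  in none of the danger sets
  \<open>\<bar>p + z r + x q\<bar> < \<epsilon> q powr - \<lambda>\<close>, \<open>\<bar>r + y q\<bar> < \<epsilon> q powr - \<mu>\<close> of the integer vectors \<open>v = (p, r, q)\<close> with \<open>q > 0\<close>
  (lemma \<open>bounded_orbit_if_not_danger\<close>). Each danger set is a thin neighbourhood of a line, and Alice has
  to steer the outcome of the game away from all of them.

  If \<open>P\<close> lies in the danger set of \<open>v\<close>, the pigeonhole principle gives an integer dual vector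
  \<open>w = (A, B, C)\<close> orthogonal to \<open>v\<close> with \<open>\<bar>A\<bar> \<le> q powr \<lambda>\<close> and \<open>\<bar>B - z A\<bar> \<le> 2 q powr \<mu>\<close>. Put
  \<open>H = q max \<bar>A\<bar> \<bar>B - z A\<bar>\<close>. Near \<open>P\<close> the danger set lies within about \<open>\<epsilon> / H\<close> of a plane that is determined
  by \<open>w\<close>. The vectors with \<open>q\<close> in a dyadic interval \<open>[Q, 2 Q)\<close> are dealt with when
  the ball of Bob has a radius \<open>\<rho>\<close> for which \<open>H \<rho>\<close> is, up to a constant, about
  \<open>max 1 ((Q powr (1 + \<lambda>) \<rho> / K0) powr (1 / 4))\<close>. The arithmetic core
  (lemma \<open>plane_or_point\<close>) says that for such a class either one plane covers all its danger sets in the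
  ball, or two of the dual vectors are not parallel and their cross product is, up to sign, an integer vector
  with a smaller last coordinate whose danger set contains the whole ball. If the outcome
  lay in some danger set, then for a vector with least \<open>q\<close> among those whose danger set contains it the second
  case would be excluded, so the outcome would be close to the plane, which Alice has avoided (lemma
  \<open>outcome_not_danger\<close>).

  At radius \<open>\<rho>\<close> Alice thus has to avoid finitely many planes, with thicknesses \<open>\<eta> \<rho> t ^ k\<close> for a fixed \<open>t < 1\<close>.
  She can do so with single deletions (lemma \<open>potential_game_winning\<close>): the neighbourhood of thickness \<open>\<tau>\<close> gets the
  weight \<open>\<tau> powr \<gamma>\<close>. The hyperplanes that meet a ball fall into \<open>M\<close> classes, each of which is contained in one
  permitted deletion, with \<open>M\<close> depending on \<open>\<beta>\<close> and the dimension only. At every other move Alice deletes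
  the class of greatest weight, and for small \<open>\<gamma>\<close> the loss of the fraction \<open>1 / M\<close> outweighs the shrinking
  of the ball in two moves. At the remaining moves she deletes a hyperplane through the centre, which forces
  the radii to tend to zero.\<close>


section \<open>Neighbourhoods of hyperplanes\<close>

lemma mem_hyperplane_nbhd_iff:
  fixes a :: "real ^ 'd::finite"
  assumes a: "norm a = 1"
  shows "x \<in> hyperplane_nbhd {y. a \<bullet> y = b} \<tau> \<longleftrightarrow> \<bar>a \<bullet> x - b\<bar> < \<tau>"
proof -
  let ?L = "{y. a \<bullet> y = b}"
  have aa: "a \<bullet> a = 1"
    using a by (simp add: norm_eq_1)
  define y where "y = x - (a \<bullet> x - b) *\<^sub>R a"
  have y: "y \<in> ?L"
    by (simp add: y_def inner_diff_right aa)
  have "infdist x ?L \<le> dist x y"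
    using y by (rule infdist_le)
  also have "dist x y = \<bar>a \<bullet> x - b\<bar>"
    using a by (simp add: y_def dist_norm)
  finally have le: "infdist x ?L \<le> \<bar>a \<bullet> x - b\<bar>" .
  have "\<bar>a \<bullet> x - b\<bar> \<le> dist x z" if "z \<in> ?L" for z
  proof -
    have "\<bar>a \<bullet> x - b\<bar> = \<bar>a \<bullet> (x - z)\<bar>"
      using that by (simp add: inner_diff_right)
    also have "\<dots> \<le> norm a * norm (x - z)"
      by (rule Cauchy_Schwarz_ineq2)
    finally show ?thesis
      using a by (simp add: dist_norm)
  qed
  then have "\<bar>a \<bullet> x - b\<bar> \<le> infdist x ?L"
    using y by (auto simp: infdist_def intro!: cINF_greatest)
  with le show ?thesis
    by (simp add: hyperplane_nbhd_def)
qed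

lemma affine_hyperplane_unit_normal:
  assumes "affine_hyperplane L"
  obtains a b where "norm a = 1" "L = {x. a \<bullet> x = b}"
proof -
  obtain a b where ab: "a \<noteq> 0" "L = {x. a \<bullet> x = b}"
    using assms by (auto simp: affine_hyperplane_def)
  show ?thesis
  proof
    show "norm (a /\<^sub>R norm a) = 1"
      using ab by simp
    show "L = {x. (a /\<^sub>R norm a) \<bullet> x = b / norm a}"
      using ab by (auto simp: field_simps)
  qed
qed

lemma affine_hyperplaneI: "norm a = 1 \<Longrightarrow> affine_hyperplane {x. a \<bullet> x = b}"
  unfolding affine_hyperplane_def by (rule exI[of _ a], rule exI[of _ b]) auto

text \<open>The hyperplanes close to the unit ball have parameters (unit normal, offset) in a compact set. A finite
  net of it sorts the thin hyperplane neighbourhoods that meet a ball into boundedly many classes, each of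
  them contained, inside the ball, in a single neighbourhood of thickness \<open>\<beta> \<rho>\<close>.\<close>

lemma exists_hyperplane_capturing_fraction:
  fixes \<beta> :: real
  assumes \<beta>: "0 < \<beta>" "\<beta> < 1"
  obtains M :: nat where "2 \<le> M"
    "\<forall>(c :: real ^ 'd::finite) \<rho> \<A> f. 0 < \<rho> \<longrightarrow> finite \<A> \<longrightarrow>
      (\<forall>A\<in>\<A>. affine_hyperplane (fst A) \<and> snd A \<le> \<beta> / 4 * \<rho>
        \<and> hyperplane_nbhd (fst A) (snd A) \<inter> cball c \<rho> \<noteq> {} \<and> 0 \<le> f A) \<longrightarrow>
      (\<exists>L. affine_hyperplane L \<and>
        sum f {A \<in> \<A>. \<not> hyperplane_nbhd (fst A) (snd A) \<inter> cball c \<rho>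
                          \<subseteq> hyperplane_nbhd L (\<beta> * \<rho>)}
          \<le> (1 - 1 / M) * sum f \<A>)"
proof -
  define T :: "((real ^ 'd) \<times> real) set" where "T = sphere 0 1 \<times> cball 0 2"
  have "compact T"
    unfolding T_def by (intro compact_Times) auto
  then obtain k where k: "finite k" "k \<subseteq> T" "T \<subseteq> (\<Union>t\<in>k. ball t (\<beta> / 4))"
    using \<beta> seq_compact_imp_totally_bounded[OF compact_imp_seq_compact, of T]
    by (metis divide_pos_pos zero_less_numeral)
  define M where "M = card k + 2"
  have main: "\<exists>L. affine_hyperplane L \<and>
        sum f {A \<in> \<A>. \<not> hyperplane_nbhd (fst A) (snd A) \<inter> cball c \<rho>
                          \<subseteq> hyperplane_nbhd L (\<beta> * \<rho>)}
          \<le> (1 - 1 / M) * sum f \<A>"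
    if \<rho>: "0 < \<rho>" and fin: "finite \<A>" and
      \<A>: "\<And>A. A \<in> \<A> \<Longrightarrow> affine_hyperplane (fst A) \<and> snd A \<le> \<beta> / 4 * \<rho>
        \<and> hyperplane_nbhd (fst A) (snd A) \<inter> cball c \<rho> \<noteq> {} \<and> 0 \<le> f A"
    for c :: "real ^ 'd" and \<rho> \<A> f
  proof -
    define slab where "slab = (\<lambda>t :: (real ^ 'd) \<times> real. {x. fst t \<bullet> x = \<rho> * snd t + fst t \<bullet> c})"
    define N where "N = (\<lambda>A. hyperplane_nbhd (fst A) (snd A) \<inter> cball c \<rho>)"
    have hyp: "affine_hyperplane (slab t)" if "t \<in> k" for t
      using k(2) that unfolding slab_def T_def by (intro affine_hyperplaneI) auto
    have cov: "\<exists>t\<in>k. N A \<subseteq> hyperplane_nbhd (slab t) (\<beta> * \<rho>)" if A: "A \<in> \<A>" for A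
    proof -
      obtain a b where ab: "norm a = 1" "fst A = {x. a \<bullet> x = b}"
        using \<A>[OF A] affine_hyperplane_unit_normal by metis
      have sA: "snd A \<le> \<beta> / 4 * \<rho>"
        using \<A>[OF A] by blast
      have nb: "x \<in> hyperplane_nbhd (fst A) (snd A) \<longleftrightarrow> \<bar>a \<bullet> x - b\<bar> < snd A" for x
        using ab by (simp add: mem_hyperplane_nbhd_iff)
      \<comment> \<open>\<open>s\<close> is the offset of the hyperplane after the ball has been rescaled to the unit ball.\<close>
      define s where "s = (b - a \<bullet> c) / \<rho>"
      have b: "b = \<rho> * s + a \<bullet> c"
        using \<rho> by (simp add: s_def)
      obtain x where x: "\<bar>a \<bullet> x - b\<bar> < snd A" "dist c x \<le> \<rho>"
        using \<A>[OF A] nb by auto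
      have "\<bar>a \<bullet> (x - c)\<bar> \<le> norm a * norm (x - c)"
        by (rule Cauchy_Schwarz_ineq2)
      also have "\<dots> \<le> \<rho>"
        using x(2) ab(1) by (simp add: dist_norm norm_minus_commute)
      finally have "\<bar>\<rho> * s\<bar> \<le> \<rho> + \<beta> / 4 * \<rho>"
        using x(1) sA b unfolding inner_diff_right by linarith
      also have "\<dots> \<le> \<rho> * 2"
        using \<beta> \<rho> by (simp add: field_simps)
      finally have "\<bar>s\<bar> \<le> 2"
        using \<rho> by (simp add: abs_mult)
      then have "(a, s) \<in> T"
        using ab by (simp add: T_def)
      then have "(a, s) \<in> (\<Union>t\<in>k. ball t (\<beta> / 4))"
        using k(3) by blast
      then obtain a' s' where t: "(a', s') \<in> k" "dist (a', s') (a, s) < \<beta> / 4"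
        by (auto simp only: UN_iff mem_ball split_paired_all)
      have a': "norm a' = 1"
        using t(1) k(2) by (auto simp: T_def)
      have d1: "norm (a' - a) < \<beta> / 4" and d2: "\<bar>s' - s\<bar> < \<beta> / 4"
        using t(2) dist_fst_le[of "(a', s')" "(a, s)"] dist_snd_le[of "(a', s')" "(a, s)"]
        by (auto simp: dist_norm)
      have "N A \<subseteq> hyperplane_nbhd (slab (a', s')) (\<beta> * \<rho>)"
      proof
        fix y assume "y \<in> N A"
        then have y: "\<bar>a \<bullet> y - b\<bar> < snd A" "norm (y - c) \<le> \<rho>"
          by (auto simp: N_def nb dist_norm norm_minus_commute)
        have "a' \<bullet> y - (\<rho> * s' + a' \<bullet> c)
            = (a' - a) \<bullet> (y - c) + (a \<bullet> y - b) - \<rho> * (s' - s)"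
          by (simp add: b algebra_simps inner_diff_left inner_diff_right)
        moreover have "\<bar>(a' - a) \<bullet> (y - c)\<bar> \<le> \<beta> / 4 * \<rho>"
        proof -
          have "\<bar>(a' - a) \<bullet> (y - c)\<bar> \<le> norm (a' - a) * norm (y - c)"
            by (rule Cauchy_Schwarz_ineq2)
          also have "\<dots> \<le> \<beta> / 4 * \<rho>"
            using d1 y(2) \<beta> by (intro mult_mono) auto
          finally show ?thesis .
        qed
        moreover have "\<bar>\<rho> * (s' - s)\<bar> \<le> \<beta> / 4 * \<rho>"
          using d2 \<rho> by (simp add: abs_mult)
        moreover have "\<bar>a \<bullet> y - b\<bar> \<le> \<beta> / 4 * \<rho>"
          using y(1) sA by linarith
        moreover have "0 < \<beta> * \<rho>"
          using \<beta> \<rho> by simp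
        ultimately have "\<bar>a' \<bullet> y - (\<rho> * s' + a' \<bullet> c)\<bar> < \<beta> * \<rho>"
          by linarith
        then show "y \<in> hyperplane_nbhd (slab (a', s')) (\<beta> * \<rho>)"
          using a' by (simp add: slab_def mem_hyperplane_nbhd_iff)
      qed
      with t(1) show ?thesis
        by blast
    qed
    then obtain \<tau> where \<tau>: "\<And>A. A \<in> \<A> \<Longrightarrow> \<tau> A \<in> k \<and> N A \<subseteq> hyperplane_nbhd (slab (\<tau> A)) (\<beta> * \<rho>)"
      by metis
    have fpos: "0 \<le> f A" if "A \<in> \<A>" for A
      using \<A> that by blast
    have S0: "0 \<le> sum f \<A>"
      using fpos by (simp add: sum_nonneg)
    show ?thesis
    proof (cases "sum f \<A> = 0")
      case True
      obtain a :: "real ^ 'd" where "norm a = 1"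
        using vector_choose_size[of 1] by auto
      then have "affine_hyperplane {x. a \<bullet> x = 0}"
        by (rule affine_hyperplaneI)
      moreover have "sum f {A \<in> \<A>. P A} \<le> (1 - 1 / M) * sum f \<A>" for P
        using sum_mono2[OF fin, of "{A \<in> \<A>. P A}" f] fpos True by auto
      ultimately show ?thesis
        by (intro exI conjI)
    next
      case False
      have "sum f \<A> = (\<Sum>t\<in>k. sum f {A \<in> \<A>. \<tau> A = t})"
        using \<tau> by (intro sum.group[symmetric] fin k(1)) auto
      have "\<exists>t\<in>k. sum f \<A> / M \<le> sum f {A \<in> \<A>. \<tau> A = t}"
      proof (rule ccontr)
        assume *: "\<not> ?thesis"
        have "sum f \<A> = (\<Sum>t\<in>k. sum f {A \<in> \<A>. \<tau> A = t})" by fact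
        also have "\<dots> \<le> (\<Sum>t\<in>k. sum f \<A> / M)"
          using * by (intro sum_mono) force
        also have "\<dots> = card k * (sum f \<A> / M)"
          by simp
        also have "\<dots> < M * (sum f \<A> / M)"
          using S0 False by (intro mult_strict_right_mono) (auto simp: M_def)
        also have "\<dots> = sum f \<A>"
          by (simp add: M_def)
        finally show False
          by simp
      qed
      then obtain t where t: "t \<in> k" "sum f \<A> / M \<le> sum f {A \<in> \<A>. \<tau> A = t}"
        by blast
      have "sum f {A \<in> \<A>. \<not> N A \<subseteq> hyperplane_nbhd (slab t) (\<beta> * \<rho>)}
          \<le> sum f {A \<in> \<A>. \<tau> A \<noteq> t}"
        using \<tau> fpos fin by (intro sum_mono2) auto
      also have "\<dots> = sum f \<A> - sum f {A \<in> \<A>. \<tau> A = t}"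
      proof -
        have "sum f (\<A> - {A \<in> \<A>. \<tau> A = t}) = sum f \<A> - sum f {A \<in> \<A>. \<tau> A = t}"
          using fin by (intro sum_diff) auto
        moreover have "\<A> - {A \<in> \<A>. \<tau> A = t} = {A \<in> \<A>. \<tau> A \<noteq> t}"
          by auto
        ultimately show ?thesis
          by simp
      qed
      also have "\<dots> \<le> (1 - 1 / M) * sum f \<A>"
        using t(2) by (simp add: algebra_simps)
      finally show ?thesis
        using hyp[OF t(1)] unfolding N_def by blast
    qed
  qed
  show ?thesis
  proof (rule that[of M])
    show "2 \<le> M"
      by (simp add: M_def)
  qed (intro allI impI; rule main; blast)
qed


section \<open>The hyperplane potential game\<close>

text \<open>A finite set of pairs of a hyperplane and a positive thickness, the \<open>\<gamma>\<close>-th powers of the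
  thicknesses adding up to at most \<open>m\<close>: a move of Alice in the hyperplane potential game.\<close>

definition admissible_family :: "real \<Rightarrow> real \<Rightarrow> ((real ^ 'd::finite) set \<times> real) set \<Rightarrow> bool" where
  "admissible_family \<gamma> m \<A> \<longleftrightarrow>
     finite \<A> \<and> (\<forall>A\<in>\<A>. affine_hyperplane (fst A) \<and> 0 < snd A) \<and> (\<Sum>A\<in>\<A>. snd A powr \<gamma>) \<le> m"

text \<open>A sequence of moves of Bob that starts inside \<open>W\<close> and obeys the rules on nesting and radii, with radii
  tending to zero. The deletions of Alice are not part of the notion.\<close>

definition shrinking_play ::
  "(real ^ 'd) set \<Rightarrow> real \<Rightarrow> (nat \<Rightarrow> 'd::finite ball_move) \<Rightarrow> bool" where
  "shrinking_play W \<beta> B \<longleftrightarrow>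
     move_ball (B 0) \<subseteq> W \<and> (\<forall>i. 0 < snd (B i)) \<and>
     (\<forall>i. move_ball (B (Suc i)) \<subseteq> move_ball (B i) \<and> \<beta> * snd (B i) \<le> snd (B (Suc i))) \<and>
     (\<lambda>i. snd (B i)) \<longlonglongrightarrow> 0"

text \<open>If Alice can win the potential game, in which she may answer every ball with an admissible family instead
  of a single neighbourhood, then she can win the hyperplane absolute game. The family may depend on the
  current ball and on the first ball of the play. The constants \<open>\<gamma>\<close> and \<open>s\<close> depend on \<open>\<beta>\<close> and the dimension
  only.\<close>

lemma potential_game_winning:
  fixes \<beta> :: real
  assumes \<beta>: "0 < \<beta>" "\<beta> < 1 / 3"
  obtains \<gamma> s :: real where "0 < \<gamma>" "0 < s"
    "\<forall>(W :: (real ^ 'd::finite) set) S F.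
      (\<forall>b0 b. 0 < snd b0 \<longrightarrow> 0 < snd b \<longrightarrow> admissible_family \<gamma> (s * snd b powr \<gamma>) (F b0 b)) \<longrightarrow>
      (\<forall>B x. shrinking_play W \<beta> B \<longrightarrow> (\<forall>i. x \<in> move_ball (B i)) \<longrightarrow>
         (\<forall>i. \<forall>A\<in>F (B 0) (B i). x \<notin> hyperplane_nbhd (fst A) (snd A)) \<longrightarrow> x \<in> S) \<longrightarrow>
      (\<exists>\<sigma>. winning_strategy W S \<beta> \<sigma>)"
proof -
  have "\<beta> < 1"
    using \<beta> by simp
  obtain M :: nat where M: "2 \<le> M" and net:
    "\<forall>(c :: real ^ 'd) \<rho> \<A> f. 0 < \<rho> \<longrightarrow> finite \<A> \<longrightarrow>
      (\<forall>A\<in>\<A>. affine_hyperplane (fst A) \<and> snd A \<le> \<beta> / 4 * \<rho>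
        \<and> hyperplane_nbhd (fst A) (snd A) \<inter> cball c \<rho> \<noteq> {} \<and> 0 \<le> f A) \<longrightarrow>
      (\<exists>L. affine_hyperplane L \<and>
        sum f {A \<in> \<A>. \<not> hyperplane_nbhd (fst A) (snd A) \<inter> cball c \<rho>
                          \<subseteq> hyperplane_nbhd L (\<beta> * \<rho>)}
          \<le> (1 - 1 / M) * sum f \<A>)"
    by (rule exists_hyperplane_capturing_fraction[OF \<beta>(1) \<open>\<beta> < 1\<close>])
  define \<alpha> where "\<alpha> = \<beta> / 4"
  define q where "q = (1 - 1 / (2 * M)) / (1 - 1 / M)"
  have q1: "1 < q"
    using M by (simp add: q_def field_simps)
  define \<gamma> where "\<gamma> = ln q / (- 2 * ln \<beta>)"
  have ln\<beta>: "ln \<beta> < 0"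
    using \<beta> by simp
  have \<gamma>: "0 < \<gamma>"
    using q1 ln\<beta> by (simp add: \<gamma>_def divide_pos_neg)
  \<comment> \<open>The exponent is chosen such that \<open>(1 - 1 / M) * \<beta> powr (- 2 * \<gamma>) = 1 - 1 / (2 * M)\<close>: two moves can
    magnify the potential, relative to the radius, by at most the factor \<open>c * c\<close>.\<close>
  define c where "c = \<beta> powr (- \<gamma>)"
  have c0: "0 < c" and c1: "1 \<le> c"
    using \<beta> \<gamma> by (auto simp: c_def powr_minus field_simps powr_le1)
  have "c * c = q"
  proof -
    have "c * c = exp (- 2 * \<gamma> * ln \<beta>)"
      using \<beta> by (simp add: c_def powr_def exp_add[symmetric])
    also have "- 2 * \<gamma> * ln \<beta> = ln q"
      using ln\<beta> by (simp add: \<gamma>_def)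
    finally show ?thesis
      using q1 by simp
  qed
  then have cc: "(1 - 1 / M) * (c * c) = 1 - 1 / (2 * M)"
    using M by (simp add: q_def)
  have \<alpha>0: "0 < \<alpha>"
    using \<beta> by (simp add: \<alpha>_def)
  define s where "s = \<alpha> powr \<gamma> / (4 * M * (c * c))"
  have s0: "0 < s"
    using \<alpha>0 M c0 by (simp add: s_def)
  have s1: "s * (c * c) = \<alpha> powr \<gamma> / (4 * M)"
    using c0 M by (simp add: s_def)
  have main: "\<exists>\<sigma>. winning_strategy W S \<beta> \<sigma>"
    if F: "\<forall>b0 b. 0 < snd b0 \<longrightarrow> 0 < snd b \<longrightarrow> admissible_family \<gamma> (s * snd b powr \<gamma>) (F b0 b)"
      and out: "\<forall>B x. shrinking_play W \<beta> B \<longrightarrow> (\<forall>i. x \<in> move_ball (B i)) \<longrightarrow>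
         (\<forall>i. \<forall>A\<in>F (B 0) (B i). x \<notin> hyperplane_nbhd (fst A) (snd A)) \<longrightarrow> x \<in> S"
    for W S :: "(real ^ 'd) set" and F :: "'d ball_move \<Rightarrow> 'd ball_move \<Rightarrow> ((real ^ 'd) set \<times> real) set"
  proof -
    \<comment> \<open>For a history \<open>h\<close>, \<open>act h\<close> collects all neighbourhoods requested so far, \<open>mt h\<close> those that still meet
      the current ball, and a hyperplane is good if its deletion removes the fraction \<open>1 / M\<close> of their
      weight.\<close>
    define nb where "nb = (\<lambda>A :: (real ^ 'd) set \<times> real. hyperplane_nbhd (fst A) (snd A))"
    define act where "act = (\<lambda>h. \<Union>b\<in>set h. F (hd h) b)"
    define mt where "mt = (\<lambda>h. {A \<in> act h. nb A \<inter> move_ball (last h) \<noteq> {}})"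
    define wt where "wt = (\<lambda>A :: (real ^ 'd) set \<times> real. snd A powr \<gamma>)"
    define good where "good = (\<lambda>h L. affine_hyperplane L \<and>
       sum wt {A \<in> mt h. \<not> nb A \<inter> move_ball (last h) \<subseteq> hyperplane_nbhd L (\<beta> * snd (last h))}
        \<le> (1 - 1 / M) * sum wt (mt h))"
    obtain a0 :: "real ^ 'd" where a0: "norm a0 = 1"
      using vector_choose_size[of 1] by auto
    define ctr where "ctr = (\<lambda>h :: 'd ball_move list. {x. a0 \<bullet> x = a0 \<bullet> fst (last h)})"
    define \<sigma> :: "'d alice_strategy" where "\<sigma> = (\<lambda>h.
      (if odd (length h) \<and> (\<exists>L. good h L) then (SOME L. good h L) else ctr h, \<beta> * snd (last h)))"
    have ctr: "affine_hyperplane (ctr h)" for h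
      unfolding ctr_def by (rule affine_hyperplaneI[OF a0])
    have good_some: "good h (SOME L. good h L)" if "\<exists>L. good h L" for h
      using that by (rule someI_ex)
    have legal: "legal_strategy \<beta> \<sigma>"
      unfolding legal_strategy_def
    proof (intro allI impI)
      fix h :: "'d ball_move list" assume h: "h \<noteq> [] \<and> (\<forall>B\<in>set h. 0 < snd B)"
      then have "0 < snd (last h)"
        by simp
      moreover have "affine_hyperplane (fst (\<sigma> h))"
        using good_some[of h] ctr by (auto simp: \<sigma>_def good_def)
      ultimately show "affine_hyperplane (fst (\<sigma> h)) \<and> 0 < snd (\<sigma> h) \<and> snd (\<sigma> h) \<le> \<beta> * snd (last h)"
        using \<beta> by (simp add: \<sigma>_def)
    qed
    have "(\<Inter>i. move_ball (B i)) \<inter> S \<noteq> {}" if play: "legal_play W \<beta> \<sigma> B" for B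
    proof -
      define r where "r = (\<lambda>i. snd (B i))"
      define h where "h = (\<lambda>i. map B [0..<Suc i])"
      have h_simps: "last (h i) = B i" "hd (h i) = B 0" "length (h i) = Suc i" "set (h i) = B ` {..i}" for i
        by (auto simp: h_def hd_map atLeast0LessThan lessThan_Suc_atMost simp del: upt_Suc)
           (simp add: last_map)
      have B0: "move_ball (B 0) \<subseteq> W" and r0: "\<And>i. 0 < r i"
        and sub: "\<And>i. move_ball (B (Suc i)) \<subseteq> move_ball (B i)"
        and avoid: "\<And>i. move_ball (B (Suc i)) \<inter> alice_nbhd \<sigma> (h i) = {}"
        and rS: "\<And>i. \<beta> * r i \<le> r (Suc i)"
        using play unfolding legal_play_def r_def h_def by blast+
      have anti: "r (Suc i) + dist (fst (B i)) (fst (B (Suc i))) \<le> r i" for i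
        using sub[of i] r0[of "Suc i"]
        by (simp add: move_ball_def cball_subset_cball_iff r_def dist_commute)
      have mono: "r (Suc i) \<le> r i" for i
        using anti[of i] zero_le_dist[of "fst (B i)" "fst (B (Suc i))"] by linarith
      have half: "r (Suc i) \<le> r i / 2" if "odd i" for i
      proof -
        have "\<sigma> (h i) = (ctr (h i), \<beta> * r i)"
          using that by (simp add: \<sigma>_def h_simps r_def)
        then have "fst (B i) \<in> alice_nbhd \<sigma> (h i)"
          using \<beta> r0[of i] by (simp add: alice_nbhd_def hyperplane_nbhd_def ctr_def h_simps)
        then have "fst (B i) \<notin> move_ball (B (Suc i))"
          using avoid[of i] by blast
        then show ?thesis
          using anti[of i] by (simp add: move_ball_def r_def dist_commute)
      qed
      have r_even: "r (2 * m) \<le> r 0 * (1 / 2) ^ m" for m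
      proof (induction m)
        case (Suc m)
        have "r (2 * Suc m) \<le> r (Suc (2 * m)) / 2"
          using half[of "Suc (2 * m)"] by simp
        also have "\<dots> \<le> r (2 * m) / 2"
          using mono[of "2 * m"] by simp
        finally show ?case
          using Suc by simp
      qed simp
      have dec: "decseq r"
        using mono by (simp add: decseq_Suc_iff)
      have lim: "r \<longlonglongrightarrow> 0"
      proof (rule LIMSEQ_I)
        fix e :: real assume "0 < e"
        then obtain m where m: "(1 / 2) ^ m < e / r 0"
          using real_arch_pow_inv[of "e / r 0" "1 / 2"] r0[of 0] by auto
        have "norm (r i - 0) < e" if "2 * m \<le> i" for i
        proof -
          have "r i \<le> r (2 * m)"
            using dec that by (simp add: decseq_def)
          also have "\<dots> \<le> r 0 * (1 / 2) ^ m"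
            by (rule r_even)
          also have "\<dots> < e"
            using m r0[of 0] by (simp add: field_simps)
          finally show ?thesis
            using r0[of i] by simp
        qed
        then show "\<exists>no. \<forall>n\<ge>no. norm (r n - 0) < e"
          by blast
      qed
      have FB: "finite (F (B 0) (B i))"
        "\<And>A. A \<in> F (B 0) (B i) \<Longrightarrow> affine_hyperplane (fst A) \<and> 0 < snd A"
        "sum wt (F (B 0) (B i)) \<le> s * r i powr \<gamma>" for i
        using F[rule_format, of "B 0" "B i"] r0[of 0] r0[of i]
        by (auto simp: r_def wt_def admissible_family_def)
      have act_fin: "finite (act (h i))" for i
        using FB(1) by (auto simp: act_def h_simps)
      have act_pos: "affine_hyperplane (fst A) \<and> 0 < snd A" if A: "A \<in> act (h i)" for A i
      proof -
        obtain j where "A \<in> F (B 0) (B j)"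
          using A by (auto simp: act_def h_simps)
        then show ?thesis
          by (rule FB(2))
      qed
      have act_Suc: "act (h (Suc i)) = act (h i) \<union> F (B 0) (B (Suc i))" for i
        by (auto simp: act_def h_simps atMost_Suc)
      have wt0: "0 \<le> wt A" for A
        by (simp add: wt_def)
      \<comment> \<open>The potential: the weight of the requested neighbourhoods that still meet the current ball.\<close>
      define \<Phi> where "\<Phi> = (\<lambda>i. sum wt (mt (h i)))"
      have mt_fin: "finite (mt (h i))" for i
        using act_fin by (simp add: mt_def)
      have step: "\<Phi> (Suc i) \<le> sum wt {A \<in> mt (h i). nb A \<inter> move_ball (B (Suc i)) \<noteq> {}}
          + s * r (Suc i) powr \<gamma>" for i
      proof -
        let ?X = "{A \<in> mt (h i). nb A \<inter> move_ball (B (Suc i)) \<noteq> {}}"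
        let ?Y = "F (B 0) (B (Suc i))"
        have fX: "finite ?X"
          using mt_fin by simp
        have "mt (h (Suc i)) \<subseteq> ?X \<union> ?Y"
          using sub[of i] by (auto simp: mt_def act_Suc h_simps)
        then have "\<Phi> (Suc i) \<le> sum wt (?X \<union> ?Y)"
          unfolding \<Phi>_def using fX FB(1) wt0 by (intro sum_mono2) auto
        also have "\<dots> = sum wt ?X + sum wt ?Y - sum wt (?X \<inter> ?Y)"
          using fX FB(1) by (rule sum_Un)
        also have "\<dots> \<le> sum wt ?X + sum wt ?Y"
          using wt0 by (simp add: sum_nonneg)
        also have "\<dots> \<le> sum wt ?X + s * r (Suc i) powr \<gamma>"
          using FB(3) by simp
        finally show ?thesis .
      qed
      have step_any: "\<Phi> (Suc i) \<le> \<Phi> i + s * r (Suc i) powr \<gamma>" for i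
      proof -
        have "sum wt {A \<in> mt (h i). nb A \<inter> move_ball (B (Suc i)) \<noteq> {}} \<le> \<Phi> i"
          unfolding \<Phi>_def using mt_fin wt0 by (intro sum_mono2) auto
        with step[of i] show ?thesis
          by linarith
      qed
      have small: "snd A \<le> \<alpha> * r i" if "A \<in> mt (h i)" "\<Phi> i \<le> (\<alpha> * r i) powr \<gamma>" for A i
      proof (rule ccontr)
        assume "\<not> ?thesis"
        then have "(\<alpha> * r i) powr \<gamma> < wt A"
          using \<gamma> \<alpha>0 r0[of i] unfolding wt_def by (intro powr_less_mono2) auto
        also have "wt A \<le> \<Phi> i"
          unfolding \<Phi>_def using that(1) mt_fin wt0 by (intro member_le_sum) auto
        finally show False
          using that(2) by simp
      qed
      have step_even: "\<Phi> (Suc i) \<le> (1 - 1 / M) * \<Phi> i + s * r (Suc i) powr \<gamma>"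
        if "even i" and le: "\<Phi> i \<le> (\<alpha> * r i) powr \<gamma>" for i
      proof -
        have "\<exists>L. affine_hyperplane L \<and>
          sum wt {A \<in> mt (h i). \<not> hyperplane_nbhd (fst A) (snd A) \<inter> cball (fst (B i)) (r i)
                          \<subseteq> hyperplane_nbhd L (\<beta> * r i)}
          \<le> (1 - 1 / M) * sum wt (mt (h i))"
        proof (intro net[rule_format, OF r0 mt_fin])
          fix A assume A: "A \<in> mt (h i)"
          then have "A \<in> act (h i)" "nb A \<inter> move_ball (B i) \<noteq> {}"
            by (auto simp: mt_def h_simps)
          then show "affine_hyperplane (fst A) \<and> snd A \<le> \<beta> / 4 * r i \<and>
            hyperplane_nbhd (fst A) (snd A) \<inter> cball (fst (B i)) (r i) \<noteq> {} \<and> 0 \<le> wt A"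
            using small[OF A le] act_pos wt0 by (simp add: \<alpha>_def nb_def move_ball_def r_def)
        qed
        then have ex: "\<exists>L. good (h i) L"
          by (simp add: good_def nb_def h_simps move_ball_def r_def)
        define L where "L = (SOME L. good (h i) L)"
        have "good (h i) L"
          unfolding L_def by (rule good_some[OF ex])
        then have L: "sum wt {A \<in> mt (h i). \<not> nb A \<inter> move_ball (B i) \<subseteq> hyperplane_nbhd L (\<beta> * r i)}
          \<le> (1 - 1 / M) * \<Phi> i"
          by (simp add: good_def h_simps r_def \<Phi>_def)
        have "alice_nbhd \<sigma> (h i) = hyperplane_nbhd L (\<beta> * r i)"
          using that ex by (simp add: alice_nbhd_def \<sigma>_def L_def h_simps r_def)
        then have "{A \<in> mt (h i). nb A \<inter> move_ball (B (Suc i)) \<noteq> {}}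
          \<subseteq> {A \<in> mt (h i). \<not> nb A \<inter> move_ball (B i) \<subseteq> hyperplane_nbhd L (\<beta> * r i)}"
          using avoid[of i] sub[of i] by blast
        then have "sum wt {A \<in> mt (h i). nb A \<inter> move_ball (B (Suc i)) \<noteq> {}}
          \<le> sum wt {A \<in> mt (h i). \<not> nb A \<inter> move_ball (B i) \<subseteq> hyperplane_nbhd L (\<beta> * r i)}"
          using mt_fin wt0 by (intro sum_mono2) auto
        with L step[of i] show ?thesis
          by linarith
      qed
      have r_powr: "r i powr \<gamma> \<le> c * r (Suc i) powr \<gamma>" for i
      proof -
        have "r i powr \<gamma> \<le> (r (Suc i) / \<beta>) powr \<gamma>"
          using rS[of i] r0[of i] \<beta> \<gamma> by (intro powr_mono2) (auto simp: field_simps)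
        also have "\<dots> = c * r (Suc i) powr \<gamma>"
          using \<beta> r0[of "Suc i"] by (simp add: powr_divide c_def powr_minus field_simps)
        finally show ?thesis .
      qed
      \<comment> \<open>Moves with even index, that is, histories of odd length, are the ones that reduce the potential.\<close>
      have inv: "\<Phi> (2 * m) \<le> (\<alpha> * r (2 * m)) powr \<gamma>" for m
      proof (induction m)
        case 0
        have "mt (h 0) \<subseteq> F (B 0) (B 0)"
          by (auto simp: mt_def act_def h_simps)
        then have "\<Phi> 0 \<le> sum wt (F (B 0) (B 0))"
          unfolding \<Phi>_def using FB(1) wt0 by (intro sum_mono2) auto
        also have "\<dots> \<le> s * r 0 powr \<gamma>"
          by (rule FB(3))
        also have "\<dots> \<le> \<alpha> powr \<gamma> * r 0 powr \<gamma>"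
        proof (rule mult_right_mono)
          have "s * 1 \<le> s * (c * c)"
            using s0 c1 mult_mono[OF c1 c1] by (intro mult_left_mono) auto
          also have "\<dots> \<le> \<alpha> powr \<gamma>"
            unfolding s1 using M by (simp add: pos_divide_le_eq mult_le_cancel_left1)
          finally show "s \<le> \<alpha> powr \<gamma>"
            by simp
        qed simp
        finally show ?case
          using \<alpha>0 r0[of 0] by (simp add: powr_mult)
      next
        case (Suc m)
        let ?i = "2 * m"
        let ?R = "r (Suc (Suc ?i)) powr \<gamma>"
        have k: "0 \<le> 1 - 1 / M"
          using M by (simp add: field_simps)
        have R0: "0 \<le> ?R"
          by simp
        have R1: "r (Suc ?i) powr \<gamma> \<le> c * ?R"
          by (rule r_powr)
        have R2: "r ?i powr \<gamma> \<le> c * c * ?R"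
          using order_trans[OF r_powr[of ?i] mult_left_mono[OF R1]] c0 by (simp add: mult.assoc)
        have "\<Phi> (Suc ?i) \<le> (1 - 1 / M) * \<Phi> ?i + s * r (Suc ?i) powr \<gamma>"
          using Suc by (intro step_even) auto
        also have "\<dots> \<le> (1 - 1 / M) * (\<alpha> powr \<gamma> * (c * c * ?R)) + s * (c * ?R)"
        proof (intro add_mono mult_left_mono k R1)
          show "\<Phi> ?i \<le> \<alpha> powr \<gamma> * (c * c * ?R)"
          proof -
            have "\<Phi> ?i \<le> \<alpha> powr \<gamma> * r ?i powr \<gamma>"
              using Suc \<alpha>0 r0[of ?i] by (simp add: powr_mult)
            also have "\<dots> \<le> \<alpha> powr \<gamma> * (c * c * ?R)"
              by (intro mult_left_mono R2) simp
            finally show ?thesis .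
          qed
        qed (use s0 in simp)
        also have "\<dots> = (1 - 1 / (2 * M)) * \<alpha> powr \<gamma> * ?R + s * c * ?R"
          using arg_cong[OF cc, of "\<lambda>t. t * \<alpha> powr \<gamma> * ?R"] by (simp add: algebra_simps)
        finally have "\<Phi> (Suc (Suc ?i)) \<le> (1 - 1 / (2 * M)) * \<alpha> powr \<gamma> * ?R + (s * c + s) * ?R"
          using step_any[of "Suc ?i"] by (simp add: algebra_simps)
        also have "(s * c + s) * ?R \<le> (2 * (s * (c * c))) * ?R"
        proof (rule mult_right_mono[OF _ R0])
          have "c \<le> c * c" "1 \<le> c * c"
            using c1 mult_mono[OF c1 c1] by (auto simp: mult_le_cancel_left1)
          then have "s * c \<le> s * (c * c)" "s * 1 \<le> s * (c * c)"
            using s0 by (intro mult_left_mono; simp)+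
          then show "s * c + s \<le> 2 * (s * (c * c))"
            by linarith
        qed
        also have "(1 - 1 / (2 * M)) * \<alpha> powr \<gamma> * ?R + (2 * (s * (c * c))) * ?R = \<alpha> powr \<gamma> * ?R"
          unfolding s1 using M by (simp add: field_simps)
        also have "\<dots> = (\<alpha> * r (2 * Suc m)) powr \<gamma>"
          using \<alpha>0 r0[of "2 * Suc m"] by (simp add: powr_mult)
        finally show ?case
          by simp
      qed
      have "(\<Inter>i. move_ball (B i)) \<noteq> {}"
      proof (rule compact_nest)
        show "compact (move_ball (B n))" "move_ball (B n) \<noteq> {}" for n
          using r0[of n] by (auto simp: move_ball_def r_def)
        show "move_ball (B n) \<subseteq> move_ball (B m)" if "m \<le> n" for m n
          using that by (rule lift_Suc_antimono_le[of "\<lambda>n. move_ball (B n)", OF sub])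
      qed
      then obtain x where x: "\<And>i. x \<in> move_ball (B i)"
        by blast
      have "shrinking_play W \<beta> B"
        using B0 r0 sub rS lim by (simp add: shrinking_play_def r_def)
      moreover have "\<forall>i. \<forall>A\<in>F (B 0) (B i). x \<notin> hyperplane_nbhd (fst A) (snd A)"
      proof (intro allI ballI)
        fix i A assume A: "A \<in> F (B 0) (B i)"
        show "x \<notin> hyperplane_nbhd (fst A) (snd A)"
        proof
          assume "x \<in> hyperplane_nbhd (fst A) (snd A)"
          then have "A \<in> mt (h j)" if "i \<le> j" for j
            using A that x[of j] by (auto simp: mt_def act_def h_simps nb_def)
          \<comment> \<open>A neighbourhood that contains the outcome keeps its full weight in the potential forever.\<close>
          then have *: "snd A \<le> \<alpha> * r (2 * m)" if "i \<le> m" for m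
            using small[of A "2 * m"] inv[of m] that by simp
          have "(\<lambda>m. r (2 * m)) \<longlonglongrightarrow> 0"
            by (rule LIMSEQ_subseq_LIMSEQ[OF lim, of "\<lambda>m. 2 * m", unfolded o_def])
               (simp add: strict_mono_def)
          then have "(\<lambda>m. \<alpha> * r (2 * m)) \<longlonglongrightarrow> 0"
            by (rule tendsto_mult_right_zero)
          then have "snd A \<le> 0"
            using * by (intro Lim_bounded2[of _ 0 i]) auto
          then show False
            using FB(2)[OF A] by simp
        qed
      qed
      ultimately have "x \<in> S"
        using out x by blast
      with x show ?thesis
        by blast
    qed
    with legal show ?thesis
      unfolding winning_strategy_def by blast
  qed
  show ?thesis
    by (rule that[OF \<gamma> s0]) (intro allI impI, rule main)
qed


section \<open>Integer vectors, dual vectors and danger sets\<close>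

text \<open>The dual vectors orthogonal to \<open>(p, r, q)\<close> correspond to the pairs \<open>(A, B)\<close> with \<open>q\<close> dividing \<open>A p + B r\<close>;
  the pigeonhole principle modulo \<open>q\<close> finds one in a box of area about \<open>q\<close>.\<close>

lemma exists_small_dual_vector:
  fixes lam mu z :: real and p r q :: int
  assumes lm: "0 \<le> lam" "0 \<le> mu" "lam + mu = 1" and q: "0 < q"
  obtains A B C :: int where "A \<noteq> 0 \<or> B \<noteq> 0" "A * p + B * r + C * q = 0"
    "\<bar>of_int A\<bar> \<le> of_int q powr lam" "\<bar>of_int B - z * of_int A\<bar> \<le> 2 * of_int q powr mu"
proof -
  define m where "m = nat \<lfloor>of_int q powr lam\<rfloor>"
  define n where "n = nat \<lfloor>of_int q powr mu\<rfloor>"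
  have q1: "1 \<le> real_of_int q powr lam" "1 \<le> real_of_int q powr mu"
    using q lm by (auto intro!: ge_one_powr_ge_zero)
  have m: "real m \<le> of_int q powr lam" "of_int q powr lam < real m + 1"
    and n: "real n \<le> of_int q powr mu" "of_int q powr mu < real n + 1"
    using q1 unfolding m_def n_def by linarith+
  have "of_int q = of_int q powr lam * of_int q powr mu"
    using lm q by (simp add: powr_add[symmetric])
  also have "\<dots> < (real m + 1) * (real n + 1)"
    using m(2) n(2) q1 by (intro mult_strict_mono) auto
  finally have "of_int q < real ((m + 1) * (n + 1))"
    by (simp add: algebra_simps)
  then have qmn: "nat q < (m + 1) * (n + 1)"
    using q by linarith
  \<comment> \<open>\<open>B\<close> is taken as a small number added to the ceiling of \<open>z A\<close>, which keeps \<open>B - z A\<close> small.\<close>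
  define f where "f = (\<lambda>(a :: nat, b :: nat). int a * p + (\<lceil>z * a\<rceil> + int b) * r)"
  let ?D = "{..m} \<times> {..n}"
  have "card ((\<lambda>t. f t mod q) ` ?D) \<le> card {0..<q}"
    using q by (intro card_mono) auto
  also have "\<dots> < card ?D"
    using qmn by (simp add: card_cartesian_product)
  finally have "\<not> inj_on (\<lambda>t. f t mod q) ?D"
    by (rule pigeonhole)
  then obtain a b a' b' where ab: "a \<le> m" "b \<le> n" "a' \<le> m" "b' \<le> n" "(a, b) \<noteq> (a', b')"
    "f (a, b) mod q = f (a', b') mod q"
    unfolding inj_on_def by auto
  define A where "A = int a - int a'"
  define B where "B = (\<lceil>z * a\<rceil> + int b) - (\<lceil>z * a'\<rceil> + int b')"
  have "q dvd f (a, b) - f (a', b')"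
    using ab(6) by (simp add: mod_eq_dvd_iff)
  also have "f (a, b) - f (a', b') = A * p + B * r"
    by (simp add: f_def A_def B_def algebra_simps)
  finally obtain C where C: "A * p + B * r = q * C"
    by (rule dvdE)
  show ?thesis
  proof (rule that[of A B "- C"])
    show "A \<noteq> 0 \<or> B \<noteq> 0"
      using ab(5) by (auto simp: A_def B_def)
    show "A * p + B * r + - C * q = 0"
      using C by simp
    show "\<bar>of_int A\<bar> \<le> of_int q powr lam"
      using ab(1,3) m(1) unfolding A_def by simp
    have "real_of_int B - z * of_int A
       = (\<lceil>z * a\<rceil> - z * a) - (\<lceil>z * a'\<rceil> - z * a') + (real b - real b')"
      by (simp add: A_def B_def algebra_simps)
    moreover have "0 \<le> \<lceil>z * a\<rceil> - z * a" "\<lceil>z * a\<rceil> - z * a < 1"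
      "0 \<le> \<lceil>z * a'\<rceil> - z * a'" "\<lceil>z * a'\<rceil> - z * a' < 1"
      by linarith+
    ultimately show "\<bar>of_int B - z * of_int A\<bar> \<le> 2 * of_int q powr mu"
      using ab(2,4) n(1) q1(2) by linarith
  qed
qed

text \<open>For an integer vector \<open>v = (p, r, q)\<close> and parameters \<open>P = (x, y, z)\<close>, the image of \<open>v\<close> under the matrix
  \<open>u_mat x y z\<close> has the coordinates \<open>form_x v P\<close>, \<open>form_y v P\<close> and \<open>denom v\<close>. A dual integer vector
  \<open>w = (A, B, C)\<close> is a row vector; multiplied by the inverse matrix it has the coordinates \<open>dual_x w\<close>,
  \<open>dual_y w P\<close> and \<open>dual_z w P\<close>. The pairing of \<open>w\<close> with \<open>v\<close> is therefore expressed by these coordinates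
  for every \<open>P\<close>, and \<open>cross w w'\<close> is orthogonal to both dual vectors.\<close>

definition form_x :: "int \<times> int \<times> int \<Rightarrow> real ^ 3 \<Rightarrow> real" where
  "form_x = (\<lambda>(p, r, q) P. p + P $ 3 * r + P $ 1 * q)"

definition form_y :: "int \<times> int \<times> int \<Rightarrow> real ^ 3 \<Rightarrow> real" where
  "form_y = (\<lambda>(p, r, q) P. r + P $ 2 * q)"

definition denom :: "int \<times> int \<times> int \<Rightarrow> int" where
  "denom = (\<lambda>(p, r, q). q)"

definition dual_x :: "int \<times> int \<times> int \<Rightarrow> real" where
  "dual_x = (\<lambda>(A, B, C). A)"

definition dual_y :: "int \<times> int \<times> int \<Rightarrow> real ^ 3 \<Rightarrow> real" where
  "dual_y = (\<lambda>(A, B, C) P. B - P $ 3 * A)"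

abbreviation dual_size :: "int \<times> int \<times> int \<Rightarrow> real ^ 3 \<Rightarrow> real" where
  "dual_size w P \<equiv> max \<bar>dual_x w\<bar> \<bar>dual_y w P\<bar>"

definition dual_z :: "int \<times> int \<times> int \<Rightarrow> real ^ 3 \<Rightarrow> real" where
  "dual_z = (\<lambda>(A, B, C) P. C - P $ 1 * A - P $ 2 * (B - P $ 3 * A))"

definition pairing :: "int \<times> int \<times> int \<Rightarrow> int \<times> int \<times> int \<Rightarrow> int" where
  "pairing = (\<lambda>(A, B, C) (p, r, q). A * p + B * r + C * q)"

definition cross :: "int \<times> int \<times> int \<Rightarrow> int \<times> int \<times> int \<Rightarrow> int \<times> int \<times> int" where
  "cross = (\<lambda>(A, B, C) (A', B', C'). (B * C' - C * B', C * A' - A * C', A * B' - B * A'))"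

lemmas coord_defs = form_x_def form_y_def denom_def dual_x_def dual_y_def dual_z_def pairing_def cross_def

lemma pairing_eq: "of_int (pairing w v) = dual_x w * form_x v P + dual_y w P * form_y v P + dual_z w P * denom v"
  by (cases w; cases v) (simp add: coord_defs algebra_simps)

lemma form_x_cross: "form_x (cross w w') P = dual_y w P * dual_z w' P - dual_y w' P * dual_z w P"
  by (cases w; cases w') (simp add: coord_defs algebra_simps)

lemma form_y_cross: "form_y (cross w w') P = dual_x w' * dual_z w P - dual_x w * dual_z w' P"
  by (cases w; cases w') (simp add: coord_defs algebra_simps)

lemma denom_cross: "of_int (denom (cross w w')) = dual_x w * dual_y w' P - dual_x w' * dual_y w P"
  by (cases w; cases w') (simp add: coord_defs algebra_simps)

lemma form_x_shift: "form_x (p, r, q) P' = form_x (p, r, q) P + (P' $ 3 - P $ 3) * r + (P' $ 1 - P $ 1) * q"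
  by (simp add: coord_defs algebra_simps)

lemma form_y_shift: "form_y v P' = form_y v P + (P' $ 2 - P $ 2) * denom v"
  by (cases v) (simp add: coord_defs algebra_simps)

lemma dual_y_shift: "dual_y w P' = dual_y w P - (P' $ 3 - P $ 3) * dual_x w"
  by (cases w) (simp add: coord_defs algebra_simps)

lemma pairing_zero_if_cross_zero:
  assumes "cross w w' = (0, 0, 0)" "pairing w v = 0" "w \<noteq> (0, 0, 0)"
  shows "pairing w' v = 0"
proof -
  obtain A B C where w: "w = (A, B, C)" by (cases w)
  obtain A' B' C' where w': "w' = (A', B', C')" by (cases w')
  obtain p r q where v: "v = (p, r, q)" by (cases v)
  have eqs: "B * C' = C * B'" "C * A' = A * C'" "A * B' = B * A'"
    and 0: "A * p + B * r + C * q = 0"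
    using assms by (auto simp: coord_defs w w' v)
  have "A * (A' * p + B' * r + C' * q) = A' * (A * p + B * r + C * q)"
    using eqs by algebra
  moreover have "B * (A' * p + B' * r + C' * q) = B' * (A * p + B * r + C * q)"
    using eqs by algebra
  moreover have "C * (A' * p + B' * r + C' * q) = C' * (A * p + B * r + C * q)"
    using eqs by algebra
  ultimately show ?thesis
    using assms(3) 0 by (auto simp: coord_defs w w' v)
qed

text \<open>The parameters \<open>P\<close> for which \<open>v\<close> becomes short, in terms of \<open>\<epsilon>\<close>, at some time of the flow: a neighbourhood
  of the line on which both forms of \<open>v\<close> vanish.\<close>

definition danger :: "real \<Rightarrow> real \<Rightarrow> real \<Rightarrow> int \<times> int \<times> int \<Rightarrow> (real ^ 3) set" where
  "danger lam mu \<epsilon> v =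
     {P. \<bar>form_x v P\<bar> < \<epsilon> * of_int (denom v) powr (- lam) \<and> \<bar>form_y v P\<bar> < \<epsilon> * of_int (denom v) powr (- mu)}"

text \<open>A set \<open>D\<close> of points whose coordinates are bounded by \<open>K\<close> and differ by at most \<open>2 * \<rho>\<close>, a dyadic interval \<open>[Q, 2 Q)\<close> for the last
  coordinate of \<open>v\<close>, and a bound \<open>N\<close> for the size of the dual vectors. The number \<open>g\<close> measures how much
  larger \<open>N Q \<rho>\<close> is allowed to be than the small constant that forces pairings to vanish.\<close>

locale ball_scale =
  fixes lam mu \<epsilon> K Q \<rho> N g :: real and D :: "(real ^ 3) set"
  assumes lam: "1 / 2 \<le> lam" and mu: "0 \<le> mu" and lam_mu: "lam + mu = 1"
    and \<epsilon>: "0 < \<epsilon>" "\<epsilon> \<le> 1 / 100" and K: "1 \<le> K" and Q: "1 \<le> Q" and \<rho>: "0 < \<rho>" "\<rho> \<le> 1"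
    and g: "1 \<le> g" "g \<le> Q" and N: "8 * (K + 3) * (N * Q * \<rho>) \<le> g" and N0: "0 \<le> N"
    and D_diam: "\<And>P P' i. P \<in> D \<Longrightarrow> P' \<in> D \<Longrightarrow> \<bar>P' $ i - P $ i\<bar> \<le> 2 * \<rho>"
    and D_bound: "\<And>P i. P \<in> D \<Longrightarrow> \<bar>P $ i\<bar> \<le> K"
begin

text \<open>A vector \<open>v\<close> of the class, a point \<open>P\<close> of its danger set, and a dual vector orthogonal to \<open>v\<close> that is
  small at \<open>P\<close>.\<close>

definition triple :: "int \<times> int \<times> int \<Rightarrow> int \<times> int \<times> int \<Rightarrow> real ^ 3 \<Rightarrow> bool" where
  "triple v w P \<longleftrightarrow> P \<in> D \<and> Q \<le> of_int (denom v) \<and> of_int (denom v) < 2 * Q \<and> P \<in> danger lam mu \<epsilon> v \<and>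
     pairing w v = 0 \<and> w \<noteq> (0, 0, 0) \<and>
     \<bar>dual_x w\<bar> \<le> of_int (denom v) powr lam \<and> \<bar>dual_y w P\<bar> \<le> 2 * of_int (denom v) powr mu \<and>
     \<bar>dual_x w\<bar> \<le> N \<and> \<bar>dual_y w P\<bar> \<le> N"

definition Q_lam where "Q_lam = Q powr lam"
definition Q_mu where "Q_mu = Q powr mu"

lemma Q_parts: "1 \<le> Q_lam" "1 \<le> Q_mu" "Q_lam * Q_mu = Q"
  using Q lam mu lam_mu by (auto simp: Q_lam_def Q_mu_def ge_one_powr_ge_zero powr_add[symmetric])

lemma inverse_Q: "1 / Q = 1 / Q_lam * (1 / Q_mu)"
  by (simp add: Q_parts(3))

lemma exponents_le_1: "lam \<le> 1" "mu \<le> 1"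
  using lam mu lam_mu by auto

lemma NQ\<rho>_le: "N * Q * \<rho> \<le> g / 32"
proof -
  have "0 \<le> N * Q * \<rho>"
    using N0 Q \<rho> by simp
  then have "32 * (N * Q * \<rho>) \<le> 8 * (K + 3) * (N * Q * \<rho>)"
    using K by (intro mult_right_mono) auto
  with N show ?thesis
    by simp
qed

lemma N\<rho>_le: "N * \<rho> \<le> 1 / 32"
proof -
  have "Q * (N * \<rho>) = N * Q * \<rho>"
    by simp
  also have "\<dots> \<le> Q * (1 / 32)"
    using NQ\<rho>_le g by linarith
  finally have "Q * (N * \<rho>) \<le> Q * (1 / 32)" .
  then show ?thesis
    by (rule mult_left_le_imp_le) (use Q in simp)
qed

lemma KNQ\<rho>_le: "(K + 5) * (N * Q * \<rho>) \<le> 3 * g / 16"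
proof -
  have "0 \<le> N * Q * \<rho>"
    using N0 Q \<rho> by simp
  then have "(K + 5) * (N * Q * \<rho>) \<le> (3 / 2 * (K + 3)) * (N * Q * \<rho>)"
    using K by (intro mult_right_mono) auto
  with N show ?thesis
    by (simp add: algebra_simps)
qed

lemma powr_bounds:
  assumes "Q \<le> q" "q < 2 * Q"
  shows "q powr lam \<le> 2 * Q_lam" "q powr mu \<le> 2 * Q_mu" "q powr - lam \<le> 1 / Q_lam" "q powr - mu \<le> 1 / Q_mu"
proof -
  have two: "2 powr t \<le> 2" if "t \<le> 1" for t :: real
    using powr_mono[OF that, of 2] by simp
  have "q powr lam \<le> (2 * Q) powr lam" "q powr mu \<le> (2 * Q) powr mu"
    using assms Q lam mu by (auto intro!: powr_mono2)
  moreover have "(2 * Q) powr lam \<le> 2 * Q_lam" "(2 * Q) powr mu \<le> 2 * Q_mu"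
    using Q two exponents_le_1 by (auto simp: powr_mult Q_lam_def Q_mu_def)
  ultimately show "q powr lam \<le> 2 * Q_lam" "q powr mu \<le> 2 * Q_mu"
    by linarith+
  have "q powr - lam \<le> Q powr - lam" "q powr - mu \<le> Q powr - mu"
    using assms Q lam mu by (auto intro!: powr_mono2')
  then show "q powr - lam \<le> 1 / Q_lam" "q powr - mu \<le> 1 / Q_mu"
    using Q by (auto simp: Q_lam_def Q_mu_def powr_minus divide_inverse)
qed

lemma triple_denom: "triple v w P \<Longrightarrow> Q \<le> of_int (denom v) \<and> of_int (denom v) < 2 * Q"
  by (simp add: triple_def)

lemma triple_D: "triple v w P \<Longrightarrow> P \<in> D"
  by (simp add: triple_def)

lemma triple_forms_at:
  assumes "triple v w P"
  shows "\<bar>form_x v P\<bar> \<le> \<epsilon> / Q_lam" "\<bar>form_y v P\<bar> \<le> \<epsilon> / Q_mu"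
proof -
  note pb = powr_bounds[of "of_int (denom v)"]
  have "\<bar>form_x v P\<bar> < \<epsilon> * of_int (denom v) powr (- lam)" "\<bar>form_y v P\<bar> < \<epsilon> * of_int (denom v) powr (- mu)"
    using assms by (auto simp: triple_def danger_def)
  moreover have "\<epsilon> * of_int (denom v) powr (- lam) \<le> \<epsilon> * (1 / Q_lam)" "\<epsilon> * of_int (denom v) powr (- mu) \<le> \<epsilon> * (1 / Q_mu)"
    using pb(3,4) triple_denom[OF assms] \<epsilon> by (intro mult_left_mono; simp)+
  ultimately show "\<bar>form_x v P\<bar> \<le> \<epsilon> / Q_lam" "\<bar>form_y v P\<bar> \<le> \<epsilon> / Q_mu"
    by auto
qed

lemma triple_forms_near:
  assumes t: "triple v w P" and P': "P' \<in> D"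
  shows "\<bar>form_x v P'\<bar> \<le> \<epsilon> / Q_lam + 4 * (K + 2) * (\<rho> * Q)" "\<bar>form_y v P'\<bar> \<le> \<epsilon> / Q_mu + 4 * (\<rho> * Q)"
proof -
  obtain p r q where v: "v = (p, r, q)" by (cases v)
  have q: "Q \<le> q" "q < 2 * Q"
    using triple_denom[OF t] by (auto simp: v denom_def)
  have P: "P \<in> D"
    using t by (rule triple_D)
  have \<epsilon>Q_mu: "\<epsilon> / Q_mu \<le> 1"
    using \<epsilon> Q_parts by (simp add: divide_le_eq_1)
  have "\<bar>of_int r\<bar> \<le> \<bar>form_y v P\<bar> + \<bar>P $ 2 * q\<bar>"
    by (simp add: v form_y_def)
  also have "\<dots> \<le> 1 + K * q"
    using triple_forms_at(2)[OF t] \<epsilon>Q_mu D_bound[OF P, of 2] q Q by (intro add_mono) (auto simp: abs_mult intro!: mult_right_mono)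
  also have "\<dots> \<le> (K + 1) * q"
    using q Q by (simp add: algebra_simps)
  finally have r: "\<bar>of_int r\<bar> \<le> (K + 1) * q" .
  have "\<bar>(P' $ 3 - P $ 3) * r\<bar> \<le> 2 * \<rho> * ((K + 1) * q)"
    unfolding abs_mult using D_diam[OF P P', of 3] r \<rho> by (intro mult_mono) auto
  moreover have q2: "\<bar>(P' $ i - P $ i) * q\<bar> \<le> 2 * \<rho> * q" for i
    using D_diam[OF P P', of i] q Q by (auto simp: abs_mult intro!: mult_right_mono)
  ultimately have "\<bar>form_x v P'\<bar> \<le> \<epsilon> / Q_lam + (2 * \<rho> * ((K + 1) * q) + 2 * \<rho> * q)"
    unfolding v using form_x_shift[of p r q P' P] triple_forms_at(1)[OF t] q2[of 1] unfolding v by linarith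
  also have "\<dots> = \<epsilon> / Q_lam + 2 * \<rho> * (K + 2) * q"
    by (simp add: algebra_simps)
  also have "\<dots> \<le> \<epsilon> / Q_lam + 2 * \<rho> * (K + 2) * (2 * Q)"
    using q \<rho> K by (intro add_left_mono mult_left_mono) auto
  finally show "\<bar>form_x v P'\<bar> \<le> \<epsilon> / Q_lam + 4 * (K + 2) * (\<rho> * Q)"
    by (simp add: mult_ac)
  have "\<bar>form_y v P'\<bar> \<le> \<epsilon> / Q_mu + 2 * \<rho> * q"
    using form_y_shift[of v P' P] triple_forms_at(2)[OF t] q2[of 2] by (simp add: v denom_def)
  also have "\<dots> \<le> \<epsilon> / Q_mu + 2 * \<rho> * (2 * Q)"
    using q \<rho> by (intro add_left_mono mult_left_mono) auto
  finally show "\<bar>form_y v P'\<bar> \<le> \<epsilon> / Q_mu + 4 * (\<rho> * Q)"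
    by (simp add: mult_ac)
qed

lemma triple_dual:
  assumes t: "triple v w P" and P': "P' \<in> D"
  shows "\<bar>dual_x w\<bar> \<le> 2 * Q_lam" "\<bar>dual_x w\<bar> \<le> N" "\<bar>dual_y w P'\<bar> \<le> 6 * Q_mu" "\<bar>dual_y w P'\<bar> \<le> 3 * N"
proof -
  note pb = powr_bounds[of "of_int (denom v)"]
  have P: "P \<in> D"
    using t by (rule triple_D)
  have w: "\<bar>dual_x w\<bar> \<le> of_int (denom v) powr lam" "\<bar>dual_y w P\<bar> \<le> 2 * of_int (denom v) powr mu"
    "\<bar>dual_x w\<bar> \<le> N" "\<bar>dual_y w P\<bar> \<le> N"
    using t by (auto simp: triple_def)
  show "\<bar>dual_x w\<bar> \<le> N" by fact
  show "\<bar>dual_x w\<bar> \<le> 2 * Q_lam"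
    using w(1) pb(1) triple_denom[OF t] by linarith
  have d: "\<bar>(P' $ 3 - P $ 3) * dual_x w\<bar> \<le> 2 * \<rho> * N"
    unfolding abs_mult using D_diam[OF P P', of 3] w(3) \<rho> by (intro mult_mono) auto
  have "2 * \<rho> * N \<le> 1"
    using N\<rho>_le by (simp add: mult_ac)
  then show "\<bar>dual_y w P'\<bar> \<le> 6 * Q_mu"
    using d dual_y_shift[of w P' P] w(2) pb(2) triple_denom[OF t] Q_parts(2) by linarith
  have "\<rho> * N \<le> 1 * N"
    using \<rho> N0 by (intro mult_right_mono) auto
  then show "\<bar>dual_y w P'\<bar> \<le> 3 * N"
    using d dual_y_shift[of w P' P] w(4) by linarith
qed

text \<open>The first two terms of the pairing of one triple's dual vector with another triple's vector, evaluated at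
  any point of \<open>D\<close>.\<close>

lemma mixed_bound:
  assumes t: "triple v w P" and t': "triple v' w' P'" and P'': "P'' \<in> D"
  shows "\<bar>dual_x w' * form_x v P'' + dual_y w' P'' * form_y v P''\<bar> \<le> 8 * \<epsilon> + 3 / 4 * g"
proof -
  note near = triple_forms_near[OF t P''] and dual = triple_dual[OF t' P'']
  have 0: "0 \<le> \<rho> * Q"
    using \<rho> Q by simp
  have "\<bar>dual_x w' * form_x v P''\<bar> \<le> \<bar>dual_x w'\<bar> * (\<epsilon> / Q_lam + 4 * (K + 2) * (\<rho> * Q))"
    unfolding abs_mult using near by (intro mult_left_mono) auto
  also have "\<dots> = \<bar>dual_x w'\<bar> * (\<epsilon> / Q_lam) + \<bar>dual_x w'\<bar> * (4 * (K + 2) * (\<rho> * Q))"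
    by (simp add: algebra_simps)
  also have "\<dots> \<le> 2 * Q_lam * (\<epsilon> / Q_lam) + N * (4 * (K + 2) * (\<rho> * Q))"
    using dual Q_parts \<epsilon> K 0 by (intro add_mono mult_right_mono) auto
  finally have 1: "\<bar>dual_x w' * form_x v P''\<bar> \<le> 2 * \<epsilon> + 4 * (K + 2) * (N * Q * \<rho>)"
    using Q_parts by (simp add: mult_ac)
  have "\<bar>dual_y w' P'' * form_y v P''\<bar> \<le> \<bar>dual_y w' P''\<bar> * (\<epsilon> / Q_mu + 4 * (\<rho> * Q))"
    unfolding abs_mult using near by (intro mult_left_mono) auto
  also have "\<dots> = \<bar>dual_y w' P''\<bar> * (\<epsilon> / Q_mu) + \<bar>dual_y w' P''\<bar> * (4 * (\<rho> * Q))"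
    by (simp add: algebra_simps)
  also have "\<dots> \<le> 6 * Q_mu * (\<epsilon> / Q_mu) + 3 * N * (4 * (\<rho> * Q))"
    using dual Q_parts \<epsilon> 0 by (intro add_mono mult_right_mono) auto
  finally have 2: "\<bar>dual_y w' P'' * form_y v P''\<bar> \<le> 6 * \<epsilon> + 12 * (N * Q * \<rho>)"
    using Q_parts by (simp add: mult_ac)
  have "4 * (K + 2) * (N * Q * \<rho>) + 12 * (N * Q * \<rho>) = 4 * ((K + 5) * (N * Q * \<rho>))"
    by (simp add: algebra_simps)
  with 1 2 KNQ\<rho>_le show ?thesis
    by linarith
qed

lemma dual_z_bound:
  assumes t: "triple v w P" and P'': "P'' \<in> D"
  shows "\<bar>dual_z w P''\<bar> \<le> g / Q"
proof -
  have "dual_x w * form_x v P'' + dual_y w P'' * form_y v P'' + dual_z w P'' * denom v = 0"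
    using pairing_eq[of w v P''] t by (simp add: triple_def)
  then have "\<bar>dual_z w P'' * denom v\<bar> \<le> 8 * \<epsilon> + 3 / 4 * g"
    using mixed_bound[OF t t P''] by linarith
  also have "\<dots> \<le> g"
    using \<epsilon> g by linarith
  finally have "\<bar>dual_z w P''\<bar> * denom v \<le> g"
    using triple_denom[OF t] Q by (simp add: abs_mult)
  moreover have "\<bar>dual_z w P''\<bar> * Q \<le> \<bar>dual_z w P''\<bar> * denom v"
    using triple_denom[OF t] by (intro mult_left_mono) auto
  ultimately show ?thesis
    using Q by (simp add: pos_le_divide_eq)
qed

text \<open>In the range \<open>g = 1\<close> the pairing of vectors and dual vectors of any two triples is an integer of absolute
  value less than one.\<close>

lemma pairing_zero_of_small:
  assumes g1: "g = 1" and t: "triple v w P" and t': "triple v' w' P'"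
  shows "pairing w' v = 0"
proof -
  have P': "P' \<in> D"
    using t' by (rule triple_D)
  define q where "q = real_of_int (denom v)"
  define q' where "q' = real_of_int (denom v')"
  have q: "Q \<le> q" "q < 2 * Q" "Q \<le> q'" "q' < 2 * Q"
    using triple_denom[OF t] triple_denom[OF t'] by (auto simp: q_def q'_def)
  have "dual_x w' * form_x v' P' + dual_y w' P' * form_y v' P' + dual_z w' P' * q' = 0"
    using pairing_eq[of w' v' P'] t' by (simp add: triple_def q'_def)
  moreover have "\<bar>dual_x w' * form_x v' P'\<bar> \<le> \<epsilon>"
  proof -
    have "\<bar>dual_x w' * form_x v' P'\<bar> \<le> q' powr lam * (\<epsilon> * q' powr (- lam))"
      unfolding abs_mult using t' q Q \<epsilon>
      by (intro mult_mono) (auto simp: triple_def danger_def q'_def)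
    also have "\<dots> = \<epsilon> * (q' powr lam * q' powr (- lam))"
      by simp
    also have "q' powr lam * q' powr (- lam) = 1"
      using q Q by (simp add: powr_add[symmetric])
    finally show ?thesis by simp
  qed
  moreover have "\<bar>dual_y w' P' * form_y v' P'\<bar> \<le> 2 * \<epsilon>"
  proof -
    have "\<bar>dual_y w' P' * form_y v' P'\<bar> \<le> 2 * q' powr mu * (\<epsilon> * q' powr (- mu))"
      unfolding abs_mult using t' q Q \<epsilon>
      by (intro mult_mono) (auto simp: triple_def danger_def q'_def)
    also have "\<dots> = 2 * \<epsilon> * (q' powr mu * q' powr (- mu))"
      by simp
    also have "q' powr mu * q' powr (- mu) = 1"
      using q Q by (simp add: powr_add[symmetric])
    finally show ?thesis by simp
  qed
  ultimately have "\<bar>dual_z w' P' * q'\<bar> \<le> 3 * \<epsilon>"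
    by linarith
  then have "\<bar>dual_z w' P'\<bar> * q' \<le> 3 * \<epsilon>"
    using q Q by (simp add: abs_mult)
  moreover have "\<bar>dual_z w' P' * q\<bar> \<le> \<bar>dual_z w' P'\<bar> * (2 * q')"
    using q Q by (auto simp: abs_mult intro!: mult_left_mono)
  ultimately have "\<bar>dual_z w' P' * q\<bar> \<le> 6 * \<epsilon>"
    by linarith
  then have "\<bar>real_of_int (pairing w' v)\<bar> \<le> 14 * \<epsilon> + 3 / 4"
    using mixed_bound[OF t t' P'] pairing_eq[of w' v P'] unfolding g1 q_def by linarith
  then have "\<bar>real_of_int (pairing w' v)\<bar> < 1"
    using \<epsilon> by linarith
  then show ?thesis
    by linarith
qed

lemma cross_bounds:
  assumes t: "triple v w P" and t': "triple v' w' P'" and P'': "P'' \<in> D"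
  shows "\<bar>of_int (denom (cross w w'))\<bar> \<le> 12 * (N * Q_mu)"
    "\<bar>form_x (cross w w') P''\<bar> \<le> 12 * g / Q_lam" "\<bar>form_y (cross w w') P''\<bar> \<le> 2 * (N * g / Q)"
proof -
  note d = triple_dual[OF t P''] and d' = triple_dual[OF t' P'']
  note c = dual_z_bound[OF t P''] and c' = dual_z_bound[OF t' P'']
  have 1: "\<bar>dual_x w * dual_y w' P''\<bar> \<le> N * (6 * Q_mu)" "\<bar>dual_x w' * dual_y w P''\<bar> \<le> N * (6 * Q_mu)"
    unfolding abs_mult using d d' N0 by (auto intro!: mult_mono)
  then show "\<bar>of_int (denom (cross w w'))\<bar> \<le> 12 * (N * Q_mu)"
    unfolding denom_cross[of w w' P''] by linarith
  have 2: "\<bar>dual_y w P'' * dual_z w' P''\<bar> \<le> (6 * Q_mu) * (g / Q)" "\<bar>dual_y w' P'' * dual_z w P''\<bar> \<le> (6 * Q_mu) * (g / Q)"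
    unfolding abs_mult using d(3) d'(3) c c' Q_parts(2) by (intro mult_mono; simp)+
  have "Q_mu * (g / Q) = Q_mu * g * (1 / Q)"
    by simp
  also have "\<dots> = g / Q_lam"
    unfolding inverse_Q using Q_parts(2) by simp
  finally have "Q_mu * (g / Q) = g / Q_lam" .
  then have e: "(6 * Q_mu) * (g / Q) = 6 * (g / Q_lam)"
    by (simp only: mult.assoc)
  have "\<bar>form_x (cross w w') P''\<bar> \<le> \<bar>dual_y w P'' * dual_z w' P''\<bar> + \<bar>dual_y w' P'' * dual_z w P''\<bar>"
    unfolding form_x_cross by (rule abs_triangle_ineq4)
  also have "\<dots> \<le> 6 * (g / Q_lam) + 6 * (g / Q_lam)"
    using 2 unfolding e by (rule add_mono)
  finally show "\<bar>form_x (cross w w') P''\<bar> \<le> 12 * g / Q_lam"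
    by simp
  have 3: "\<bar>dual_x w * dual_z w' P''\<bar> \<le> N * (g / Q)" "\<bar>dual_x w' * dual_z w P''\<bar> \<le> N * (g / Q)"
    unfolding abs_mult using d(2) d'(2) c c' N0 by (intro mult_mono; simp)+
  have "\<bar>form_y (cross w w') P''\<bar> \<le> \<bar>dual_x w' * dual_z w P''\<bar> + \<bar>dual_x w * dual_z w' P''\<bar>"
    unfolding form_y_cross by (rule abs_triangle_ineq4)
  also have "\<dots> \<le> N * (g / Q) + N * (g / Q)"
    using 3 by (intro add_mono)
  finally show "\<bar>form_y (cross w w') P''\<bar> \<le> 2 * (N * g / Q)"
    by simp
qed

lemma N_bound:
  assumes K0: "K0 * g ^ 4 = Q_lam * Q * \<rho>" "(20 / \<epsilon>)\<^sup>2 \<le> K0"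
  shows "N \<le> Q_lam / 32 * (\<epsilon> / (20 * g))\<^sup>2"
proof -
  have K0pos: "0 < K0"
    using K0(2) \<epsilon> by (smt (verit) zero_less_divide_iff zero_less_power)
  have g3: "g\<^sup>2 \<le> g ^ 3"
    using g by (intro power_increasing) auto
  have "N * (K0 * g ^ 3) * g = (N * Q * \<rho>) * Q_lam"
    using K0(1) by (simp add: eval_nat_numeral mult_ac)
  also have "\<dots> \<le> g / 32 * Q_lam"
    using NQ\<rho>_le Q_parts by (intro mult_right_mono) auto
  finally have "N * (K0 * g ^ 3) * g \<le> (Q_lam / 32) * g"
    by (simp add: mult_ac)
  then have "N * (K0 * g ^ 3) \<le> Q_lam / 32"
    using g by (auto dest: mult_right_le_imp_le)
  moreover have "N * ((20 / \<epsilon>)\<^sup>2 * g\<^sup>2) \<le> N * (K0 * g ^ 3)"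
    using K0 K0pos g3 N0 g by (intro mult_left_mono mult_mono) auto
  ultimately have "N * ((20 / \<epsilon>)\<^sup>2 * g\<^sup>2) \<le> Q_lam / 32"
    by linarith
  then show ?thesis
    using \<epsilon> g by (simp add: power_divide power_mult_distrib field_simps)
qed

text \<open>The cross product of two dual vectors is so small that its danger set contains all of \<open>D\<close>. The condition
  on \<open>g\<close> says that \<open>g\<close> is the fourth root of \<open>Q powr (1 + lam) * \<rho> / K0\<close>; together with \<open>g \<ge> 1\<close> and \<open>lam \<ge> 1 / 2\<close> it
  gives the estimate of the first form.\<close>

lemma cross_danger:
  assumes t: "triple v w P" and t': "triple v' w' P'"
    and K0: "K0 * g ^ 4 = Q_lam * Q * \<rho>" "(20 / \<epsilon>)\<^sup>2 \<le> K0" and pos: "0 < denom (cross w w')"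
  shows "of_int (denom (cross w w')) < Q" "D \<subseteq> danger lam mu \<epsilon> (cross w w')"
proof -
  \<comment> \<open>\<open>u\<close> bounds the ratio of the last coordinate of the cross product to \<open>Q\<close>.\<close>
  define u where "u = (\<epsilon> / (20 * g))\<^sup>2"
  have u0: "0 < u"
    using \<epsilon> g by (simp add: u_def)
  have "\<epsilon> / (20 * g) < 1"
    using \<epsilon> g by (simp add: divide_less_eq)
  then have u1: "u < 1"
    unfolding u_def using \<epsilon> g by (intro power_Suc_less_one[where n = 1, simplified, folded power2_eq_square] | simp add: power_less_one_iff)+
  have N: "N \<le> Q_lam / 32 * u"
    unfolding u_def by (rule N_bound[OF K0])
  define q where "q = real_of_int (denom (cross w w'))"
  have P: "P \<in> D"
    using t by (rule triple_D)
  have q0: "0 < q"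
    using pos by (simp add: q_def)
  have "q \<le> 12 * (N * Q_mu)"
    using cross_bounds(1)[OF t t' P] by (simp add: q_def)
  also have "\<dots> \<le> 12 * (Q_lam / 32 * u * Q_mu)"
    using N Q_parts by (intro mult_left_mono mult_right_mono) auto
  also have "\<dots> = 12 / 32 * (Q * u)"
    using Q_parts(3) by (simp add: mult_ac)
  also have "\<dots> \<le> Q * u"
    using Q u0 by simp
  finally have qu: "q \<le> Q * u" .
  also have "\<dots> < Q * 1"
    using Q u1 by (intro mult_strict_left_mono) auto
  finally have qQ: "q < Q"
    by simp
  then show "of_int (denom (cross w w')) < Q"
    by (simp add: q_def)
  have "P'' \<in> danger lam mu \<epsilon> (cross w w')" if P'': "P'' \<in> D" for P''
  proof -
    note cb = cross_bounds[OF t t' P'']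
    have "1 / Q_mu \<le> q powr - mu"
    proof -
      have "1 / Q_mu = Q powr - mu"
        using Q by (simp add: Q_mu_def powr_minus_divide)
      also have "\<dots> \<le> q powr - mu"
        using q0 qQ mu by (intro powr_mono2') auto
      finally show ?thesis .
    qed
    then have "\<epsilon> * (1 / Q_mu) \<le> \<epsilon> * q powr - mu"
      using \<epsilon> by (intro mult_left_mono) auto
    moreover have "2 * (N * g / Q) < \<epsilon> * (1 / Q_mu)"
    proof -
      have "2 * (N * g / Q) \<le> 2 * (Q_lam / 32 * u * g / Q)"
        using N g Q by (intro mult_left_mono divide_right_mono mult_right_mono) auto
      also have "\<dots> = (Q_lam * u * g / 16) * (1 / Q)"
        by simp
      also have "\<dots> = (u * g / 16) * (1 / Q_mu)"
        unfolding inverse_Q using Q_parts(1) by simp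
      also have "\<dots> < \<epsilon> * (1 / Q_mu)"
      proof (rule mult_strict_right_mono)
        have "u * g = \<epsilon> * (\<epsilon> / (400 * g))"
          using g by (simp add: u_def power2_eq_square field_simps)
        also have "\<dots> \<le> \<epsilon> * 1"
          using \<epsilon> g by (intro mult_left_mono) (auto simp: divide_le_eq)
        finally show "u * g / 16 < \<epsilon>"
          using \<epsilon> by simp
      qed (use Q_parts in simp)
      finally show ?thesis .
    qed
    ultimately have y: "\<bar>form_y (cross w w') P''\<bar> < \<epsilon> * q powr - mu"
      using cb(3) by linarith
    have "20 * g / \<epsilon> = u powr - (1 / 2)"
    proof -
      have "u powr (1 / 2) = \<epsilon> / (20 * g)"
        using u0 \<epsilon> g by (simp add: powr_half_sqrt u_def real_sqrt_abs abs_of_pos)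
      then show ?thesis
        by (simp add: powr_minus_divide)
    qed
    also have "\<dots> \<le> u powr - lam"
      using u0 u1 lam by (intro powr_mono') auto
    finally have "\<epsilon> * ((20 * g / \<epsilon>) / Q_lam) \<le> \<epsilon> * (u powr - lam / Q_lam)"
      using \<epsilon> Q_parts by (intro mult_left_mono divide_right_mono) auto
    also have "u powr - lam / Q_lam = (Q * u) powr - lam"
      using Q u0 by (simp add: powr_mult Q_lam_def powr_minus field_simps)
    also have "\<epsilon> * (Q * u) powr - lam \<le> \<epsilon> * q powr - lam"
      using q0 qu lam \<epsilon> by (intro mult_left_mono powr_mono2') auto
    finally have "20 * g / Q_lam \<le> \<epsilon> * q powr - lam"
      using \<epsilon> by simp
    moreover have "12 * g / Q_lam < 20 * g / Q_lam"
      using g Q_parts by (simp add: divide_strict_right_mono)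
    ultimately have "\<bar>form_x (cross w w') P''\<bar> < \<epsilon> * q powr - lam"
      using cb(2) by linarith
    with y show ?thesis
      by (simp add: danger_def q_def)
  qed
  then show "D \<subseteq> danger lam mu \<epsilon> (cross w w')"
    by blast
qed

lemma cross_zero_or_point:
  assumes t: "triple v w P" and t': "triple v' w' P'"
    and K0: "K0 * g ^ 4 = Q_lam * Q * \<rho>" "(20 / \<epsilon>)\<^sup>2 \<le> K0"
  shows "cross w w' = (0, 0, 0) \<or>
    (\<exists>u. 0 < denom u \<and> of_int (denom u) < Q \<and> D \<subseteq> danger lam mu \<epsilon> u)"
proof -
  have "denom (cross w' w) = - denom (cross w w')"
    by (cases w; cases w') (simp add: coord_defs)
  then consider "0 < denom (cross w w')" | "0 < denom (cross w' w)" | "denom (cross w w') = 0"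
    by linarith
  then show ?thesis
  proof cases
    case 1
    then show ?thesis
      using cross_danger[OF t t' K0] by blast
  next
    case 2
    then show ?thesis
      using cross_danger[OF t' t K0] by blast
  next
    \<comment> \<open>A cross product with vanishing last coordinate has integral forms of absolute value less than one.\<close>
    case 3
    obtain p r where c: "cross w w' = (p, r, 0)"
      using 3 by (cases "cross w w'") (auto simp: denom_def)
    have P: "P \<in> D"
      using t by (rule triple_D)
    note cb = cross_bounds[OF t t' P]
    have "\<bar>real_of_int r\<bar> < 1"
    proof -
      have "\<bar>real_of_int r\<bar> \<le> 2 * (N * g / Q)"
        using cb(3) by (simp add: c form_y_def)
      also have "\<dots> \<le> 2 * ((Q_lam / 32 * (\<epsilon> / (20 * g))\<^sup>2) * g / Q)"
        using N_bound[OF K0] g Q by (intro mult_left_mono divide_right_mono mult_right_mono) auto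
      also have "\<dots> = \<epsilon>\<^sup>2 / 6400 * (1 / g) * (Q_lam * (1 / Q))"
        using g by (simp add: power2_eq_square mult_ac)
      also have "\<dots> = \<epsilon>\<^sup>2 / 6400 * (1 / g) * (1 / Q_mu)"
        unfolding inverse_Q using Q_parts(1) by simp
      also have "\<dots> \<le> \<epsilon>\<^sup>2 / 6400 * 1 * 1"
        using Q_parts g by (intro mult_mono) auto
      also have "\<dots> < 1"
      proof -
        have "\<epsilon>\<^sup>2 \<le> 1"
          using \<epsilon> by (simp add: power_le_one)
        then show ?thesis by simp
      qed
      finally show ?thesis .
    qed
    then have r: "r = 0"
      by linarith
    have "\<bar>real_of_int p\<bar> < 1"
    proof -
      have "\<bar>real_of_int p\<bar> \<le> 12 * (g / Q_lam)"
        using cb(2) by (simp add: c r form_x_def)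
      also have "\<dots> < 1"
      proof (rule ccontr)
        assume "\<not> 12 * (g / Q_lam) < 1"
        then have "1 / 12 \<le> g / Q_lam"
          by linarith
        then have "(1 / 12) ^ 4 \<le> (g / Q_lam) ^ 4"
          by (intro power_mono) auto
        moreover have "(20 / (1 / 100)) ^ 2 \<le> (20 / \<epsilon>)\<^sup>2"
          using \<epsilon> by (intro power_mono divide_left_mono) auto
        ultimately have "(20 / (1 / 100)) ^ 2 * (1 / 12) ^ 4 \<le> K0 * (g / Q_lam) ^ 4"
          using K0(2) by (intro mult_mono) auto
        also have "\<dots> = (K0 * g ^ 4) / Q_lam ^ 4"
          by (simp add: power_divide)
        also have "\<dots> = Q * \<rho> / Q_lam ^ 3"
          unfolding K0(1) using Q_parts by (simp add: eval_nat_numeral)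
        also have "\<dots> \<le> Q * 1 / Q_lam ^ 3"
          using Q \<rho> Q_parts by (intro divide_right_mono mult_left_mono) auto
        also have "\<dots> = (Q_lam * Q_mu) / Q_lam ^ 3"
          by (simp only: Q_parts(3) mult_1_right)
        also have "\<dots> = Q_mu / Q_lam\<^sup>2"
          using Q_parts(1) by (simp add: eval_nat_numeral)
        also have "\<dots> \<le> 1"
        proof -
          have "Q_mu \<le> Q_lam"
            unfolding Q_lam_def Q_mu_def using Q lam lam_mu by (intro powr_mono) auto
          also have "Q_lam \<le> Q_lam\<^sup>2"
            using Q_parts by (simp add: power2_eq_square)
          finally show ?thesis
            using Q_parts by (simp add: divide_le_eq_1)
        qed
        finally show False
          by (simp add: power_divide)
      qed
      finally show ?thesis .
    qed
    then have "p = 0"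
      by linarith
    with r show ?thesis
      by (simp add: c)
  qed
qed

text \<open>If \<open>v\<close> is orthogonal to \<open>w0\<close>, then \<open>dual_z w0\<close> is small on the danger set of \<open>v\<close>. The zero set of \<open>dual_z w0\<close> is
  a quadric, because of the product of \<open>y\<close> and \<open>z\<close>; its tangent plane at \<open>P0\<close> is used, and the term
  \<open>4 * \<rho>\<^sup>2\<close> accounts for the curvature.\<close>

lemma covering_plane:
  assumes t0: "triple v0 w0 P0" and Lo: "0 < Lo"
    and M: "Lo \<le> of_int (denom v0) * dual_size w0 P0" and \<tau>: "16 * \<epsilon> / Lo + 4 * \<rho>\<^sup>2 < \<tau>"
  obtains L where "affine_hyperplane L"
    "\<And>v w P. triple v w P \<Longrightarrow> pairing w0 v = 0 \<Longrightarrow> P \<in> hyperplane_nbhd L \<tau>"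
proof -
  define m where "m = dual_size w0 P0"
  define n :: "real ^ 3" where "n = vector [- dual_x w0, - dual_y w0 P0, P0 $ 2 * dual_x w0]"
  obtain A0 B0 C0 where w0: "w0 = (A0, B0, C0)"
    by (cases w0)
  define d where "d = P0 $ 2 * dual_x w0 * P0 $ 3 - of_int C0"
  have q0: "Q \<le> of_int (denom v0)" "of_int (denom v0) < 2 * Q"
    using triple_denom[OF t0] by auto
  have m0: "0 \<le> m"
    by (simp add: m_def)
  have "Lo \<le> of_int (denom v0) * m"
    using M by (simp add: m_def)
  also have "\<dots> \<le> 2 * Q * m"
    using q0 m0 by (intro mult_right_mono) auto
  finally have mLo: "Lo \<le> 2 * Q * m" .
  then have m: "0 < m"
    using Lo m0 Q by (cases "m = 0") auto
  have "\<bar>n $ 1\<bar> \<le> norm n" "\<bar>n $ 2\<bar> \<le> norm n"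
    by (rule component_le_norm_cart)+
  then have nm: "m \<le> norm n"
    by (simp add: n_def m_def)
  then have n0: "0 < norm n"
    using m by linarith
  define n' where "n' = n /\<^sub>R norm n"
  have n': "norm n' = 1"
    using n0 by (simp add: n'_def)
  define L where "L = {X. n' \<bullet> X = d / norm n}"
  have "P \<in> hyperplane_nbhd L \<tau>" if t: "triple v w P" and orth: "pairing w0 v = 0" for v w P
  proof -
    have P: "P \<in> D" and P0: "P0 \<in> D"
      using t t0 by (auto dest: triple_D)
    have q: "Q \<le> of_int (denom v)"
      using triple_denom[OF t] by auto
    note near = triple_forms_at[OF t] and dual = triple_dual[OF t0 P]
    have 1: "\<bar>dual_x w0 * form_x v P\<bar> \<le> (2 * Q_lam) * (\<epsilon> / Q_lam)"
      unfolding abs_mult using near dual Q_parts by (intro mult_mono) auto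
    have 2: "\<bar>dual_y w0 P * form_y v P\<bar> \<le> (6 * Q_mu) * (\<epsilon> / Q_mu)"
      unfolding abs_mult using near dual Q_parts by (intro mult_mono) auto
    have "\<bar>dual_z w0 P * denom v\<bar> \<le> 8 * \<epsilon>"
      using pairing_eq[of w0 v P] 1 2 Q_parts orth by simp
    then have "\<bar>dual_z w0 P\<bar> * denom v \<le> 8 * \<epsilon>"
      using q Q by (simp add: abs_mult)
    moreover have "\<bar>dual_z w0 P\<bar> * Q \<le> \<bar>dual_z w0 P\<bar> * denom v"
      using q by (intro mult_left_mono) auto
    ultimately have dual_z: "\<bar>dual_z w0 P\<bar> \<le> 8 * \<epsilon> / Q"
      using Q by (simp add: pos_le_divide_eq)
    have "n \<bullet> P - d = dual_z w0 P - dual_x w0 * ((P $ 2 - P0 $ 2) * (P $ 3 - P0 $ 3))"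
      by (simp add: inner_vec_def sum_3 n_def d_def w0 coord_defs algebra_simps)
    moreover have "\<bar>dual_x w0 * ((P $ 2 - P0 $ 2) * (P $ 3 - P0 $ 3))\<bar> \<le> m * ((2 * \<rho>) * (2 * \<rho>))"
      unfolding abs_mult using D_diam[OF P0 P] \<rho> by (intro mult_mono) (auto simp: m_def)
    ultimately have "\<bar>n \<bullet> P - d\<bar> \<le> 8 * \<epsilon> / Q + 4 * \<rho>\<^sup>2 * m"
      using dual_z by (simp add: power2_eq_square algebra_simps)
    also have "\<dots> \<le> (16 * \<epsilon> / Lo) * m + 4 * \<rho>\<^sup>2 * m"
    proof -
      have "\<epsilon> * Lo \<le> \<epsilon> * (2 * Q * m)"
        using mLo \<epsilon> by (intro mult_left_mono) auto
      then show ?thesis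
        using Lo Q by (simp add: field_simps)
    qed
    also have "\<dots> = (16 * \<epsilon> / Lo + 4 * \<rho>\<^sup>2) * m"
      by (simp add: algebra_simps)
    also have "\<dots> < \<tau> * m"
      using \<tau> m by simp
    also have "\<dots> \<le> \<tau> * norm n"
    proof (rule mult_left_mono[OF nm])
      have "0 < 16 * \<epsilon> / Lo + 4 * \<rho>\<^sup>2"
        using \<epsilon> Lo \<rho> by (intro add_pos_pos) auto
      then show "0 \<le> \<tau>"
        using \<tau> by linarith
    qed
    finally have "\<bar>(n \<bullet> P - d) / norm n\<bar> < \<tau>"
      using n0 by (simp add: pos_divide_less_eq)
    also have "(n \<bullet> P - d) / norm n = n' \<bullet> P - d / norm n"
      by (simp add: n'_def divide_inverse_commute right_diff_distrib)
    finally show ?thesis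
      unfolding L_def mem_hyperplane_nbhd_iff[OF n'] .
  qed
  then show ?thesis
    using that[of L] affine_hyperplaneI[OF n'] unfolding L_def by blast
qed

text \<open>The dichotomy for one class of vectors at one ball: a single plane covers the points of all triples, or
  the danger set of a vector with smaller last coordinate contains \<open>D\<close>.\<close>

lemma plane_or_point:
  assumes g_cases: "g = 1 \<or> K0 * g ^ 4 = Q_lam * Q * \<rho> \<and> (20 / \<epsilon>)\<^sup>2 \<le> K0"
    and Lo: "0 < Lo" and \<tau>: "16 * \<epsilon> / Lo + 4 * \<rho>\<^sup>2 < \<tau>"
  shows "(\<exists>L. affine_hyperplane L \<and> (\<forall>v w P. triple v w P \<longrightarrow>
            Lo \<le> of_int (denom v) * dual_size w P \<longrightarrow> P \<in> hyperplane_nbhd L \<tau>)) \<or>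
    (\<exists>u. 0 < denom u \<and> of_int (denom u) < Q \<and> D \<subseteq> danger lam mu \<epsilon> u)"
    (is "?plane \<or> ?point")
proof (cases "?point \<or> (\<forall>v w P. triple v w P \<longrightarrow> \<not> Lo \<le> of_int (denom v) * dual_size w P)")
  case True
  obtain e :: "real ^ 3" where "norm e = 1"
    using vector_choose_size[of 1] by auto
  then have "affine_hyperplane {x. e \<bullet> x = 0}"
    by (rule affine_hyperplaneI)
  with True show ?thesis
    by blast
next
  case False
  then have no: "\<not> ?point"
    by blast
  obtain v0 w0 P0 where t0: "triple v0 w0 P0" and M: "Lo \<le> of_int (denom v0) * dual_size w0 P0"
    using False by blast
  obtain L where L: "affine_hyperplane L"
    "\<And>v w P. triple v w P \<Longrightarrow> pairing w0 v = 0 \<Longrightarrow> P \<in> hyperplane_nbhd L \<tau>"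
    using covering_plane[OF t0 Lo M \<tau>] by blast
  have "pairing w0 v = 0" if t: "triple v w P" for v w P
    using g_cases
  proof
    assume "g = 1"
    then show ?thesis
      using t t0 by (rule pairing_zero_of_small)
  next
    assume K0: "K0 * g ^ 4 = Q_lam * Q * \<rho> \<and> (20 / \<epsilon>)\<^sup>2 \<le> K0"
    then have "cross w w0 = (0, 0, 0)"
      using cross_zero_or_point[OF t t0, of K0] no by blast
    then show ?thesis
      by (rule pairing_zero_if_cross_zero) (use t in \<open>auto simp: triple_def\<close>)
  qed
  with L have ?plane
    by blast
  then show ?thesis ..
qed

end


section \<open>Scheduling the classes of vectors along a play\<close>

lemma exists_dyadic_scale:
  fixes y :: real
  assumes "1 \<le> y"
  obtains k :: nat where "2 ^ k \<le> y" "y < 2 * 2 ^ k"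
proof -
  define n where "n = (LEAST n. y < 2 ^ n)"
  have "\<exists>n. y < 2 ^ n"
    using real_arch_pow[of 2 y] by simp
  then have n: "y < 2 ^ n"
    unfolding n_def by (rule LeastI_ex)
  then have "n \<noteq> 0"
    using assms by (cases n) auto
  then obtain k where k: "n = Suc k"
    by (cases n) auto
  have "\<not> y < 2 ^ k"
    using not_less_Least[of k "\<lambda>n. y < 2 ^ n"] k unfolding n_def by simp
  then show ?thesis
    using n k that[of k] by simp
qed

lemma fourth_root_power: "0 < x \<Longrightarrow> (x ^ 4) powr (1 / 4) = x" for x :: real
  using powr_powr[of x 4 "1 / 4"] by simp

lemma power_fourth_root: "0 < x \<Longrightarrow> (x powr (1 / 4)) ^ 4 = x" for x :: real
  using powr_powr[of x "1 / 4" 4] by simp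

text \<open>The constants for one play. \<open>K\<close> bounds the coordinates of the points of the first ball, \<open>\<rho>s\<close> is the radius below
  which Alice starts to act, \<open>\<eta> \<rho> t ^ k\<close> is the thickness of the neighbourhood of the \<open>k\<close>-th plane at radius
  \<open>\<rho>\<close>, and \<open>\<epsilon>\<close> is the parameter of the danger sets, chosen last.\<close>

locale cover_parameters =
  fixes lam mu \<beta> K \<eta> \<rho>s \<epsilon> c1 K0 t :: real
  assumes lam: "1 / 2 \<le> lam" and mu: "0 \<le> mu" and lam_mu: "lam + mu = 1"
    and \<beta>: "0 < \<beta>" "\<beta> < 1" and K: "1 \<le> K" and \<eta>: "0 < \<eta>"
    and c1: "c1 = 1 / (16 * (K + 3))" and K0: "K0 = (20 / \<epsilon>)\<^sup>2" and t: "t = 2 powr - (1 / 4)"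
    and \<rho>s: "0 < \<rho>s" "\<rho>s \<le> 1" "\<rho>s \<le> (\<eta> / 16)\<^sup>2" "\<rho>s \<le> c1 * \<beta> / 2"
    and \<epsilon>: "0 < \<epsilon>" "\<epsilon> \<le> 1 / 100"
    and \<epsilon>_small: "64 * \<epsilon> \<le> \<eta> * \<beta> * \<rho>s"
      "64 * \<epsilon> * (2 * K0 / (c1 * \<beta>)) powr (1 / 4) \<le> \<eta> * (c1 * \<beta>)"
begin

text \<open>A vector with last coordinate \<open>q\<close> whose dual vector has size \<open>M\<close> is dealt with at the first ball, of radius
  \<open>\<rho>\<close>, at which \<open>q * M \<le> height_bound q \<rho>\<close>. The factor \<open>growth\<close> is one unless \<open>q powr (1 + lam) * \<rho>\<close> is large; it
  makes the needed thicknesses, relative to \<open>\<rho>\<close>, summable over the dyadic intervals for \<open>q\<close>.\<close>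

definition growth where "growth q \<rho> = max 1 ((q powr (1 + lam) * \<rho> / K0) powr (1 / 4))" for q \<rho> :: real
definition height_bound where "height_bound q \<rho> = c1 * growth q \<rho> / \<rho>" for q \<rho> :: real

lemma c1_bounds: "0 < c1" "c1 \<le> 1"
  using K by (auto simp: c1 divide_le_eq_1)

lemma K0_bounds: "0 < K0" "1 \<le> K0"
proof -
  have "(20 / (1 / 100))\<^sup>2 \<le> K0"
    unfolding K0 using \<epsilon> by (intro power_mono divide_left_mono) auto
  then show "0 < K0" "1 \<le> K0"
    by auto
qed

lemma t_bounds: "0 < t" "t < 1" "1 / 2 \<le> t"
proof -
  show "0 < t" by (simp add: t)
  show "t < 1" unfolding t by (rule powr_less_one) auto
  have "2 powr - 1 \<le> (2::real) powr - (1 / 4)"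
    by (intro powr_mono) auto
  then show "1 / 2 \<le> t"
    by (simp add: t powr_minus)
qed

lemma t_power: "t ^ k = (2 ^ k) powr - (1 / 4)"
  by (simp add: t powr_powr powr_realpow[symmetric] mult.commute)

lemma growth_ge1: "1 \<le> growth q \<rho>"
  by (simp add: growth_def)

lemma growth_mono:
  assumes "0 \<le> q" "q \<le> q'" "0 \<le> \<rho>" "\<rho> \<le> \<rho>'"
  shows "growth q \<rho> \<le> growth q' \<rho>'"
proof -
  have "q powr (1 + lam) * \<rho> / K0 \<le> q' powr (1 + lam) * \<rho>' / K0"
    using assms lam K0_bounds by (intro divide_right_mono mult_mono powr_mono2) auto
  then have "(q powr (1 + lam) * \<rho> / K0) powr (1 / 4) \<le> (q' powr (1 + lam) * \<rho>' / K0) powr (1 / 4)"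
    using assms K0_bounds by (intro powr_mono2) auto
  then show ?thesis
    by (auto simp: growth_def)
qed

lemma growth_scale:
  assumes s: "1 \<le> s" and x: "0 \<le> x" "x' \<le> s ^ 4 * x" "0 \<le> x'"
    and "growth q \<rho> = max 1 (x powr (1 / 4))" "growth q' \<rho>' = max 1 (x' powr (1 / 4))"
  shows "growth q' \<rho>' \<le> s * growth q \<rho>"
proof -
  have "x' powr (1 / 4) \<le> (s ^ 4 * x) powr (1 / 4)"
    using x by (intro powr_mono2) auto
  also have "\<dots> = (s ^ 4) powr (1 / 4) * x powr (1 / 4)"
    using s x by (simp add: powr_mult)
  also have "(s ^ 4) powr (1 / 4) = s"
    using s by (rule_tac fourth_root_power) simp
  finally have "x' powr (1 / 4) \<le> s * x powr (1 / 4)" .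
  also have "\<dots> \<le> s * max 1 (x powr (1 / 4))"
    using s by (intro mult_left_mono) auto
  finally have "x' powr (1 / 4) \<le> s * max 1 (x powr (1 / 4))" .
  moreover have "1 * 1 \<le> s * max 1 (x powr (1 / 4))"
    using s by (intro mult_mono) auto
  ultimately show ?thesis
    unfolding assms(5,6) by (intro max.boundedI) auto
qed

lemma growth_double:
  assumes "0 \<le> q" "q \<le> 2 * Q" "0 < \<rho>"
  shows "growth q \<rho> \<le> 2 * growth Q \<rho>"
proof (rule growth_scale[where x = "Q powr (1 + lam) * \<rho> / K0" and x' = "q powr (1 + lam) * \<rho> / K0"])
  have "q powr (1 + lam) \<le> (2 * Q) powr (1 + lam)"
    using assms lam by (intro powr_mono2) auto
  also have "\<dots> = 2 powr (1 + lam) * Q powr (1 + lam)"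
    using assms by (simp add: powr_mult)
  also have "2 powr (1 + lam) \<le> 2 powr (2::real)"
    using lam lam_mu mu by (intro powr_mono) auto
  also have "2 powr (2::real) \<le> (2::real) ^ 4"
    by (simp add: powr_numeral)
  finally have "q powr (1 + lam) \<le> 2 ^ 4 * Q powr (1 + lam)"
    by (auto simp: mult_right_mono)
  then have "q powr (1 + lam) * (\<rho> / K0) \<le> 2 ^ 4 * Q powr (1 + lam) * (\<rho> / K0)"
    using assms K0_bounds by (intro mult_right_mono) auto
  then show "q powr (1 + lam) * \<rho> / K0 \<le> 2 ^ 4 * (Q powr (1 + lam) * \<rho> / K0)"
    by simp
qed (use assms K0_bounds in \<open>auto simp: growth_def\<close>)

lemma height_bound_antimono:
  assumes "0 < \<rho>" "\<rho> \<le> \<rho>'"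
  shows "height_bound q \<rho>' \<le> height_bound q \<rho>"
proof -
  have s: "1 \<le> \<rho>' / \<rho>"
    using assms by simp
  have "growth q \<rho>' \<le> \<rho>' / \<rho> * growth q \<rho>"
  proof (rule growth_scale[where x = "q powr (1 + lam) * \<rho> / K0" and x' = "q powr (1 + lam) * \<rho>' / K0"])
    have "\<rho>' / \<rho> \<le> (\<rho>' / \<rho>) ^ 4"
      using s by (intro self_le_power) auto
    then have le: "\<rho>' / \<rho> * (q powr (1 + lam) * \<rho> / K0) \<le> (\<rho>' / \<rho>) ^ 4 * (q powr (1 + lam) * \<rho> / K0)"
      using assms K0_bounds by (intro mult_right_mono) auto
    have "q powr (1 + lam) * \<rho>' / K0 = \<rho>' / \<rho> * (q powr (1 + lam) * \<rho> / K0)"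
      using assms by simp
    also note le
    finally show "q powr (1 + lam) * \<rho>' / K0 \<le> (\<rho>' / \<rho>) ^ 4 * (q powr (1 + lam) * \<rho> / K0)" .
  qed (use assms s K0_bounds in \<open>auto simp: growth_def\<close>)
  then have "c1 * (growth q \<rho>' / \<rho>') \<le> c1 * (growth q \<rho> / \<rho>)"
    using assms c1_bounds by (intro mult_left_mono) (auto simp: field_simps)
  then show ?thesis
    by (simp add: height_bound_def)
qed

lemma growth_le_sqrt:
  assumes "1 \<le> q" "0 < \<rho>" "\<rho> \<le> 1"
  shows "growth q \<rho> \<le> sqrt q"
proof -
  have "q powr (1 + lam) * \<rho> / K0 \<le> q powr 2 * 1 / 1"
    using assms lam mu lam_mu K0_bounds by (intro frac_le mult_mono powr_mono) auto
  then have "(q powr (1 + lam) * \<rho> / K0) powr (1 / 4) \<le> (q powr 2) powr (1 / 4)"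
    using assms K0_bounds by (intro powr_mono2) auto
  also have "\<dots> = q powr (1 / 2)"
    by (simp only: powr_powr) simp
  also have "\<dots> = sqrt q"
    using assms by (simp add: powr_half_sqrt)
  finally show ?thesis
    using assms by (simp add: growth_def)
qed

text \<open>Only finitely many dyadic intervals for \<open>q\<close> are relevant at a given radius. This also absorbs the
  curvature term \<open>4 * \<rho>\<^sup>2\<close>, which does not decay in \<open>k\<close>.\<close>

lemma le_inverse_square:
  assumes "1 \<le> q" "0 < \<rho>" "\<rho> \<le> 1" "q \<le> height_bound q \<rho>"
  shows "q \<le> 1 / \<rho>\<^sup>2"
proof -
  have "c1 * growth q \<rho> \<le> 1 * sqrt q"
    using c1_bounds growth_le_sqrt[OF assms(1-3)] growth_ge1[of q \<rho>] by (intro mult_mono) auto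
  then have "height_bound q \<rho> \<le> 1 * sqrt q / \<rho>"
    unfolding height_bound_def using assms(2) by (intro divide_right_mono) auto
  then have "q \<le> sqrt q / \<rho>"
    using assms(4) by simp
  then have "q * \<rho> \<le> sqrt q"
    using assms by (simp add: pos_le_divide_eq)
  moreover have "sqrt q * (sqrt q * \<rho>) = q * \<rho>"
    using assms by (simp add: mult.assoc[symmetric])
  ultimately have "sqrt q * (sqrt q * \<rho>) \<le> sqrt q * 1"
    by linarith
  then have "sqrt q * \<rho> \<le> 1"
    by (rule mult_left_le_imp_le) (use assms in simp)
  then have "(sqrt q * \<rho>)\<^sup>2 \<le> 1"
    using assms by (intro power_le_one) auto
  then show ?thesis
    using assms by (simp add: power_mult_distrib pos_le_divide_eq)
qed

text \<open>The triples to be dealt with at the ball \<open>D\<close> of radius \<open>\<rho>\<close>. The lower bound excludes what has been dealt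
  with at an earlier ball, since the previous radius is at most \<open>\<rho> / \<beta>\<close>. It is dropped for radii of at least
  \<open>\<beta> * \<rho>s\<close>, where there may be no earlier ball at which Alice acts.\<close>

definition relevant ::
  "(real ^ 3) set \<Rightarrow> real \<Rightarrow> real \<Rightarrow> int \<times> int \<times> int \<Rightarrow> int \<times> int \<times> int \<Rightarrow> real ^ 3 \<Rightarrow> bool" where
  "relevant D \<rho> Q v w P \<longleftrightarrow> P \<in> D \<and> Q \<le> of_int (denom v) \<and> of_int (denom v) < 2 * Q \<and>
     P \<in> danger lam mu \<epsilon> v \<and> pairing w v = 0 \<and> w \<noteq> (0, 0, 0) \<and>
     \<bar>dual_x w\<bar> \<le> of_int (denom v) powr lam \<and> \<bar>dual_y w P\<bar> \<le> 2 * of_int (denom v) powr mu \<and>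
     of_int (denom v) * dual_size w P \<le> height_bound (of_int (denom v)) \<rho> \<and>
     (\<rho> < \<beta> * \<rho>s \<longrightarrow> height_bound (of_int (denom v)) (\<rho> / \<beta>) < of_int (denom v) * dual_size w P)"

lemma dual_size_ge_1:
  assumes "pairing w v = 0" "w \<noteq> (0, 0, 0)" "0 < denom v"
  shows "1 \<le> dual_size w P"
proof -
  obtain A B C where w: "w = (A, B, C)" by (cases w)
  obtain p r q where v: "v = (p, r, q)" by (cases v)
  show ?thesis
  proof (cases "A = 0")
    case True
    then have "B \<noteq> 0"
      using assms by (auto simp: w v pairing_def denom_def)
    then have "1 \<le> \<bar>real_of_int B\<bar>"
      by linarith
    then show ?thesis
      using True by (simp add: w dual_x_def dual_y_def)
  next
    case False
    then have "1 \<le> \<bar>real_of_int A\<bar>"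
      by linarith
    then show ?thesis
      by (simp add: w dual_x_def)
  qed
qed

text \<open>The scale \<open>R\<close> of the dyadic intervals is at least one; for small radii it is chosen such that no \<open>q < R\<close>
  satisfies the lower bound in \<open>relevant\<close>.\<close>

lemma plane_for_class:
  assumes \<rho>: "0 < \<rho>" "\<rho> < \<rho>s" and R: "1 \<le> R" and R_small: "\<rho> < \<beta> * \<rho>s \<Longrightarrow> R powr (1 + lam) * \<rho> = c1 * \<beta> / 2"
    and D_diam: "\<And>P P' i. P \<in> D \<Longrightarrow> P' \<in> D \<Longrightarrow> \<bar>P' $ i - P $ i\<bar> \<le> 2 * \<rho>"
    and D_bound: "\<And>P i. P \<in> D \<Longrightarrow> \<bar>P $ i\<bar> \<le> K"
  shows "(\<exists>L. affine_hyperplane L \<and>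
      (\<forall>v w P. relevant D \<rho> (R * 2 ^ k) v w P \<longrightarrow> P \<in> hyperplane_nbhd L (\<eta> * \<rho> * t ^ k))) \<or>
    (\<exists>u. 0 < denom u \<and> of_int (denom u) < R * 2 ^ k \<and> D \<subseteq> danger lam mu \<epsilon> u)"
proof -
  define Q where "Q = R * 2 ^ k"
  have Q2: "2 ^ k \<le> Q"
    using R by (simp add: Q_def)
  have Q: "1 \<le> Q"
    using Q2 order_trans[of 1 "2 ^ k" Q] by simp
  have \<rho>_less: "\<rho> < \<rho>s"
    by (rule \<rho>(2))
  have \<rho>1: "\<rho> \<le> 1"
    using \<rho> \<rho>s by linarith
  have height: "Q \<le> of_int (denom v) * dual_size w P" if r: "relevant D \<rho> Q v w P" for v w P
  proof -
    have "0 < denom v"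
      using r Q by (auto simp: relevant_def)
    then have "1 \<le> dual_size w P"
      using r by (intro dual_size_ge_1) (auto simp: relevant_def)
    then have "of_int (denom v) * 1 \<le> of_int (denom v) * dual_size w P"
      using \<open>0 < denom v\<close> by (intro mult_left_mono) auto
    moreover have "Q \<le> of_int (denom v)"
      using r by (simp add: relevant_def)
    ultimately show ?thesis
      by linarith
  qed
  show ?thesis
  proof (cases "2 ^ k \<le> 1 / \<rho>\<^sup>2")
    case False
    have "\<not> relevant D \<rho> Q v w P" for v w P
    proof
      assume r: "relevant D \<rho> Q v w P"
      then have q: "Q \<le> of_int (denom v)"
        by (simp add: relevant_def)
      have "1 \<le> dual_size w P"
        using r Q by (intro dual_size_ge_1) (auto simp: relevant_def)
      then have "of_int (denom v) * 1 \<le> of_int (denom v) * dual_size w P"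
        using q Q by (intro mult_left_mono) auto
      moreover have "of_int (denom v) * dual_size w P \<le> height_bound (of_int (denom v)) \<rho>"
        using r by (simp only: relevant_def)
      ultimately have "of_int (denom v) \<le> height_bound (of_int (denom v)) \<rho>"
        by linarith
      then have "of_int (denom v) \<le> 1 / \<rho>\<^sup>2"
        using q Q \<rho> \<rho>1 by (intro le_inverse_square) auto
      then show False
        using False q Q2 by linarith
    qed
    moreover obtain e :: "real ^ 3" where "norm e = 1"
      using vector_choose_size[of 1] by auto
    then have "affine_hyperplane {x. e \<bullet> x = 0}"
      by (rule affine_hyperplaneI)
    ultimately show ?thesis
      unfolding Q_def by blast
  next
    case True
    define g where "g = growth Q \<rho>"
    \<comment> \<open>\<open>N\<close> is the largest value for which the hypothesis on \<open>N Q \<rho>\<close> holds.\<close>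
    define N where "N = 2 * c1 * g / (Q * \<rho>)"
    have g1: "1 \<le> g"
      by (simp add: g_def growth_ge1)
    have N0: "0 \<le> N"
      using c1_bounds g1 Q \<rho> by (simp add: N_def)
    interpret ball_scale lam mu \<epsilon> K Q \<rho> N g D
    proof
      show "g \<le> Q"
      proof -
        have "sqrt Q \<le> Q"
          using Q by (simp add: real_le_lsqrt power2_eq_square)
        then show ?thesis
          using growth_le_sqrt[OF Q \<rho>(1) \<rho>1] unfolding g_def by linarith
      qed
      show "8 * (K + 3) * (N * Q * \<rho>) \<le> g"
      proof -
        have "N * Q * \<rho> = 2 * c1 * g"
          using Q \<rho> by (simp add: N_def)
        moreover have "16 * (K + 3) * c1 = 1"
          using K by (simp add: c1)
        moreover have "8 * (K + 3) * (2 * c1 * g) = (16 * (K + 3) * c1) * g"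
          by (simp add: algebra_simps)
        ultimately have "8 * (K + 3) * (N * Q * \<rho>) = g"
          by (simp only: mult_1_left)
        then show ?thesis
          by simp
      qed
    qed (use lam mu lam_mu \<epsilon> K Q \<rho> \<rho>1 g1 N0 D_diam D_bound in auto)
    have tr: "triple v w P" if r: "relevant D \<rho> Q v w P" for v w P
    proof -
      define q where "q = real_of_int (denom v)"
      have q: "Q \<le> q" "q < 2 * Q" and le: "q * dual_size w P \<le> height_bound q \<rho>"
        using r by (auto simp: relevant_def q_def)
      have "Q * dual_size w P \<le> q * dual_size w P"
        using q by (intro mult_right_mono) auto
      also note le
      also have "height_bound q \<rho> \<le> c1 * (2 * g) / \<rho>"
        unfolding height_bound_def g_def using c1_bounds \<rho> q Q
        by (intro divide_right_mono mult_left_mono growth_double) auto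
      also have "\<dots> = Q * N"
        using Q \<rho> by (simp add: N_def)
      finally have "dual_size w P \<le> N"
        by (rule mult_left_le_imp_le) (use Q in simp)
      with r show ?thesis
        by (auto simp: relevant_def triple_def)
    qed
    have g_cases: "g = 1 \<or> K0 * g ^ 4 = Q_lam * Q * \<rho> \<and> (20 / \<epsilon>)\<^sup>2 \<le> K0"
    proof (cases "(Q powr (1 + lam) * \<rho> / K0) powr (1 / 4) \<le> 1")
      case True
      then show ?thesis
        by (simp add: g_def growth_def)
    next
      case False
      then have "g = (Q powr (1 + lam) * \<rho> / K0) powr (1 / 4)"
        by (simp add: g_def growth_def)
      then have "g ^ 4 = Q powr (1 + lam) * \<rho> / K0"
        using Q \<rho> K0_bounds by (simp only:) (intro power_fourth_root; simp)
      then have "K0 * g ^ 4 = Q_lam * Q * \<rho>"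
        using K0_bounds Q by (simp add: Q_lam_def powr_add)
      then show ?thesis
        by (simp add: K0)
    qed
    \<comment> \<open>A lower bound for the product of \<open>q\<close> and the size of the dual vector.\<close>
    define Lo where "Lo = (if \<rho> < \<beta> * \<rho>s then c1 * \<beta> * g / \<rho> else Q)"
    have Lo: "0 < Lo"
      using c1_bounds \<beta> g1 \<rho> Q by (simp add: Lo_def)
    have Lo_le: "Lo \<le> of_int (denom v) * dual_size w P" if r: "relevant D \<rho> Q v w P" for v w P
    proof (cases "\<rho> < \<beta> * \<rho>s")
      case True
      have "g \<le> growth (of_int (denom v)) (\<rho> / \<beta>)"
        unfolding g_def using r Q \<rho> \<beta> by (intro growth_mono) (auto simp: relevant_def field_simps)
      then have "c1 * g / (\<rho> / \<beta>) \<le> height_bound (of_int (denom v)) (\<rho> / \<beta>)"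
        unfolding height_bound_def using c1_bounds \<rho> \<beta> by (intro divide_right_mono mult_left_mono) auto
      then show ?thesis
        using r True by (simp add: relevant_def Lo_def mult_ac)
    next
      case False
      then show ?thesis
        using height[OF r] by (simp add: Lo_def)
    qed
    have tk: "0 < t ^ k"
      using t_bounds by simp
    have quad: "4 * \<rho>\<^sup>2 \<le> \<eta> * \<rho> * t ^ k / 4"
    proof -
      have "sqrt \<rho> \<le> t ^ k"
      proof -
        have "1 / \<rho>\<^sup>2 = \<rho> powr - 2"
          using \<rho> by (simp add: powr_minus divide_inverse)
        then have "(1 / \<rho>\<^sup>2) powr - (1 / 4) = \<rho> powr (1 / 2)"
          by (simp only: powr_powr) simp
        then have "sqrt \<rho> = (1 / \<rho>\<^sup>2) powr - (1 / 4)"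
          using \<rho> by (simp only: powr_half_sqrt)
        also have "\<dots> \<le> (2 ^ k) powr - (1 / 4)"
          by (intro powr_mono2' True) auto
        finally show ?thesis
          by (simp add: t_power)
      qed
      moreover have "sqrt \<rho> \<le> \<eta> / 16"
        using \<rho>_less \<rho>s(3) \<eta> by (intro real_le_lsqrt) auto
      ultimately have "sqrt \<rho> * sqrt \<rho> \<le> \<eta> / 16 * t ^ k"
        using \<rho> \<eta> by (intro mult_mono) auto
      then have "\<rho> * \<rho> \<le> \<rho> * (\<eta> / 16 * t ^ k)"
        using \<rho> by (intro mult_left_mono) auto
      then show ?thesis
        by (simp add: power2_eq_square algebra_simps)
    qed
    have lin: "16 * \<epsilon> / Lo \<le> \<eta> * \<rho> * t ^ k / 4"
    proof (cases "\<rho> < \<beta> * \<rho>s")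
      case False
      have "16 * \<epsilon> / Q \<le> (\<eta> * \<rho> / 4) / 2 ^ k"
      proof (rule frac_le)
        have "\<eta> * (\<beta> * \<rho>s) \<le> \<eta> * \<rho>"
          using False \<eta> by (intro mult_left_mono) auto
        then show "16 * \<epsilon> \<le> \<eta> * \<rho> / 4"
          using \<epsilon>_small(1) by (simp add: mult.assoc)
      qed (use Q2 \<eta> \<rho> in auto)
      also have "\<dots> \<le> (\<eta> * \<rho> / 4) * t ^ k"
      proof -
        have "(1 / 2) ^ k \<le> t ^ k"
          using t_bounds by (intro power_mono) auto
        then have "(\<eta> * \<rho> / 4) * (1 / 2) ^ k \<le> (\<eta> * \<rho> / 4) * t ^ k"
          using \<eta> \<rho> by (intro mult_left_mono) auto
        then show ?thesis
          by (simp add: power_divide)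
      qed
      finally show ?thesis
        using False by (simp add: Lo_def)
    next
      case True
      define x where "x = c1 * \<beta> / (2 * K0)"
      have x0: "0 < x"
        using c1_bounds \<beta> K0_bounds by (simp add: x_def)
      have "x * 2 ^ k \<le> Q powr (1 + lam) * \<rho> / K0"
      proof -
        have "(2 ^ k :: real) = (2 ^ k) powr 1"
          by simp
        also have "\<dots> \<le> (2 ^ k) powr (1 + lam)"
          using lam by (intro powr_mono) auto
        finally have "R powr (1 + lam) * \<rho> * 2 ^ k \<le> R powr (1 + lam) * \<rho> * (2 ^ k) powr (1 + lam)"
          using \<rho> by (intro mult_left_mono) auto
        also have "\<dots> = Q powr (1 + lam) * \<rho>"
          using R by (simp add: Q_def powr_mult)
        finally have "c1 * \<beta> / 2 * 2 ^ k \<le> Q powr (1 + lam) * \<rho>"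
          using R_small[OF True] by simp
        then show ?thesis
          using K0_bounds by (simp add: x_def field_simps)
      qed
      then have "(x * 2 ^ k) powr (1 / 4) \<le> (Q powr (1 + lam) * \<rho> / K0) powr (1 / 4)"
        using x0 by (intro powr_mono2) auto
      also have "\<dots> \<le> g"
        by (simp add: g_def growth_def)
      finally have gx: "x powr (1 / 4) * (2 ^ k) powr (1 / 4) \<le> g"
        using x0 by (simp add: powr_mult)
      have t2: "(2 ^ k) powr (1 / 4) * t ^ k = 1"
        by (simp add: t_power powr_add[symmetric])
      have "x powr (1 / 4) * (2 ^ k) powr (1 / 4) * t ^ k \<le> g * t ^ k"
        using gx tk by (intro mult_right_mono) auto
      then have xg: "x powr (1 / 4) \<le> g * t ^ k"
        by (simp only: mult.assoc t2 mult_1_right)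
      have "2 * K0 / (c1 * \<beta>) = 1 / x"
        by (simp add: x_def)
      then have "64 * \<epsilon> * (1 / x) powr (1 / 4) \<le> \<eta> * (c1 * \<beta>)"
        using \<epsilon>_small(2) by simp
      then have "64 * \<epsilon> \<le> \<eta> * (c1 * \<beta>) * x powr (1 / 4)"
        using x0 by (simp add: powr_divide field_simps)
      also have "\<dots> \<le> \<eta> * (c1 * \<beta>) * (g * t ^ k)"
        using xg \<eta> c1_bounds \<beta> by (intro mult_left_mono) auto
      finally have "16 * \<epsilon> \<le> \<eta> * \<rho> * t ^ k / 4 * Lo"
        using True \<rho> by (simp add: Lo_def mult_ac)
      then show ?thesis
        using Lo by (simp add: pos_divide_le_eq)
    qed
    have "0 < \<eta> * \<rho> * t ^ k"
      using \<eta> \<rho> tk by simp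
    then have \<tau>: "16 * \<epsilon> / Lo + 4 * \<rho>\<^sup>2 < \<eta> * \<rho> * t ^ k"
      using quad lin by linarith
    show ?thesis
      using plane_or_point[OF g_cases Lo \<tau>] tr Lo_le unfolding Q_def[symmetric] by blast
  qed
qed

end

context cover_parameters
begin

text \<open>The start of the first dyadic interval at radius \<open>\<rho>\<close>.\<close>

definition base_scale where
  "base_scale \<rho> = (if \<rho> < \<beta> * \<rho>s then (c1 * \<beta> / (2 * \<rho>)) powr (1 / (1 + lam)) else 1)" for \<rho> :: real

lemma base_scale:
  assumes "0 < \<rho>" "\<rho> < \<rho>s"
  shows "1 \<le> base_scale \<rho>" "\<rho> < \<beta> * \<rho>s \<Longrightarrow> base_scale \<rho> powr (1 + lam) * \<rho> = c1 * \<beta> / 2"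
proof -
  have "1 \<le> c1 * \<beta> / (2 * \<rho>)"
    using assms \<rho>s(4) by (simp add: pos_le_divide_eq)
  then show "1 \<le> base_scale \<rho>"
    using lam by (auto simp: base_scale_def intro!: ge_one_powr_ge_zero)
  show "base_scale \<rho> powr (1 + lam) * \<rho> = c1 * \<beta> / 2" if "\<rho> < \<beta> * \<rho>s"
    using that assms lam c1_bounds \<beta> by (simp add: base_scale_def powr_powr)
qed

text \<open>The plane \<open>L\<close> handles the \<open>k\<close>-th dyadic interval at the ball \<open>B\<close>.\<close>

definition covers :: "3 ball_move \<Rightarrow> nat \<Rightarrow> (real ^ 3) set \<Rightarrow> bool" where
  "covers B k L \<longleftrightarrow> affine_hyperplane L \<and>
     (\<forall>v w P. relevant (move_ball B) (snd B) (base_scale (snd B) * 2 ^ k) v w P \<longrightarrow>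
        P \<in> hyperplane_nbhd L (\<eta> * snd B * t ^ k))"

text \<open>A plane that handles the \<open>k\<close>-th dyadic interval, or a fixed plane if there is none.\<close>

definition cover_plane :: "3 ball_move \<Rightarrow> nat \<Rightarrow> (real ^ 3) set" where
  "cover_plane B k = (if \<exists>L. covers B k L then SOME L. covers B k L else {x. axis 1 1 \<bullet> x = 0})"

text \<open>The neighbourhoods requested by Alice at the ball \<open>B\<close>.\<close>

definition cover_family :: "3 ball_move \<Rightarrow> ((real ^ 3) set \<times> real) set" where
  "cover_family B = (if snd B < \<rho>s
     then (\<lambda>k. (cover_plane B k, \<eta> * snd B * t ^ k)) ` {k. 2 ^ k \<le> 1 / (snd B)\<^sup>2} else {})"

lemma cover_plane_covers: "covers B k L \<Longrightarrow> covers B k (cover_plane B k)"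
  unfolding cover_plane_def by (auto intro: someI)

lemma affine_hyperplane_cover_plane: "affine_hyperplane (cover_plane B k)"
proof (cases "\<exists>L. covers B k L")
  case True
  then obtain L where "covers B k L"
    by blast
  then show ?thesis
    using cover_plane_covers[of B k L] by (simp add: covers_def)
next
  case False
  then show ?thesis
    by (auto simp: cover_plane_def intro!: affine_hyperplaneI)
qed

lemma cover_family_admissible:
  assumes B: "0 < snd B" and \<gamma>: "0 < \<gamma>" and \<eta>s: "\<eta> powr \<gamma> \<le> s * (1 - t powr \<gamma>)" and s: "0 < s"
  shows "admissible_family \<gamma> (s * snd B powr \<gamma>) (cover_family B)"
proof -
  define I :: "nat set" where "I = {k. 2 ^ k \<le> 1 / (snd B)\<^sup>2}"
  have "I \<subseteq> {..nat \<lfloor>1 / (snd B)\<^sup>2\<rfloor>}"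
  proof
    fix k assume "k \<in> I"
    then have "2 ^ k \<le> 1 / (snd B)\<^sup>2"
      by (simp add: I_def)
    moreover have "real k < 2 ^ k"
      by (rule of_nat_less_two_power)
    ultimately have "real k \<le> 1 / (snd B)\<^sup>2"
      by linarith
    then show "k \<in> {..nat \<lfloor>1 / (snd B)\<^sup>2\<rfloor>}"
      by simp linarith
  qed
  then have I: "finite I"
    by (rule finite_subset) simp
  define f where "f = (\<lambda>k. (cover_plane B k, \<eta> * snd B * t ^ k))"
  have tg: "0 < t powr \<gamma>" "t powr \<gamma> < 1"
    using t_bounds powr_less_mono2[OF \<gamma>, of t 1] \<gamma> by auto
  have "(\<Sum>A\<in>f ` I. snd A powr \<gamma>) \<le> (\<Sum>k\<in>I. snd (f k) powr \<gamma>)"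
    using sum_image_le[OF I, of "\<lambda>A. snd A powr \<gamma>" f] by (simp add: o_def)
  also have "\<dots> = (\<Sum>k\<in>I. \<eta> powr \<gamma> * snd B powr \<gamma> * (t powr \<gamma>) ^ k)"
  proof (rule sum.cong[OF refl])
    fix k
    have "(t ^ k) powr \<gamma> = (t powr \<gamma>) ^ k"
      using t_bounds by (simp add: powr_realpow[symmetric] powr_powr mult.commute)
    then show "snd (f k) powr \<gamma> = \<eta> powr \<gamma> * snd B powr \<gamma> * (t powr \<gamma>) ^ k"
      using \<eta> B t_bounds by (simp add: f_def powr_mult)
  qed
  also have "\<dots> = \<eta> powr \<gamma> * snd B powr \<gamma> * (\<Sum>k\<in>I. (t powr \<gamma>) ^ k)"
    by (simp add: sum_distrib_left)
  also have "\<dots> \<le> \<eta> powr \<gamma> * snd B powr \<gamma> * (1 / (1 - t powr \<gamma>))"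
  proof (rule mult_left_mono)
    have "(\<Sum>k\<in>I. (t powr \<gamma>) ^ k) \<le> (\<Sum>k. (t powr \<gamma>) ^ k)"
      using tg I by (intro sum_le_suminf summable_geometric) auto
    then show "(\<Sum>k\<in>I. (t powr \<gamma>) ^ k) \<le> 1 / (1 - t powr \<gamma>)"
      using tg by (simp add: suminf_geometric)
  qed simp
  also have "\<dots> \<le> s * (1 - t powr \<gamma>) * snd B powr \<gamma> * (1 / (1 - t powr \<gamma>))"
    using \<eta>s tg by (intro mult_right_mono) auto
  also have "\<dots> = s * snd B powr \<gamma>"
    using tg by simp
  finally have "(\<Sum>A\<in>f ` I. snd A powr \<gamma>) \<le> s * snd B powr \<gamma>" .
  then show ?thesis
    using I affine_hyperplane_cover_plane \<eta> B t_bounds s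
    by (auto simp: admissible_family_def cover_family_def f_def I_def)
qed

text \<open>The proof is by induction on the last coordinate of \<open>v\<close>: a dangerous vector is dealt with at some ball,
  and the point produced by \<open>plane_or_point\<close> would be a dangerous vector with smaller last coordinate.\<close>

lemma outcome_not_danger:
  assumes play: "shrinking_play W \<beta> B" and start: "\<rho>s \<le> snd (B 0)"
    and bound: "\<And>P i. P \<in> move_ball (B 0) \<Longrightarrow> \<bar>P $ i\<bar> \<le> K"
    and x: "\<And>i. x \<in> move_ball (B i)"
    and avoid: "\<And>i A. A \<in> cover_family (B i) \<Longrightarrow> x \<notin> hyperplane_nbhd (fst A) (snd A)"
    and v: "0 < denom v"
  shows "x \<notin> danger lam mu \<epsilon> v"
  using v
proof (induction "nat (denom v)" arbitrary: v rule: less_induct)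
  case less
  note v = less.prems
  have IH: "x \<notin> danger lam mu \<epsilon> u" if "0 < denom u" "denom u < denom v" for u
    using less.hyps[of u] that by simp
  define q where "q = real_of_int (denom v)"
  have q1: "1 \<le> q"
    using v by (simp add: q_def)
  define r where "r = (\<lambda>i. snd (B i))"
  have r0: "\<And>i. 0 < r i" and sub: "\<And>i. move_ball (B (Suc i)) \<subseteq> move_ball (B i)"
    and rS: "\<And>i. \<beta> * r i \<le> r (Suc i)" and lim: "r \<longlonglongrightarrow> 0"
    using play by (auto simp: shrinking_play_def r_def)
  show ?case
  proof
    assume dv: "x \<in> danger lam mu \<epsilon> v"
    obtain A0 B0 C0 where w: "A0 \<noteq> 0 \<or> B0 \<noteq> 0" "A0 * fst v + B0 * fst (snd v) + C0 * denom v = 0"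
      "\<bar>of_int A0\<bar> \<le> q powr lam" "\<bar>of_int B0 - x $ 3 * of_int A0\<bar> \<le> 2 * q powr mu"
      using exists_small_dual_vector[of lam mu "denom v" "fst v" "fst (snd v)" "x $ 3"] lam mu lam_mu v
      unfolding q_def by auto
    define w where "w = (A0, B0, C0)"
    define m where "m = dual_size w x"
    have w': "pairing w v = 0" "w \<noteq> (0, 0, 0)" "\<bar>dual_x w\<bar> \<le> q powr lam" "\<bar>dual_y w x\<bar> \<le> 2 * q powr mu"
      using w by (auto simp: w_def pairing_def denom_def dual_x_def dual_y_def split: prod.splits)
    have m1: "1 \<le> m"
      unfolding m_def using w' v by (intro dual_size_ge_1)
    have "q powr mu \<le> q powr lam"
      using q1 lam lam_mu by (intro powr_mono) auto
    then have m2: "m \<le> 2 * q powr lam"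
      using w' by (simp add: m_def)
    have qm: "q \<le> q * m"
      using q1 m1 by simp
    \<comment> \<open>The ball at which \<open>v\<close> is dealt with is the first good one.\<close>
    define good where "good = (\<lambda>i. r i < \<rho>s \<and> q * m \<le> height_bound q (r i))"
    define i where "i = (LEAST i. good i)"
    have "\<exists>i. good i"
    proof -
      have "0 < min \<rho>s (c1 / (q * m))"
        using \<rho>s c1_bounds q1 m1 by simp
      then have "\<forall>\<^sub>F i in sequentially. r i < min \<rho>s (c1 / (q * m))"
        by (rule order_tendstoD(2)[OF lim])
      then obtain i where ri: "r i < min \<rho>s (c1 / (q * m))"
        by (auto dest: eventually_happens)
      then have "q * m * r i \<le> c1"
        using q1 m1 by (simp add: pos_less_divide_eq mult.commute)
      then have "q * m \<le> c1 / r i"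
        using r0 by (simp add: pos_le_divide_eq)
      also have "\<dots> = c1 * 1 / r i"
        by simp
      also have "\<dots> \<le> height_bound q (r i)"
        unfolding height_bound_def using c1_bounds r0[of i] growth_ge1
        by (intro divide_right_mono mult_left_mono) auto
      finally show ?thesis
        using ri by (auto simp: good_def)
    qed
    then have good: "good i"
      unfolding i_def by (rule LeastI_ex)
    define \<rho> where "\<rho> = r i"
    have \<rho>: "0 < \<rho>" "\<rho> < \<rho>s" "q * m \<le> height_bound q \<rho>"
      using good r0 by (auto simp: good_def \<rho>_def)
    have low: "height_bound q (\<rho> / \<beta>) < q * m" if small: "\<rho> < \<beta> * \<rho>s"
    proof -
      have "\<beta> * \<rho>s \<le> 1 * \<rho>s"
        using \<beta> \<rho>s by (intro mult_right_mono) auto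
      then have "\<rho> \<noteq> r 0"
        using small start unfolding r_def by linarith
      then have "i \<noteq> 0"
        by (cases "i = 0") (auto simp: \<rho>_def)
      then obtain j where j: "i = Suc j"
        by (cases i) auto
      have rj: "r j \<le> \<rho> / \<beta>"
        using rS[of j] \<beta> by (simp add: \<rho>_def j pos_le_divide_eq mult.commute)
      have "\<not> good j"
        using not_less_Least[of j good] j unfolding i_def by simp
      moreover have "r j < \<rho>s"
        using rj small \<beta> by (simp add: pos_le_divide_eq) (smt (verit) mult.commute mult_less_cancel_left_pos)
      ultimately have "height_bound q (r j) < q * m"
        by (simp add: good_def)
      with height_bound_antimono[OF r0 rj, of q] show ?thesis
        by linarith
    qed
    define R where "R = base_scale \<rho>"
    note R = base_scale[OF \<rho>(1,2), folded R_def]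
    have "R \<le> q"
    proof (cases "\<rho> < \<beta> * \<rho>s")
      case True
      have "c1 * 1 / (\<rho> / \<beta>) \<le> height_bound q (\<rho> / \<beta>)"
        unfolding height_bound_def using c1_bounds \<rho> \<beta> growth_ge1
        by (intro divide_right_mono mult_left_mono) auto
      then have "c1 * \<beta> / \<rho> \<le> q * m"
        using low[OF True] by simp
      also have "\<dots> \<le> q * (2 * q powr lam)"
        using m2 q1 by (intro mult_left_mono) auto
      also have "\<dots> = 2 * q powr (1 + lam)"
        using q1 by (simp add: powr_add)
      finally have "c1 * \<beta> / 2 \<le> q powr (1 + lam) * \<rho>"
        using \<rho> by (simp add: pos_divide_le_eq)
      then have "R powr (1 + lam) * \<rho> \<le> q powr (1 + lam) * \<rho>"
        using R(2)[OF True] by simp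
      then have le: "R powr (1 + lam) \<le> q powr (1 + lam)"
        using \<rho> by simp
      show ?thesis
      proof (rule ccontr)
        assume "\<not> R \<le> q"
        then have "q powr (1 + lam) < R powr (1 + lam)"
          using q1 lam by (intro powr_less_mono2) auto
        with le show False
          by simp
      qed
    next
      case False
      then show ?thesis
        using q1 by (simp add: R_def base_scale_def)
    qed
    then have "1 \<le> q / R"
      using R(1) by simp
    then obtain k :: nat where k: "2 ^ k \<le> q / R" "q / R < 2 * 2 ^ k"
      by (rule exists_dyadic_scale)
    have kq: "R * 2 ^ k \<le> q" "q < 2 * (R * 2 ^ k)"
      using k R(1) by (auto simp: field_simps)
    have "1 * 2 ^ k \<le> R * 2 ^ k"
      using R(1) by (intro mult_right_mono) auto
    then have k2: "2 ^ k \<le> q"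
      using kq(1) by linarith
    have "\<rho> \<le> 1"
      using \<rho> \<rho>s by linarith
    moreover have "q \<le> height_bound q \<rho>"
      using qm \<rho>(3) by linarith
    ultimately have "q \<le> 1 / \<rho>\<^sup>2"
      using q1 \<rho>(1) by (intro le_inverse_square)
    then have kk: "2 ^ k \<le> 1 / \<rho>\<^sup>2"
      using k2 by linarith
    have rel: "relevant (move_ball (B i)) \<rho> (R * 2 ^ k) v w x"
      using x[of i] kq dv w' \<rho>(3) low by (simp add: relevant_def q_def m_def)
    have "(cover_plane (B i) k, \<eta> * \<rho> * t ^ k) \<in> cover_family (B i)"
      using kk \<rho>(2) by (auto simp: cover_family_def \<rho>_def r_def)
    then have "x \<notin> hyperplane_nbhd (cover_plane (B i) k) (\<eta> * \<rho> * t ^ k)"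
      using avoid by fastforce
    moreover have "x \<in> hyperplane_nbhd (cover_plane (B i) k) (\<eta> * \<rho> * t ^ k)" if "covers (B i) k (cover_plane (B i) k)"
      using that rel unfolding covers_def \<rho>_def R_def r_def by blast
    ultimately have "\<not> covers (B i) k (cover_plane (B i) k)"
      by blast
    then have no: "\<not> covers (B i) k L" for L
      using cover_plane_covers by blast
    have Bi0: "move_ball (B i) \<subseteq> move_ball (B 0)"
      by (rule lift_Suc_antimono_le[of "\<lambda>n. move_ball (B n)", OF sub]) simp
    have diam: "\<bar>P' $ l - P $ l\<bar> \<le> 2 * \<rho>" if "P \<in> move_ball (B i)" "P' \<in> move_ball (B i)" for P P' l
    proof -
      have "\<bar>(P' - P) $ l\<bar> \<le> norm (P' - P)"
        by (rule component_le_norm_cart)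
      also have "\<dots> = dist P' P"
        by (simp add: dist_norm)
      also have "\<dots> \<le> dist P' (fst (B i)) + dist (fst (B i)) P"
        by (rule dist_triangle)
      also have "\<dots> \<le> 2 * \<rho>"
        using that by (simp add: move_ball_def \<rho>_def r_def dist_commute)
      finally show ?thesis
        by simp
    qed
    have "(\<exists>L. affine_hyperplane L \<and> (\<forall>v w P. relevant (move_ball (B i)) \<rho> (R * 2 ^ k) v w P \<longrightarrow>
             P \<in> hyperplane_nbhd L (\<eta> * \<rho> * t ^ k))) \<or>
       (\<exists>u. 0 < denom u \<and> of_int (denom u) < R * 2 ^ k \<and> move_ball (B i) \<subseteq> danger lam mu \<epsilon> u)"
      using R diam bound Bi0 by (intro plane_for_class[OF \<rho>(1,2)]) auto
    moreover have "\<not> (\<exists>L. affine_hyperplane L \<and> (\<forall>v w P. relevant (move_ball (B i)) \<rho> (R * 2 ^ k) v w P \<longrightarrow>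
             P \<in> hyperplane_nbhd L (\<eta> * \<rho> * t ^ k)))"
      using no unfolding covers_def \<rho>_def R_def r_def by blast
    ultimately obtain u where u: "0 < denom u" "of_int (denom u) < R * 2 ^ k" "move_ball (B i) \<subseteq> danger lam mu \<epsilon> u"
      by blast
    have "denom u < denom v"
      using u(2) kq(1) unfolding q_def by linarith
    with IH[OF u(1)] u(3) x[of i] show False
      by blast
  qed
qed

end

lemma exists_cover_parameters:
  assumes lam: "1 / 2 \<le> lam" and mu: "0 \<le> mu" and lam_mu: "lam + mu = 1"
    and \<beta>: "0 < \<beta>" "\<beta> < 1" and K: "1 \<le> K" and \<eta>: "0 < \<eta>" and \<rho>0: "0 < \<rho>0"
  obtains \<rho>s \<epsilon> where "\<rho>s \<le> \<rho>0"
    "cover_parameters lam mu \<beta> K \<eta> \<rho>s \<epsilon> (1 / (16 * (K + 3))) ((20 / \<epsilon>)\<^sup>2) (2 powr - (1 / 4))"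
proof -
  define c1 where "c1 = 1 / (16 * (K + 3))"
  have c1: "0 < c1"
    using K by (simp add: c1_def)
  define \<rho>s where "\<rho>s = min (min \<rho>0 1) (min ((\<eta> / 16)\<^sup>2) (c1 * \<beta> / 2))"
  have \<rho>s: "0 < \<rho>s" "\<rho>s \<le> \<rho>0" "\<rho>s \<le> 1" "\<rho>s \<le> (\<eta> / 16)\<^sup>2" "\<rho>s \<le> c1 * \<beta> / 2"
    using c1 \<beta> \<eta> \<rho>0 by (auto simp: \<rho>s_def)
  \<comment> \<open>\<open>\<epsilon> * K0 powr (1 / 4)\<close> is a multiple of \<open>sqrt \<epsilon>\<close>, so the last condition on \<open>\<epsilon>\<close> can be met although \<open>K0\<close> grows
    with \<open>1 / \<epsilon>\<close>.\<close>
  define X where "X = (800 / (c1 * \<beta>)) powr (1 / 4)"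
  have X: "0 < X"
    using c1 \<beta> by (simp add: X_def)
  define Y where "Y = \<eta> * (c1 * \<beta>) / (64 * X)"
  have Y: "0 < Y"
    using \<eta> c1 \<beta> X by (simp add: Y_def)
  define \<epsilon> where "\<epsilon> = min (1 / 100) (min (\<eta> * \<beta> * \<rho>s / 64) (Y\<^sup>2))"
  have \<epsilon>: "0 < \<epsilon>" "\<epsilon> \<le> 1 / 100" "64 * \<epsilon> \<le> \<eta> * \<beta> * \<rho>s" "\<epsilon> \<le> Y\<^sup>2"
    using \<eta> \<beta> \<rho>s Y by (auto simp: \<epsilon>_def)
  have "\<epsilon> * (2 * (20 / \<epsilon>)\<^sup>2 / (c1 * \<beta>)) powr (1 / 4) = X * sqrt \<epsilon>"
  proof -
    have "2 * (20 / \<epsilon>)\<^sup>2 / (c1 * \<beta>) = (800 / (c1 * \<beta>)) * \<epsilon> powr - 2"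
      using \<epsilon> by (simp add: powr_minus powr_numeral power_divide field_simps)
    then have "(2 * (20 / \<epsilon>)\<^sup>2 / (c1 * \<beta>)) powr (1 / 4) = X * \<epsilon> powr - (1 / 2)"
      using c1 \<beta> \<epsilon> by (simp only: powr_mult X_def powr_powr) simp
    moreover have "\<epsilon> * \<epsilon> powr - (1 / 2) = sqrt \<epsilon>"
      using \<epsilon> by (simp add: powr_minus powr_half_sqrt real_div_sqrt flip: divide_inverse)
    ultimately show ?thesis
      by (simp add: mult.left_commute)
  qed
  moreover have "64 * (X * sqrt \<epsilon>) \<le> \<eta> * (c1 * \<beta>)"
  proof -
    have "sqrt \<epsilon> \<le> Y"
      using \<epsilon> Y by (intro real_le_lsqrt) auto
    then have "64 * (X * sqrt \<epsilon>) \<le> 64 * (X * Y)"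
      using X by simp
    also have "\<dots> = \<eta> * (c1 * \<beta>)"
      using X by (simp add: Y_def)
    finally show ?thesis .
  qed
  ultimately have "cover_parameters lam mu \<beta> K \<eta> \<rho>s \<epsilon> c1 ((20 / \<epsilon>)\<^sup>2) (2 powr - (1 / 4))"
    using lam mu lam_mu \<beta> K \<eta> \<rho>s \<epsilon> c1_def by unfold_locales (auto simp: mult.assoc)
  then show ?thesis
    using that[OF \<rho>s(2)] unfolding c1_def by blast
qed

lemma HAW_on_if_contains_not_danger:
  fixes S :: "(real ^ 3) set"
  assumes lam: "1 / 2 \<le> lam" and mu: "0 \<le> mu" and lam_mu: "lam + mu = 1"
    and S: "\<And>\<epsilon> x. 0 < \<epsilon> \<Longrightarrow> (\<And>v. 0 < denom v \<Longrightarrow> x \<notin> danger lam mu \<epsilon> v) \<Longrightarrow> x \<in> S"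
  shows "HAW_on W S"
  unfolding HAW_on_def
proof (intro allI impI, elim conjE)
  fix \<beta> :: real assume \<beta>: "0 < \<beta>" "\<beta> < 1 / 3"
  then have \<beta>1: "\<beta> < 1"
    by simp
  obtain \<gamma> s :: real where \<gamma>: "0 < \<gamma>" and s: "0 < s" and game:
    "\<forall>(W :: (real ^ 3) set) S F.
      (\<forall>b0 b. 0 < snd b0 \<longrightarrow> 0 < snd b \<longrightarrow> admissible_family \<gamma> (s * snd b powr \<gamma>) (F b0 b)) \<longrightarrow>
      (\<forall>B x. shrinking_play W \<beta> B \<longrightarrow> (\<forall>i. x \<in> move_ball (B i)) \<longrightarrow>
         (\<forall>i. \<forall>A\<in>F (B 0) (B i). x \<notin> hyperplane_nbhd (fst A) (snd A)) \<longrightarrow> x \<in> S) \<longrightarrow>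
      (\<exists>\<sigma>. winning_strategy W S \<beta> \<sigma>)"
    by (rule potential_game_winning[OF \<beta>])
  define t :: real where "t = 2 powr - (1 / 4)"
  have t: "0 < t" "t < 1"
    using powr_less_one[of 2 "- (1 / 4)"] by (auto simp: t_def)
  have tg: "t powr \<gamma> < 1"
    using t powr_less_mono2[OF \<gamma>, of t 1] by simp
  define \<eta> where "\<eta> = (s * (1 - t powr \<gamma>)) powr (1 / \<gamma>)"
  have \<eta>0: "0 < \<eta>" and \<eta>_powr: "\<eta> powr \<gamma> = s * (1 - t powr \<gamma>)"
    using s tg \<gamma> by (auto simp: \<eta>_def powr_powr)
  have "\<exists>\<F>. (\<forall>b. 0 < snd b \<longrightarrow> admissible_family \<gamma> (s * snd b powr \<gamma>) (\<F> b)) \<and>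
      (\<forall>B x. B 0 = b0 \<longrightarrow> shrinking_play W \<beta> B \<longrightarrow> (\<forall>i. x \<in> move_ball (B i)) \<longrightarrow>
         (\<forall>i. \<forall>A\<in>\<F> (B i). x \<notin> hyperplane_nbhd (fst A) (snd A)) \<longrightarrow> x \<in> S)"
    if b0: "0 < snd b0" for b0 :: "3 ball_move"
  proof -
    define K where "K = 1 + norm (fst b0) + snd b0"
    have K: "1 \<le> K"
      using b0 by (simp add: K_def)
    have bound: "\<bar>P $ i\<bar> \<le> K" if "P \<in> move_ball b0" for P i
    proof -
      have "\<bar>P $ i\<bar> \<le> norm P"
        by (rule component_le_norm_cart)
      also have "\<dots> \<le> norm (fst b0) + dist (fst b0) P"
        by (metis dist_norm norm_minus_commute norm_triangle_sub)
      also have "\<dots> \<le> K"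
        using that by (simp add: move_ball_def K_def)
      finally show ?thesis .
    qed
    obtain \<rho>s \<epsilon> where start: "\<rho>s \<le> snd b0"
      and cp: "cover_parameters lam mu \<beta> K \<eta> \<rho>s \<epsilon> (1 / (16 * (K + 3))) ((20 / \<epsilon>)\<^sup>2) t"
      unfolding t_def
      by (rule exists_cover_parameters[OF lam mu lam_mu \<beta>(1) \<beta>1 K \<eta>0 b0])
    interpret cover_parameters lam mu \<beta> K \<eta> \<rho>s \<epsilon> "1 / (16 * (K + 3))" "(20 / \<epsilon>)\<^sup>2" t
      by (rule cp)
    have "admissible_family \<gamma> (s * snd b powr \<gamma>) (cover_family b)" if "0 < snd b" for b
      using that \<gamma> \<eta>_powr s by (intro cover_family_admissible) auto
    moreover have "x \<in> S" if B: "B 0 = b0" "shrinking_play W \<beta> B" "\<forall>i. x \<in> move_ball (B i)"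
      "\<forall>i. \<forall>A\<in>cover_family (B i). x \<notin> hyperplane_nbhd (fst A) (snd A)" for B x
    proof (rule S[OF \<epsilon>(1)])
      fix v assume "0 < denom v"
      then show "x \<notin> danger lam mu \<epsilon> v"
        using B bound start by (intro outcome_not_danger[OF B(2)]) auto
    qed
    ultimately show ?thesis
      by blast
  qed
  then obtain F where F: "\<And>b0. 0 < snd b0 \<Longrightarrow>
      (\<forall>b. 0 < snd b \<longrightarrow> admissible_family \<gamma> (s * snd b powr \<gamma>) (F b0 b)) \<and>
      (\<forall>B x. B 0 = b0 \<longrightarrow> shrinking_play W \<beta> B \<longrightarrow> (\<forall>i. x \<in> move_ball (B i)) \<longrightarrow>
         (\<forall>i. \<forall>A\<in>F b0 (B i). x \<notin> hyperplane_nbhd (fst A) (snd A)) \<longrightarrow> x \<in> S)"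
    by metis
  have "\<forall>b0 b. 0 < snd b0 \<longrightarrow> 0 < snd b \<longrightarrow> admissible_family \<gamma> (s * snd b powr \<gamma>) (F b0 b)"
    using F by blast
  moreover have "\<forall>B x. shrinking_play W \<beta> B \<longrightarrow> (\<forall>i. x \<in> move_ball (B i)) \<longrightarrow>
         (\<forall>i. \<forall>A\<in>F (B 0) (B i). x \<notin> hyperplane_nbhd (fst A) (snd A)) \<longrightarrow> x \<in> S"
  proof (intro allI impI)
    fix B x
    assume B: "shrinking_play W \<beta> B" "\<forall>i. x \<in> move_ball (B i)"
      "\<forall>i. \<forall>A\<in>F (B 0) (B i). x \<notin> hyperplane_nbhd (fst A) (snd A)"
    then have "0 < snd (B 0)"
      by (simp add: shrinking_play_def)
    from F[OF this] B show "x \<in> S"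
      by blast
  qed
  ultimately show "\<exists>\<sigma>. winning_strategy W S \<beta> \<sigma>"
    using game by blast
qed


section \<open>Mahler's criterion in dimension three\<close>

lemma gram_identity:
  fixes u v w :: "real ^ 3"
  shows "(v \<bullet> cross3 u w)\<^sup>2 = (v \<bullet> v) * (u \<bullet> u) * (w \<bullet> w) + 2 * (v \<bullet> u) * (u \<bullet> w) * (w \<bullet> v)
     - (v \<bullet> v) * (u \<bullet> w)\<^sup>2 - (u \<bullet> u) * (v \<bullet> w)\<^sup>2 - (w \<bullet> w) * (v \<bullet> u)\<^sup>2"
  unfolding cross3_def inner_vec_def sum_3 inner_real_def vector_3
  by (simp add: power2_eq_square algebra_simps)

lemma exists_int_nearest: "\<exists>m :: int. \<bar>x + of_int m\<bar> \<le> (1 / 2 :: real)"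
  by (rule exI[of _ "- round x"]) (use of_int_round_abs_le[of x] in \<open>simp add: abs_minus_commute\<close>)

text \<open>A basis of a lattice of covolume one that is reduced up to the error \<open>\<delta>\<^sup>2 / 4\<close> and has its shortest vector of
  norm at least \<open>\<delta>\<close> is bounded: each vector is comparable to its component orthogonal to the shorter ones,
  and the product of the lengths of these components is one.\<close>

lemma reduced_basis_bound:
  fixes b1 b2 b3 :: "real ^ 3"
  assumes vol: "\<bar>b3 \<bullet> cross3 b1 b2\<bar> = 1" and \<delta>: "0 < \<delta>" "\<delta> \<le> norm b1"
    and le: "norm b1 \<le> norm b2" "norm b2 \<le> norm b3"
    and red2: "\<And>m :: int. (norm b2)\<^sup>2 \<le> (norm (b2 + of_int m *\<^sub>R b1))\<^sup>2 + \<delta>\<^sup>2 / 4"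
    and red3: "\<And>m n :: int. (norm b3)\<^sup>2 \<le> (norm (b3 + of_int m *\<^sub>R b1 + of_int n *\<^sub>R b2))\<^sup>2 + \<delta>\<^sup>2 / 4"
  shows "(norm b3)\<^sup>2 \<le> 8 / \<delta> ^ 4"
proof -
  define U where "U = b1 \<bullet> b1"
  have \<delta>U: "\<delta>\<^sup>2 \<le> U"
    using \<delta> power_mono[of \<delta> "norm b1" 2] by (simp add: U_def power2_norm_eq_inner)
  have U0: "0 < U"
    using \<delta>U \<delta> zero_less_power[of \<delta> 2] by linarith
  have U2: "U \<le> (norm b2)\<^sup>2" and U3: "(norm b2)\<^sup>2 \<le> (norm b3)\<^sup>2"
    using le by (auto simp: U_def power2_norm_eq_inner[symmetric] intro!: power_mono)
  define k where "k = (b2 \<bullet> b1) / U"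
  define c where "c = b2 - k *\<^sub>R b1"
  define V where "V = c \<bullet> c"
  have cb: "c \<bullet> b1 = 0" "b1 \<bullet> c = 0"
    using U0 by (auto simp: c_def k_def U_def inner_diff_left inner_diff_right inner_commute)
  have b2: "b2 = c + k *\<^sub>R b1"
    by (simp add: c_def)
  have b2sq: "(norm b2)\<^sup>2 = V + k\<^sup>2 * U"
    unfolding power2_norm_eq_inner b2 U_def V_def
    by (simp add: inner_add_left inner_add_right cb power2_eq_square algebra_simps)
  obtain m :: int where m: "\<bar>k + m\<bar> \<le> 1 / 2"
    using exists_int_nearest by blast
  have half_sq: "x\<^sup>2 \<le> 1 / 4" if "\<bar>x\<bar> \<le> 1 / 2" for x :: real
    using power_mono[OF that, of 2] by (simp add: power_divide)
  have "(norm (b2 + of_int m *\<^sub>R b1))\<^sup>2 = V + (k + m)\<^sup>2 * U"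
  proof -
    have "b2 + of_int m *\<^sub>R b1 = c + (k + m) *\<^sub>R b1"
      by (simp add: b2 algebra_simps)
    then show ?thesis
      unfolding power2_norm_eq_inner U_def V_def
      by (simp add: inner_add_left inner_add_right cb power2_eq_square algebra_simps)
  qed
  also have "\<dots> \<le> V + 1 / 4 * U"
    using half_sq[OF m] U0 by (intro add_left_mono mult_right_mono) auto
  finally have "(norm b2)\<^sup>2 \<le> V + U / 4 + \<delta>\<^sup>2 / 4"
    using red2[of m] by linarith
  then have V2: "(norm b2)\<^sup>2 / 2 \<le> V"
    using U2 \<delta>U by linarith
  then have \<delta>V: "\<delta>\<^sup>2 / 2 \<le> V"
    using \<delta>U U2 by linarith
  have V0: "0 < V"
    using V2 U2 U0 by linarith
  have Vb2: "V \<le> (norm b2)\<^sup>2"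
    using b2sq U0 by simp
  define t where "t = (b3 \<bullet> c) / V"
  obtain n :: int where n: "\<bar>t + n\<bar> \<le> 1 / 2"
    using exists_int_nearest by blast
  define s where "s = ((b3 + of_int n *\<^sub>R b2) \<bullet> b1) / U"
  obtain l :: int where l: "\<bar>s + l\<bar> \<le> 1 / 2"
    using exists_int_nearest by blast
  define d where "d = b3 + of_int l *\<^sub>R b1 + of_int n *\<^sub>R b2"
  have dc: "d \<bullet> c = (t + n) * V"
    using V0 unfolding d_def b2 by (simp add: inner_add_left cb t_def V_def[symmetric] algebra_simps)
  have "s * U = (b3 + of_int n *\<^sub>R b2) \<bullet> b1"
    using U0 by (simp add: s_def)
  then have db: "d \<bullet> b1 = (s + l) * U"
    by (simp add: d_def inner_add_left U_def[symmetric] distrib_right)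
  have "d \<bullet> cross3 b1 c = b3 \<bullet> cross3 b1 b2"
    by (simp add: d_def c_def inner_vec_def sum_3 cross3_simps algebra_simps)
  then have dvol: "(d \<bullet> cross3 b1 c)\<^sup>2 = 1"
    using vol by (metis power2_abs one_power2)
  have "1 = (d \<bullet> d) * U * V - U * ((t + n) * V)\<^sup>2 - V * ((s + l) * U)\<^sup>2"
    using gram_identity[of d b1 c] unfolding dvol
    by (simp add: cb dc db U_def[symmetric] V_def[symmetric] mult_ac)
  then have "(d \<bullet> d) * (U * V) = 1 + (U * V) * ((t + n)\<^sup>2 * V + (s + l)\<^sup>2 * U)"
    by (simp add: power2_eq_square algebra_simps)
  also have "\<dots> \<le> 1 + (U * V) * (1 / 4 * V + 1 / 4 * U)"
    using half_sq[OF n] half_sq[OF l] U0 V0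
    by (intro add_left_mono mult_left_mono add_mono mult_right_mono) auto
  finally have "(d \<bullet> d) \<le> (1 + (U * V) * (1 / 4 * V + 1 / 4 * U)) / (U * V)"
    using U0 V0 by (simp add: pos_le_divide_eq)
  also have "\<dots> = 1 / (U * V) + V / 4 + U / 4"
    using U0 V0 by (simp add: add_divide_distrib)
  finally have "(norm b3)\<^sup>2 \<le> 1 / (U * V) + V / 4 + U / 4 + \<delta>\<^sup>2 / 4"
    using red3[of l n] by (simp add: d_def power2_norm_eq_inner)
  then have "(norm b3)\<^sup>2 \<le> 4 * (1 / (U * V))"
    using Vb2 U2 U3 \<delta>U by linarith
  also have "\<dots> \<le> 4 * (1 / (\<delta>\<^sup>2 * (\<delta>\<^sup>2 / 2)))"
    using \<delta>U \<delta>V U0 V0 \<delta> by (intro mult_left_mono divide_left_mono mult_mono mult_pos_pos) auto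
  also have "\<dots> = 8 / \<delta> ^ 4"
    by (simp add: power2_eq_square eval_nat_numeral)
  finally show ?thesis .
qed

lemma SL3Z_mult: "A \<in> SL3Z \<Longrightarrow> B \<in> SL3Z \<Longrightarrow> A ** B \<in> SL3Z"
  unfolding SL3Z_def by (simp add: det_mul) (simp add: matrix_matrix_mult_def Ints_sum Ints_mult)

lemma SL3Z_inverse:
  assumes "A \<in> SL3Z"
  obtains A' where "A' \<in> SL3Z" "A ** A' = mat 1"
proof -
  define A' :: "real ^ 3 ^ 3" where "A' = vector
    [vector [A$2$2 * A$3$3 - A$2$3 * A$3$2, A$1$3 * A$3$2 - A$1$2 * A$3$3, A$1$2 * A$2$3 - A$1$3 * A$2$2],
     vector [A$2$3 * A$3$1 - A$2$1 * A$3$3, A$1$1 * A$3$3 - A$1$3 * A$3$1, A$1$3 * A$2$1 - A$1$1 * A$2$3],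
     vector [A$2$1 * A$3$2 - A$2$2 * A$3$1, A$1$2 * A$3$1 - A$1$1 * A$3$2, A$1$1 * A$2$2 - A$1$2 * A$2$1]]"
  have det: "det A = 1" and ints: "\<And>i j. A $ i $ j \<in> \<int>"
    using assms by (auto simp: SL3Z_def)
  have inv: "A ** A' = mat 1"
    using det unfolding det_3
    by (simp add: vec_eq_iff forall_3 matrix_matrix_mult_def sum_3 A'_def mat_def) (simp add: algebra_simps)
  moreover have "det A' = 1"
    using arg_cong[OF inv, of det] det by (simp add: det_mul)
  moreover have "A' $ i $ j \<in> \<int>" for i j
    using exhaust_3[of i] exhaust_3[of j] ints by (auto simp: A'_def intro!: Ints_diff Ints_mult)
  ultimately show ?thesis
    using that[of A'] by (auto simp: SL3Z_def)
qed

text \<open>The elementary integer matrix that adds, from the right, \<open>m\<close> times column \<open>i\<close> and \<open>n\<close> times column \<open>j\<close> to column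
  \<open>k\<close>.\<close>

definition shear :: "3 \<Rightarrow> 3 \<Rightarrow> 3 \<Rightarrow> int \<Rightarrow> int \<Rightarrow> real ^ 3 ^ 3" where
  "shear i j k m n = (\<chi> r c. if r = c then 1 else if c = k \<and> r = i then of_int m
                              else if c = k \<and> r = j then of_int n else 0)"

lemma shear_SL3Z:
  assumes "i \<noteq> j" "i \<noteq> k" "j \<noteq> k"
  shows "shear i j k m n \<in> SL3Z"
proof -
  have "det (shear i j k m n) = 1"
    using assms exhaust_3[of i] exhaust_3[of j] exhaust_3[of k]
    by (auto simp: det_3 shear_def)
  then show ?thesis
    by (auto simp: SL3Z_def shear_def)
qed

lemma column_shear:
  assumes "i \<noteq> j" "i \<noteq> k" "j \<noteq> k"
  shows "column c (G ** shear i j k m n) =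
    (if c = k then column k G + of_int m *\<^sub>R column i G + of_int n *\<^sub>R column j G else column c G)"
  using assms exhaust_3[of i] exhaust_3[of j] exhaust_3[of k] exhaust_3[of c]
  by (auto simp: vec_eq_iff column_def matrix_matrix_mult_def sum_3 shear_def algebra_simps)

lemma triple_product_columns:
  fixes G :: "real ^ 3 ^ 3"
  assumes "i \<noteq> j" "i \<noteq> k" "j \<noteq> k"
  shows "\<bar>column k G \<bullet> cross3 (column i G) (column j G)\<bar> = \<bar>det G\<bar>"
  using assms exhaust_3[of i] exhaust_3[of j] exhaust_3[of k]
  by (auto simp: det_3 inner_vec_def sum_3 cross3_def column_def algebra_simps)

lemma sorted_indices_3:
  fixes f :: "3 \<Rightarrow> real"
  obtains i j k where "i \<noteq> j" "i \<noteq> k" "j \<noteq> k" "f i \<le> f j" "f j \<le> f k" "\<And>c. f c \<le> f k"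
proof -
  note result = that
  have H: thesis if "i \<noteq> j" "i \<noteq> k" "j \<noteq> k" "f i \<le> f j" "f j \<le> f k" "UNIV = {i, j, k}" for i j k
  proof (rule result[OF that(1-5)])
    fix c
    have "c \<in> {i, j, k}"
      by (rule subst[OF that(6), of "\<lambda>S. c \<in> S"]) simp
    then show "f c \<le> f k"
      using that(4,5) by fastforce
  qed
  have U: "UNIV = {1, 2, 3::3}" "UNIV = {1, 3, 2::3}" "UNIV = {2, 1, 3::3}"
    "UNIV = {2, 3, 1::3}" "UNIV = {3, 1, 2::3}" "UNIV = {3, 2, 1::3}"
    using UNIV_3 by auto
  consider "f 1 \<le> f 2" "f 2 \<le> f 3" | "f 1 \<le> f 3" "f 3 \<le> f 2" | "f 2 \<le> f 1" "f 1 \<le> f 3"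
    | "f 2 \<le> f 3" "f 3 \<le> f 1" | "f 3 \<le> f 1" "f 1 \<le> f 2" | "f 3 \<le> f 2" "f 2 \<le> f 1"
    by linarith
  then show ?thesis
    by cases (rule H; (assumption | rule U | simp))+
qed

text \<open>The representative minimises the sum of the squared column norms up to \<open>\<delta>\<^sup>2 / 4\<close>. An approximate minimum
  exists without any discreteness argument and is all that \<open>reduced_basis_bound\<close> needs.\<close>

lemma bounded_representative:
  fixes g :: "real ^ 3 ^ 3"
  assumes det: "det g = 1" and \<delta>: "0 < \<delta>"
    and min: "\<And>v. v \<noteq> 0 \<Longrightarrow> (\<And>i. v $ i \<in> \<int>) \<Longrightarrow> \<delta> \<le> norm (g *v v)"
  obtains A where "A \<in> SL3Z" "\<And>i j. \<bar>(g ** A) $ i $ j\<bar> \<le> 3 / \<delta>\<^sup>2"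
proof -
  define f :: "real ^ 3 ^ 3 \<Rightarrow> real" where "f = (\<lambda>A. \<Sum>c\<in>UNIV. (norm (column c (g ** A)))\<^sup>2)"
  have f0: "0 \<le> f A" for A
    by (simp add: f_def sum_nonneg)
  have one: "mat 1 \<in> SL3Z"
    unfolding SL3Z_def by simp (simp add: mat_def)
  define I where "I = Inf (f ` SL3Z)"
  have bdd: "bdd_below (f ` SL3Z)"
    using f0 by (auto simp: bdd_below_def)
  have "\<exists>y\<in>f ` SL3Z. y < I + \<delta>\<^sup>2 / 4"
    unfolding I_def using one \<delta> by (intro cInf_lessD) auto
  then obtain A where A: "A \<in> SL3Z" "f A < I + \<delta>\<^sup>2 / 4"
    by blast
  have near: "f A \<le> f A' + \<delta>\<^sup>2 / 4" if "A' \<in> SL3Z" for A'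
    using cInf_lower[OF _ bdd, of "f A'"] that A(2) unfolding I_def by fastforce
  define b where "b = (\<lambda>c. column c (g ** A))"
  have \<delta>b: "\<delta> \<le> norm (b c)" for c
  proof -
    have "b c = g *v column c A"
      by (simp add: b_def vec_eq_iff column_def matrix_vector_mult_def matrix_matrix_mult_def)
    moreover have "column c A \<noteq> 0"
    proof
      assume "column c A = 0"
      then have "det A = 0"
        using det_zero_column(1) by blast
      then show False
        using A(1) by (simp add: SL3Z_def)
    qed
    moreover have "column c A $ i \<in> \<int>" for i
      using A(1) by (simp add: SL3Z_def column_def)
    ultimately show ?thesis
      using min by simp
  qed
  have red: "(norm (b k))\<^sup>2 \<le> (norm (b k + of_int m *\<^sub>R b i + of_int n *\<^sub>R b j))\<^sup>2 + \<delta>\<^sup>2 / 4"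
    if ijk: "i \<noteq> j" "i \<noteq> k" "j \<noteq> k" for i j k m n
  proof -
    have "A ** shear i j k m n \<in> SL3Z"
      using A(1) shear_SL3Z[OF ijk] by (rule SL3Z_mult)
    then have "f A \<le> f (A ** shear i j k m n) + \<delta>\<^sup>2 / 4"
      by (rule near)
    also have "f (A ** shear i j k m n) = (\<Sum>c\<in>UNIV.
        (norm (if c = k then b k + of_int m *\<^sub>R b i + of_int n *\<^sub>R b j else b c))\<^sup>2)"
      unfolding f_def matrix_mul_assoc column_shear[OF ijk] b_def ..
    also have "\<dots> = (norm (b k + of_int m *\<^sub>R b i + of_int n *\<^sub>R b j))\<^sup>2 + (\<Sum>c\<in>UNIV - {k}. (norm (b c))\<^sup>2)"
      by (subst sum.remove[of _ k]) auto
    also have "f A = (norm (b k))\<^sup>2 + (\<Sum>c\<in>UNIV - {k}. (norm (b c))\<^sup>2)"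
      unfolding f_def b_def by (rule sum.remove) auto
    finally show ?thesis
      by simp
  qed
  obtain i j k where ijk: "i \<noteq> j" "i \<noteq> k" "j \<noteq> k"
    and le: "norm (b i) \<le> norm (b j)" "norm (b j) \<le> norm (b k)" and max: "\<And>c. norm (b c) \<le> norm (b k)"
    using sorted_indices_3[of "\<lambda>c. norm (b c)"] by blast
  have "det (g ** A) = 1"
    using det A(1) by (simp add: det_mul SL3Z_def)
  then have vol: "\<bar>b k \<bullet> cross3 (b i) (b j)\<bar> = 1"
    using triple_product_columns[OF ijk, of "g ** A"] by (simp add: b_def)
  have "(norm (b k))\<^sup>2 \<le> 8 / \<delta> ^ 4"
  proof (rule reduced_basis_bound[OF vol \<delta> \<delta>b le])
    show "(norm (b j))\<^sup>2 \<le> (norm (b j + of_int m *\<^sub>R b i))\<^sup>2 + \<delta>\<^sup>2 / 4" for m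
      using red[of i k j m 0] ijk by auto
    show "(norm (b k))\<^sup>2 \<le> (norm (b k + of_int m *\<^sub>R b i + of_int n *\<^sub>R b j))\<^sup>2 + \<delta>\<^sup>2 / 4" for m n
      using red[OF ijk] .
  qed
  also have "\<dots> \<le> (3 / \<delta>\<^sup>2)\<^sup>2"
    using \<delta> by (simp add: power_divide field_simps)
  finally have bk: "norm (b k) \<le> 3 / \<delta>\<^sup>2"
    using \<delta> by (rule_tac power2_le_imp_le) auto
  have "\<bar>(g ** A) $ r $ c\<bar> \<le> 3 / \<delta>\<^sup>2" for r c
  proof -
    have "\<bar>(g ** A) $ r $ c\<bar> = \<bar>b c $ r\<bar>"
      by (simp add: b_def column_def)
    also have "\<dots> \<le> norm (b c)"
      by (rule component_le_norm_cart)
    finally show ?thesis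
      using max[of c] bk by linarith
  qed
  with A(1) show ?thesis
    by (rule that)
qed

lemma compact_bounded_SL3R: "compact {G :: real ^ 3 ^ 3. det G = 1 \<and> (\<forall>i j. \<bar>G $ i $ j\<bar> \<le> C)}"
proof (rule compact_eq_bounded_closed[THEN iffD2], rule conjI)
  have "norm G \<le> (\<Sum>i\<in>(UNIV :: 3 set). \<Sum>j\<in>(UNIV :: 3 set). C)" if G: "\<And>i j. \<bar>G $ i $ j\<bar> \<le> C" for G :: "real ^ 3 ^ 3"
  proof -
    have "norm G \<le> (\<Sum>i\<in>UNIV. norm (G $ i))"
      unfolding norm_vec_def by (rule L2_set_le_sum) simp
    also have "\<dots> \<le> (\<Sum>i\<in>UNIV. \<Sum>j\<in>UNIV. \<bar>G $ i $ j\<bar>)"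
      by (intro sum_mono norm_le_l1_cart)
    also have "\<dots> \<le> (\<Sum>i\<in>(UNIV :: 3 set). \<Sum>j\<in>(UNIV :: 3 set). C)"
      by (intro sum_mono G)
    finally show ?thesis .
  qed
  then show "bounded {G :: real ^ 3 ^ 3. det G = 1 \<and> (\<forall>i j. \<bar>G $ i $ j\<bar> \<le> C)}"
    unfolding bounded_iff by blast
  have "closed {G :: real ^ 3 ^ 3. det G = 1}"
    unfolding det_3 by (intro closed_Collect_eq continuous_intros)
  moreover have "closed {G :: real ^ 3 ^ 3. \<forall>i j. \<bar>G $ i $ j\<bar> \<le> C}"
    by (intro closed_Collect_all closed_Collect_le continuous_intros)
  ultimately show "closed {G :: real ^ 3 ^ 3. det G = 1 \<and> (\<forall>i j. \<bar>G $ i $ j\<bar> \<le> C)}"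
    by (auto simp: Collect_conj_eq)
qed

text \<open>The sufficient half of Mahler's criterion for sets of lattices in dimension three.\<close>

lemma bounded_in_quotientI:
  fixes \<G> :: "(real ^ 3 ^ 3) set"
  assumes \<delta>: "0 < \<delta>" and det: "\<And>g. g \<in> \<G> \<Longrightarrow> det g = 1"
    and min: "\<And>g v. g \<in> \<G> \<Longrightarrow> v \<noteq> 0 \<Longrightarrow> (\<And>i. v $ i \<in> \<int>) \<Longrightarrow> \<delta> \<le> norm (g *v v)"
  shows "bounded_in_quotient ((\<lambda>g. g <#\<^bsub>SL3R\<^esub> SL3Z) ` \<G>)"
proof -
  define S where "S = {G :: real ^ 3 ^ 3. det G = 1 \<and> (\<forall>i j. \<bar>G $ i $ j\<bar> \<le> 3 / \<delta>\<^sup>2)}"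
  define q where "q = (\<lambda>g. g <#\<^bsub>SL3R\<^esub> SL3Z)"
  have "compactin (top_of_set (carrier SL3R)) S"
    using compact_bounded_SL3R[of "3 / \<delta>\<^sup>2"]
    by (auto simp: compactin_subtopology S_def SL3R_def)
  moreover have "continuous_map (top_of_set (carrier SL3R)) SL3_quotient q"
    unfolding SL3_quotient_def q_def by (intro quotient_imp_continuous_map quotient_map_quotient_topology)
  ultimately have "compactin SL3_quotient (q ` S)"
    by (rule image_compactin)
  moreover have "q g \<in> q ` S" if g: "g \<in> \<G>" for g
  proof -
    obtain A where A: "A \<in> SL3Z" "\<And>i j. \<bar>(g ** A) $ i $ j\<bar> \<le> 3 / \<delta>\<^sup>2"
      using bounded_representative[OF det[OF g] \<delta> min[OF g]] by blast
    obtain A' where A': "A' \<in> SL3Z" "A ** A' = mat 1"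
      using SL3Z_inverse[OF A(1)] .
    have "q g = q (g ** A)"
    proof (intro equalityI subsetI)
      fix h assume "h \<in> q g"
      then obtain c where c: "c \<in> SL3Z" "h = g ** c"
        by (auto simp: q_def l_coset_def SL3R_def)
      have "h = (g ** A) ** (A' ** c)"
        by (metis A'(2) c(2) matrix_mul_assoc matrix_mul_rid)
      then show "h \<in> q (g ** A)"
        using SL3Z_mult[OF A'(1) c(1)] by (auto simp: q_def l_coset_def SL3R_def)
    next
      fix h assume "h \<in> q (g ** A)"
      then obtain c where c: "c \<in> SL3Z" "h = (g ** A) ** c"
        by (auto simp: q_def l_coset_def SL3R_def)
      then show "h \<in> q g"
        using SL3Z_mult[OF A(1) c(1)] by (auto simp: q_def l_coset_def SL3R_def matrix_mul_assoc[symmetric])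
    qed
    moreover have "g ** A \<in> S"
      using A det[OF g] by (simp add: S_def det_mul SL3Z_def)
    ultimately show ?thesis
      by blast
  qed
  ultimately show ?thesis
    unfolding bounded_in_quotient_def q_def by blast
qed


section \<open>Bounded orbits\<close>

text \<open>A vector that gets shorter than \<open>min 1 \<epsilon>\<close> at time \<open>t\<close> has last coordinate less than \<open>exp t\<close>, and its other
  coordinates then put \<open>P\<close> into its danger set. A vector with last coordinate zero is not contracted at all.\<close>

lemma bounded_orbit_if_not_danger:
  assumes \<epsilon>: "0 < \<epsilon>" and lm: "0 \<le> lam" "0 \<le> mu" "lam + mu = 1"
    and P: "\<And>v. 0 < denom v \<Longrightarrow> P \<notin> danger lam mu \<epsilon> v"
  shows "u_mat (P $ 1) (P $ 2) (P $ 3) <#\<^bsub>SL3R\<^esub> SL3Z \<in> bounded_orbit_points (F_plus lam mu)"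
proof -
  define u where "u = u_mat (P $ 1) (P $ 2) (P $ 3)"
  define \<delta> where "\<delta> = min 1 \<epsilon>"
  have \<delta>: "0 < \<delta>" "\<delta> \<le> 1" "\<delta> \<le> \<epsilon>"
    using \<epsilon> by (auto simp: \<delta>_def)
  define \<G> where "\<G> = (\<lambda>g. g ** u) ` F_plus lam mu"
  have det_u: "det u = 1"
    by (simp add: u_def u_mat_def det_3)
  have "orbit (F_plus lam mu) (u <#\<^bsub>SL3R\<^esub> SL3Z) = (\<lambda>g. g <#\<^bsub>SL3R\<^esub> SL3Z) ` \<G>"
    unfolding orbit_def \<G>_def image_image
    by (intro image_cong refl) (auto simp: l_coset_def SL3R_def matrix_mul_assoc)
  moreover have "bounded_in_quotient ((\<lambda>g. g <#\<^bsub>SL3R\<^esub> SL3Z) ` \<G>)"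
  proof (rule bounded_in_quotientI[OF \<delta>(1)])
    fix g assume "g \<in> \<G>"
    then obtain t where t: "0 \<le> t" "g = diag_flow lam mu t ** u"
      by (auto simp: \<G>_def F_plus_def)
    have "det (diag_flow lam mu t) = exp (lam * t + mu * t + - t)"
      by (simp add: diag_flow_def det_3 exp_add exp_diff exp_minus field_simps)
    also have "lam * t + mu * t + - t = 0"
      using lm(3) by (simp add: distrib_right[symmetric])
    finally show "det g = 1"
      using det_u by (simp add: t det_mul)
    fix v :: "real ^ 3" assume v0: "v \<noteq> 0" and ints: "\<And>i. v $ i \<in> \<int>"
    have pos: "\<delta> \<le> norm (g *v v)" if "v \<noteq> 0" and ints: "\<And>i. v $ i \<in> \<int>" and "0 \<le> v $ 3" for v
    proof (rule ccontr)
      assume "\<not> \<delta> \<le> norm (g *v v)"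
      then have small: "\<bar>(g *v v) $ i\<bar> < \<delta>" for i
        using component_le_norm_cart[of "g *v v" i] by linarith
      obtain p r q :: int where pq: "v $ 1 = p" "v $ 2 = r" "v $ 3 = q"
        using ints by (metis Ints_cases)
      have "u *v v = vector [form_x (p, r, q) P, form_y (p, r, q) P, of_int (denom (p, r, q))]"
        by (simp add: vec_eq_iff forall_3 u_def u_mat_def matrix_vector_mult_def sum_3 pq
            form_x_def form_y_def denom_def algebra_simps)
      then have gv: "g *v v = diag_flow lam mu t *v vector [form_x (p, r, q) P, form_y (p, r, q) P, of_int (denom (p, r, q))]"
        by (simp add: t(2) matrix_vector_mul_assoc[symmetric])
      have comp: "(g *v v) $ 1 = exp (lam * t) * form_x (p, r, q) P"
        "(g *v v) $ 2 = exp (mu * t) * form_y (p, r, q) P" "(g *v v) $ 3 = exp (- t) * q"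
        unfolding gv by (simp_all add: diag_flow_def matrix_vector_mult_def sum_3 denom_def)
      have c1: "exp (lam * t) * \<bar>form_x (p, r, q) P\<bar> < \<delta>" and c2: "exp (mu * t) * \<bar>form_y (p, r, q) P\<bar> < \<delta>"
        and c3: "exp (- t) * \<bar>of_int q\<bar> < \<delta>"
        using small[of 1] small[of 2] small[of 3] unfolding comp abs_mult by auto
      have e1: "1 \<le> exp (lam * t)" "1 \<le> exp (mu * t)"
        using lm t(1) by auto
      have le1: "\<bar>y\<bar> < \<delta>" if "x * \<bar>y\<bar> < \<delta>" "1 \<le> x" for x y :: real
        using mult_right_mono[OF that(2), of "\<bar>y\<bar>"] that(1) by linarith
      have q0: "0 \<le> q"
        using that(3) pq by simp
      show False
      proof (cases "q = 0")
        case True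
        have "\<bar>real_of_int r\<bar> < 1"
          using le1[OF c2 e1(2)] \<delta> True by (simp add: form_y_def)
        then have r: "r = 0"
          by linarith
        have "\<bar>real_of_int p\<bar> < 1"
          using le1[OF c1 e1(1)] \<delta> True r by (simp add: form_x_def)
        then have "p = 0"
          by linarith
        then have "v = 0"
          using pq True r by (simp add: vec_eq_iff forall_3)
        with that(1) show False
          by simp
      next
        case False
        then have qpos: "0 < q"
          using q0 by simp
        have "real_of_int q < \<delta> * exp t"
          using c3 qpos by (simp add: exp_minus field_simps)
        also have "\<dots> \<le> exp t"
          using \<delta> by simp
        finally have qt: "real_of_int q \<le> exp t"
          by simp
        have key: "\<bar>y\<bar> < \<epsilon> * of_int q powr - s" if "exp (s * t) * \<bar>y\<bar> < \<delta>" "0 \<le> s" for s y :: real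
        proof -
          have "of_int q powr s \<le> exp t powr s"
            using qpos qt that(2) by (intro powr_mono2) auto
          also have "\<dots> = exp (s * t)"
            by (simp add: powr_def)
          finally have "of_int q powr s * \<bar>y\<bar> \<le> exp (s * t) * \<bar>y\<bar>"
            by (rule mult_right_mono) simp
          then have "of_int q powr s * \<bar>y\<bar> < \<epsilon>"
            using that \<delta> by linarith
          then show ?thesis
            using qpos by (simp add: powr_minus field_simps)
        qed
        have "P \<in> danger lam mu \<epsilon> (p, r, q)"
          using key[OF c1 lm(1)] key[OF c2 lm(2)] by (simp add: danger_def denom_def)
        moreover have "0 < denom (p, r, q)"
          using qpos by (simp add: denom_def)
        ultimately show False
          using P by blast
      qed
    qed
    show "\<delta> \<le> norm (g *v v)"
    proof (cases "0 \<le> v $ 3")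
      case True
      then show ?thesis
        using pos v0 ints by blast
    next
      case False
      have "\<delta> \<le> norm (g *v (- v))"
        using False v0 ints by (intro pos) auto
      also have "g *v (- v) = - (g *v v)"
        using matrix_vector_mult_diff_distrib[of g 0 v] by simp
      finally show ?thesis
        by simp
    qed
  qed
  moreover have "u <#\<^bsub>SL3R\<^esub> SL3Z \<in> lcosets\<^bsub>SL3R\<^esub> SL3Z"
    using det_u by (auto simp: LCOSETS_def SL3R_def)
  ultimately show ?thesis
    by (simp add: bounded_orbit_points_def u_def)
qed


section \<open>The chart of the unipotent group\<close>

text \<open>The inverse of the global chart.\<close>

definition U_chart_inv :: "real ^ 3 \<Rightarrow> real ^ 3 ^ 3" where
  "U_chart_inv P = u_mat (P $ 1) (P $ 2) (P $ 3)"

lemma U_chart_inverse [simp]: "U_chart (U_chart_inv P) = P"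
  by (simp add: U_chart_inv_def U_chart_u_mat vec_eq_iff forall_3)

lemma U_chart_inv_inverse: "u \<in> U_group \<Longrightarrow> U_chart_inv (U_chart u) = u"
  by (auto simp: U_group_def U_chart_inv_def U_chart_u_mat)

lemma U_chart_inv_in [simp]: "U_chart_inv P \<in> U_group"
  by (auto simp: U_group_def U_chart_inv_def)

lemma U_chart_image: "U_chart ` U_group = UNIV"
  by (metis U_chart_inverse U_chart_inv_in UNIV_eq_I image_eqI)

lemma continuous_on_vector_3:
  fixes f g h :: "'a::topological_space \<Rightarrow> 'b::{topological_space, zero}"
  assumes "continuous_on S f" "continuous_on S g" "continuous_on S h"
  shows "continuous_on S (\<lambda>x. vector [f x, g x, h x] :: 'b ^ 3)"
proof -
  have eq: "(\<lambda>x. vector [f x, g x, h x] :: 'b ^ 3)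
      = (\<lambda>x. \<chi> i. if i = 1 then f x else if i = 2 then g x else h x)"
    by (simp add: fun_eq_iff vec_eq_iff forall_3)
  have "continuous_on S (\<lambda>x. if i = 1 then f x else if i = 2 then g x else h x)" for i :: 3
    using assms by (cases "i = 1"; cases "i = 2"; simp)
  then show ?thesis
    unfolding eq by (rule continuous_on_vec_lambda)
qed

lemma U_chart_homeomorphism: "homeomorphism U_group UNIV U_chart U_chart_inv"
proof (rule homeomorphismI)
  show "continuous_on U_group U_chart"
    unfolding U_chart_def by (intro continuous_on_vector_3 continuous_intros)
  show "continuous_on UNIV U_chart_inv"
    unfolding U_chart_inv_def u_mat_def by (intro continuous_on_vector_3 continuous_intros)
qed (auto simp: U_chart_inv_inverse)

lemma C1_atlas_U: "C1_atlas U_group U_atlas"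
proof -
  have inj: "inj_on U_chart U_group"
    by (rule inj_on_inverseI[of _ U_chart_inv]) (rule U_chart_inv_inverse)
  have "(U_chart \<circ> the_inv_into U_group U_chart) P = P" for P
    using f_the_inv_into_f[OF inj, of P] U_chart_image by simp
  then have id: "U_chart \<circ> the_inv_into U_group U_chart = (\<lambda>P. P)"
    by blast
  have "C1_on UNIV (\<lambda>P :: real ^ 3. P)"
    unfolding C1_on_def
    by (rule exI[of _ "\<lambda>_. id_blinfun"]) (auto intro: has_derivative_ident simp: id_def[symmetric])
  then show ?thesis
    using U_chart_homeomorphism unfolding C1_atlas_def U_atlas_def
    by (auto simp: U_chart_image id)
qed

theorem theorem3p1:
  fixes lam mu :: real
  assumes "0 \<le> lam" and "0 \<le> mu" and "lam + mu = 1" and "mu \<le> lam"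
  shows "HAW_on_manifold U_group U_atlas
           {u \<in> U_group. u <#\<^bsub>SL3R\<^esub> SL3Z \<in> bounded_orbit_points (F_plus lam mu)}"
proof -
  define S where "S = {u \<in> U_group. u <#\<^bsub>SL3R\<^esub> SL3Z \<in> bounded_orbit_points (F_plus lam mu)}"
  have lam: "1 / 2 \<le> lam"
    using assms by linarith
  have "HAW_on (U_chart ` U_group) (U_chart ` (S \<inter> U_group))"
  proof (rule HAW_on_if_contains_not_danger[OF lam assms(2,3)])
    fix \<epsilon> x assume "0 < \<epsilon>" and x: "\<And>v. 0 < denom v \<Longrightarrow> x \<notin> danger lam mu \<epsilon> v"
    then have "U_chart_inv x \<in> S"
      using bounded_orbit_if_not_danger[OF _ assms(1-3) x] by (simp add: S_def U_chart_inv_def[of x, symmetric])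
    then have "U_chart (U_chart_inv x) \<in> U_chart ` (S \<inter> U_group)"
      by (intro imageI) simp
    then show "x \<in> U_chart ` (S \<inter> U_group)"
      by simp
  qed
  then show ?thesis
    using C1_atlas_U unfolding HAW_on_manifold_def S_def[symmetric]
    by (auto simp: U_atlas_def S_def)
qed

end
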